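(* There exist a hyperbolic automorphism $A:\mathbb{T}^2\to\mathbb{T}^2$ and a $C^\infty$ diffeomorphism $f:\mathbb{T}^3\to\mathbb{T}^3$ which is a partially hyperbolic skew-product over $A$, such that $f$ is accessible and chain transitive, but $f$ is not transitive.
   Context: Here $\mathbb{T}^3=\mathbb{T}^2\times\mathbb{S}^1$, $\mathbb{T}^2=\mathbb{R}^2/\mathbb{Z}^2$, $\mathbb{S}^1=\mathbb{R}/2\mathbb{Z}$, with the standard flat Riemannian metrics and distance $d$. A hyperbolic automorphism $A$ of $\mathbb{T}^2$ is the automorphism induced by a matrix in $GL(2,\mathbb{Z})$ with no eigenvalue of modulus $1$; $\|A\|$ denotes the operator norm. A diffeomorphism $f$ of a closed Riemannian manifold $M$ is partially hyperbolic if $TM=E^{ss}\oplus E^c\oplus E^{uu}$ for three nontrivial $Df$-invariant continuous bundles such that $Df|_{E^{ss}}$ is uniformly contracting, $Df|_{E^{uu}}$ is uniformly expanding, and for all $x\in M$ $$\|Df|_{E^{ss}(x)}\|<\|Df^{-1}|_{E^c(f(x))}\|^{-1},\qquad \|Df|_{E^c(x)}\|<\|Df^{-1}|_{E^{uu}(f(x))}\|^{-1}.$$ There are then unique $f$-invariant foliations $\mathcal{W}^{ss}$ and $\mathcal{W}^{uu}$ tangent to $E^{ss}$ and $E^{uu}$. A partially hyperbolic skew-product over $A$ is a partially hyperbolic diffeomorphism $f:\mathbb{T}^3\to\mathbb{T}^3$ of the form $f(x,t)=(Ax,\varphi_x(t))$ for every $(x,t)\in\mathbb{T}^2\times\mathbb{S}^1$,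 with $\|A^{-1}\|^{-1}<\|\varphi_x'(t)\|<\|A\|$ for every $(x,t)$. A partially hyperbolic diffeomorphism $f$ is accessible if any two points $x,y\in M$ can be joined by an arc consisting of finitely many segments, each contained in a leaf of $\mathcal{W}^{ss}$ or of $\mathcal{W}^{uu}$. For $x,y\in M$, $y$ is chain attainable from $x$ if for every $\epsilon>0$ there are $n\ge 1$ and a finite sequence $x_0=x,x_1,\dots,x_n=y$ in $M$ with $d(f(x_i),x_{i+1})<\epsilon$ for all $0\le i\le n-1$. A point is chain recurrent if it is chain attainable from itself; $f$ is chain transitive if every point of $M$ is chain recurrent. $f$ is transitive if for any two nonempty open sets $U,V\subset M$ there exists $n>0$ with $f^n(U)\cap V\neq\emptyset$. *)

theory Defs
  imports "HOL-Analysis.Analysis"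
begin

section \<open>The flat torus\<close>

definition lattice2 :: "(real^2) set" where
  "lattice2 = {v. \<forall>i. v $ i \<in> \<int>}"

definition lattice1 :: "real set" where
  "lattice1 = {t. t / 2 \<in> \<int>}"

lemma lattice2_add: "u \<in> lattice2 \<Longrightarrow> v \<in> lattice2 \<Longrightarrow> u + v \<in> lattice2"
  by (simp add: lattice2_def)

lemma lattice2_minus: "u \<in> lattice2 \<Longrightarrow> - u \<in> lattice2"
  by (simp add: lattice2_def)

lemma lattice2_0: "0 \<in> lattice2"
  by (simp add: lattice2_def)

lemma closed_lattice2: "closed lattice2"
proof -
  have "lattice2 = (\<Inter>i. (\<lambda>v::real^2. v $ i) -` \<int>)"
    by (auto simp: lattice2_def)
  moreover have "closed ((\<lambda>v::real^2. v $ i) -` \<int>)" for i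
    by (intro closed_vimage closed_Ints continuous_intros)
  ultimately show ?thesis by (metis (no_types, lifting) closed_INT)
qed

lemma lattice1_add: "u \<in> lattice1 \<Longrightarrow> v \<in> lattice1 \<Longrightarrow> u + v \<in> lattice1"
  by (simp add: lattice1_def add_divide_distrib)

lemma lattice1_minus: "u \<in> lattice1 \<Longrightarrow> - u \<in> lattice1"
  by (simp add: lattice1_def)

lemma lattice1_0: "0 \<in> lattice1"
  by (simp add: lattice1_def)

lemma closed_lattice1: "closed lattice1"
proof -
  have "lattice1 = (\<lambda>t::real. t / 2) -` \<int>"
    by (auto simp: lattice1_def)
  moreover have "closed ((\<lambda>t::real. t / 2) -` \<int>)"
    by (intro closed_vimage closed_Ints continuous_intros) auto
  ultimately show ?thesis by simp
qed

quotient_type torus2 = "real^2" / "\<lambda>x y. x - y \<in> lattice2"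
  morphisms rep_torus2 torus2_of
proof (rule equivpI)
  show "reflp (\<lambda>x y. x - y \<in> lattice2)"
    by (simp add: reflp_def lattice2_0)
  show "symp (\<lambda>x y. x - y \<in> lattice2)"
    by (rule sympI) (metis lattice2_minus minus_diff_eq)
  show "transp (\<lambda>x y. x - y \<in> lattice2)"
    by (rule transpI) (metis lattice2_add diff_add_cancel add_diff_eq)
qed

quotient_type circle = real / "\<lambda>s t. s - t \<in> lattice1"
  morphisms rep_circle circle_of
proof (rule equivpI)
  show "reflp (\<lambda>x y. x - y \<in> lattice1)"
    by (simp add: reflp_def lattice1_0)
  show "symp (\<lambda>x y. x - y \<in> lattice1)"
    by (rule sympI) (metis lattice1_minus minus_diff_eq)
  show "transp (\<lambda>x y. x - y \<in> lattice1)"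
    by (rule transpI) (metis lattice1_add diff_add_cancel add_diff_eq)
qed

lemma infdist_subgroup_triangle:
  fixes G :: "'a::real_normed_vector set"
  assumes "\<And>u v. u \<in> G \<Longrightarrow> v \<in> G \<Longrightarrow> u + v \<in> G" and "0 \<in> G"
  shows "infdist (u + v) G \<le> infdist u G + infdist v G"
proof (rule field_le_epsilon)
  fix e :: real assume "e > 0"
  have ne: "G \<noteq> {}" using assms(2) by blast
  obtain a where a: "a \<in> G" "dist u a < infdist u G + e/2"
    using cInf_lessD[of "dist u ` G" "infdist u G + e/2"] \<open>e > 0\<close> ne
    by (auto simp: infdist_def)
  obtain b where b: "b \<in> G" "dist v b < infdist v G + e/2"
    using cInf_lessD[of "dist v ` G" "infdist v G + e/2"] \<open>e > 0\<close> ne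
    by (auto simp: infdist_def)
  have "infdist (u + v) G \<le> dist (u + v) (a + b)"
    using assms(1) a(1) b(1) by (intro infdist_le) auto
  also have "\<dots> \<le> dist u a + dist v b"
    by (rule dist_triangle_add)
  finally show "infdist (u + v) G \<le> infdist u G + infdist v G + e"
    using a b by simp
qed

lemma infdist_subgroup_shift_le:
  fixes G :: "'a::real_normed_vector set"
  assumes "\<And>u v. u \<in> G \<Longrightarrow> v \<in> G \<Longrightarrow> u + v \<in> G" and "0 \<in> G" and "g \<in> G"
  shows "infdist (u + g) G \<le> infdist u G"
  using infdist_subgroup_triangle[OF assms(1,2), of u g] assms(3) by simp

lemma infdist_subgroup_shift:
  fixes G :: "'a::real_normed_vector set"
  assumes "\<And>u v. u \<in> G \<Longrightarrow> v \<in> G \<Longrightarrow> u + v \<in> G" and "0 \<in> G"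
    and "\<And>u. u \<in> G \<Longrightarrow> - u \<in> G" and "u - v \<in> G"
  shows "infdist u G = infdist v G"
proof (rule antisym)
  show "infdist u G \<le> infdist v G"
    using infdist_subgroup_shift_le[OF assms(1,2,4), of v] by simp
  have "v - u \<in> G" using assms(3)[OF assms(4)] by simp
  from infdist_subgroup_shift_le[OF assms(1,2) this, of u]
  show "infdist v G \<le> infdist u G" by simp
qed

lemma infdist_subgroup_minus_le:
  fixes G :: "'a::real_normed_vector set"
  assumes "\<And>u. u \<in> G \<Longrightarrow> - u \<in> G"
  shows "infdist (- u) G \<le> infdist u G"
proof (cases "G = {}")
  case False
  show ?thesis
    unfolding infdist_notempty[OF False, of u]
  proof (rule cINF_greatest[OF False])
    fix a assume "a \<in> G"
    then have "infdist (- u) G \<le> dist (- u) (- a)" by (intro infdist_le assms)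
    then show "infdist (- u) G \<le> dist u a" by (simp add: dist_minus)
  qed
qed (simp add: infdist_def)

lemma infdist_subgroup_minus:
  fixes G :: "'a::real_normed_vector set"
  assumes "\<And>u. u \<in> G \<Longrightarrow> - u \<in> G"
  shows "infdist (- u) G = infdist u G"
  using infdist_subgroup_minus_le[OF assms, where u = u]
    infdist_subgroup_minus_le[OF assms, where u = "- u"] by simp

text \<open>The distance of \<open>[x]\<close> and \<open>[y]\<close> is the minimal Euclidean distance between
  representatives, \<open>INF k. dist (x - y) k\<close> with \<open>k\<close> in the lattice; this is the distance
  of the flat Riemannian metric.\<close>

instantiation torus2 :: metric_space
begin

lift_definition dist_torus2 :: "torus2 \<Rightarrow> torus2 \<Rightarrow> real"
  is "\<lambda>x y. infdist (x - y) lattice2"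
proof -
  fix x x' y y' :: "real^2"
  assume "x - x' \<in> lattice2" "y - y' \<in> lattice2"
  then have "(x - y) - (x' - y') \<in> lattice2"
    using lattice2_add[OF _ lattice2_minus, of "x - x'" "y - y'"] by (simp add: algebra_simps)
  then show "infdist (x - y) lattice2 = infdist (x' - y') lattice2"
    by (intro infdist_subgroup_shift lattice2_add lattice2_0 lattice2_minus)
qed

definition uniformity_torus2 :: "(torus2 \<times> torus2) filter" where
  "uniformity_torus2 = (INF e\<in>{0<..}. principal {(x, y). dist x y < e})"

definition open_torus2 :: "torus2 set \<Rightarrow> bool" where
  "open_torus2 U = (\<forall>x\<in>U. eventually (\<lambda>(x', y). x' = x \<longrightarrow> y \<in> U) uniformity)"

instance
proof
  fix x y z :: torus2
  show "dist x y = 0 \<longleftrightarrow> x = y"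
    by transfer (use closed_lattice2 lattice2_0 in_closed_iff_infdist_zero in blast)
  show "dist x y \<le> dist x z + dist y z"
  proof transfer
    fix x y z :: "real^2"
    have "infdist ((x - z) + (z - y)) lattice2
        \<le> infdist (x - z) lattice2 + infdist (z - y) lattice2"
      by (intro infdist_subgroup_triangle lattice2_add lattice2_0)
    also have "infdist (z - y) lattice2 = infdist (y - z) lattice2"
      using infdist_subgroup_minus[OF lattice2_minus, of "y - z"] by simp
    finally show "infdist (x - y) lattice2
        \<le> infdist (x - z) lattice2 + infdist (y - z) lattice2"
      by simp
  qed
qed (simp_all add: uniformity_torus2_def open_torus2_def)

end

instantiation circle :: metric_space
begin

lift_definition dist_circle :: "circle \<Rightarrow> circle \<Rightarrow> real"
  is "\<lambda>s t. infdist (s - t) lattice1"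
proof -
  fix x x' y y' :: real
  assume "x - x' \<in> lattice1" "y - y' \<in> lattice1"
  then have "(x - y) - (x' - y') \<in> lattice1"
    using lattice1_add[OF _ lattice1_minus, of "x - x'" "y - y'"] by (simp add: algebra_simps)
  then show "infdist (x - y) lattice1 = infdist (x' - y') lattice1"
    by (intro infdist_subgroup_shift lattice1_add lattice1_0 lattice1_minus)
qed

definition uniformity_circle :: "(circle \<times> circle) filter" where
  "uniformity_circle = (INF e\<in>{0<..}. principal {(x, y). dist x y < e})"

definition open_circle :: "circle set \<Rightarrow> bool" where
  "open_circle U = (\<forall>x\<in>U. eventually (\<lambda>(x', y). x' = x \<longrightarrow> y \<in> U) uniformity)"

instance
proof
  fix x y z :: circle
  show "dist x y = 0 \<longleftrightarrow> x = y"
    by transfer (use closed_lattice1 lattice1_0 in_closed_iff_infdist_zero in blast)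
  show "dist x y \<le> dist x z + dist y z"
  proof transfer
    fix x y z :: real
    have "infdist ((x - z) + (z - y)) lattice1
        \<le> infdist (x - z) lattice1 + infdist (z - y) lattice1"
      by (intro infdist_subgroup_triangle lattice1_add lattice1_0)
    also have "infdist (z - y) lattice1 = infdist (y - z) lattice1"
      using infdist_subgroup_minus[OF lattice1_minus, of "y - z"] by simp
    finally show "infdist (x - y) lattice1
        \<le> infdist (x - z) lattice1 + infdist (y - z) lattice1"
      by simp
  qed
qed (simp_all add: uniformity_circle_def open_circle_def)

end

text \<open>The metric of the product type is the square root of the sum of the squares, so
  \<open>torus3\<close> carries the distance of the product Riemannian metric. All tangent
  spaces of \<open>torus3\<close> are identified with \<open>space3\<close> by means of the covering \<open>cover3\<close>.\<close>

type_synonym torus3 = "torus2 \<times> circle"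
type_synonym space3 = "(real^2) \<times> real"

definition cover3 :: "space3 \<Rightarrow> torus3" where
  "cover3 p = (torus2_of (fst p), circle_of (snd p))"


section \<open>Differentiability\<close>

text \<open>Maps between quotients are differentiated through local lifts: in
  \<open>is_lift \<pi> \<pi>' f F S\<close> the maps \<open>\<pi>\<close>, \<open>\<pi>'\<close> are the covering projections
  of domain and codomain (the identity if no quotient is taken). The local inverses of
  \<open>cover3\<close> are the charts of \<open>torus3\<close>, so \<open>F\<close> is \<open>f\<close> in charts. Two local lifts at the same
  point that are continuous there differ only by lattice translations, hence have the same
  derivative, so the \<open>THE\<close> in \<open>cover_deriv\<close> is well defined whenever a
  differentiable lift exists.\<close>

definition is_lift :: "('v \<Rightarrow> 'a) \<Rightarrow> ('w \<Rightarrow> 'b) \<Rightarrow> ('a \<Rightarrow> 'b) \<Rightarrow> ('v \<Rightarrow> 'w) \<Rightarrow> 'v set \<Rightarrow> bool" where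
  "is_lift \<pi> \<pi>' f F S \<longleftrightarrow> (\<forall>q\<in>S. \<pi>' (F q) = f (\<pi> q))"

definition has_cover_deriv ::
  "('v::real_normed_vector \<Rightarrow> 'a) \<Rightarrow> ('w::real_normed_vector \<Rightarrow> 'b) \<Rightarrow>
    ('a \<Rightarrow> 'b) \<Rightarrow> 'a \<Rightarrow> ('v \<Rightarrow> 'w) \<Rightarrow> bool" where
  "has_cover_deriv \<pi> \<pi>' f x L \<longleftrightarrow>
    (\<exists>p F S. \<pi> p = x \<and> open S \<and> p \<in> S \<and> is_lift \<pi> \<pi>' f F S \<and> (F has_derivative L) (at p))"

definition cover_deriv ::
  "('v::real_normed_vector \<Rightarrow> 'a) \<Rightarrow> ('w::real_normed_vector \<Rightarrow> 'b) \<Rightarrow>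
    ('a \<Rightarrow> 'b) \<Rightarrow> 'a \<Rightarrow> 'v \<Rightarrow> 'w" where
  "cover_deriv \<pi> \<pi>' f x = (THE L. has_cover_deriv \<pi> \<pi>' f x L)"

abbreviation D3 :: "(torus3 \<Rightarrow> torus3) \<Rightarrow> torus3 \<Rightarrow> space3 \<Rightarrow> space3" where
  "D3 \<equiv> cover_deriv cover3 cover3"

abbreviation D_circle :: "(circle \<Rightarrow> circle) \<Rightarrow> circle \<Rightarrow> real \<Rightarrow> real" where
  "D_circle \<equiv> cover_deriv circle_of circle_of"

text \<open>Class \<open>C\<^sup>k\<close> on an open set: all iterated directional derivatives up to order
  \<open>k\<close> exist and are continuous.\<close>

fun Ck_on :: "nat \<Rightarrow> ('v::real_normed_vector \<Rightarrow> 'w::real_normed_vector) \<Rightarrow> 'v set \<Rightarrow> bool" where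
  "Ck_on 0 F S \<longleftrightarrow> continuous_on S F"
| "Ck_on (Suc k) F S \<longleftrightarrow> (\<forall>p\<in>S. F differentiable (at p)) \<and>
     (\<forall>v. Ck_on k (\<lambda>p. frechet_derivative F (at p) v) S)"

definition Ck_map :: "nat \<Rightarrow> (torus3 \<Rightarrow> torus3) \<Rightarrow> bool" where
  "Ck_map k f \<longleftrightarrow>
    (\<forall>p. \<exists>S F. open S \<and> p \<in> S \<and> is_lift cover3 cover3 f F S \<and> Ck_on k F S)"

definition Ck_diffeo :: "nat \<Rightarrow> (torus3 \<Rightarrow> torus3) \<Rightarrow> bool" where
  "Ck_diffeo k f \<longleftrightarrow> bij f \<and> Ck_map k f \<and> Ck_map k (inv f)"

definition smooth_diffeo :: "(torus3 \<Rightarrow> torus3) \<Rightarrow> bool" where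
  "smooth_diffeo f \<longleftrightarrow> (\<forall>k. Ck_diffeo k f)"


section \<open>Partial hyperbolicity\<close>

type_synonym subbundle = "torus3 \<Rightarrow> space3 set"

text \<open>Continuity of a subbundle: it has continuous local frames.\<close>

definition continuous_bundle :: "subbundle \<Rightarrow> bool" where
  "continuous_bundle E \<longleftrightarrow>
    (\<forall>x. \<exists>U (n::nat) b. open U \<and> x \<in> U \<and> (\<forall>i<n. continuous_on U (b i)) \<and>
      (\<forall>y\<in>U. inj_on (\<lambda>i. b i y) {..<n} \<and> independent ((\<lambda>i. b i y) ` {..<n}) \<and>
        E y = span ((\<lambda>i. b i y) ` {..<n})))"

definition invariant_bundle :: "(torus3 \<Rightarrow> torus3) \<Rightarrow> subbundle \<Rightarrow> bool" where
  "invariant_bundle f E \<longleftrightarrow> (\<forall>x. D3 f x ` E x = E (f x))"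

definition uniformly_contracting :: "(torus3 \<Rightarrow> torus3) \<Rightarrow> subbundle \<Rightarrow> bool" where
  "uniformly_contracting f E \<longleftrightarrow>
    (\<exists>C>0. \<exists>r. 0 < r \<and> r < 1 \<and>
      (\<forall>n x. \<forall>v\<in>E x. norm (D3 (f ^^ n) x v) \<le> C * r ^ n * norm v))"

definition uniformly_expanding :: "(torus3 \<Rightarrow> torus3) \<Rightarrow> subbundle \<Rightarrow> bool" where
  "uniformly_expanding f E \<longleftrightarrow>
    (\<exists>C>0. \<exists>r. 0 < r \<and> r < 1 \<and>
      (\<forall>n x. \<forall>v\<in>E x. norm v \<le> C * r ^ n * norm (D3 (f ^^ n) x v)))"

text \<open>Operator norm of the restriction of a linear map to a nonzero subspace.\<close>

definition onorm_on :: "space3 set \<Rightarrow> (space3 \<Rightarrow> space3) \<Rightarrow> real" where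
  "onorm_on V L = (SUP v\<in>{v\<in>V. norm v = 1}. norm (L v))"

definition ph_splitting :: "(torus3 \<Rightarrow> torus3) \<Rightarrow> subbundle \<Rightarrow> subbundle \<Rightarrow> subbundle \<Rightarrow> bool" where
  "ph_splitting f Es Ec Eu \<longleftrightarrow>
    (\<forall>E\<in>{Es, Ec, Eu}. continuous_bundle E \<and> invariant_bundle f E \<and> (\<forall>x. E x \<noteq> {0})) \<and>
    (\<forall>x v. \<exists>!(a, b, c). a \<in> Es x \<and> b \<in> Ec x \<and> c \<in> Eu x \<and> v = a + b + c) \<and>
    uniformly_contracting f Es \<and> uniformly_expanding f Eu \<and>
    (\<forall>x. onorm_on (Es x) (D3 f x) < inverse (onorm_on (Ec (f x)) (D3 (inv f) (f x))) \<and>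
         onorm_on (Ec x) (D3 f x) < inverse (onorm_on (Eu (f x)) (D3 (inv f) (f x))))"

definition partially_hyperbolic :: "(torus3 \<Rightarrow> torus3) \<Rightarrow> bool" where
  "partially_hyperbolic f \<longleftrightarrow> Ck_diffeo 1 f \<and> (\<exists>Es Ec Eu. ph_splitting f Es Ec Eu)"


section \<open>Skew products over hyperbolic automorphisms\<close>

definition real_matrix :: "int^2^2 \<Rightarrow> real^2^2" where
  "real_matrix A = (\<chi> i j. of_int (A $ i $ j))"

definition complex_matrix :: "int^2^2 \<Rightarrow> complex^2^2" where
  "complex_matrix A = (\<chi> i j. of_int (A $ i $ j))"

text \<open>\<open>invertible\<close> is invertibility over the integers here, so \<open>A\<close> lies in \<open>GL(2,\<int>)\<close>.\<close>

definition hyperbolic_matrix :: "int^2^2 \<Rightarrow> bool" where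
  "hyperbolic_matrix A \<longleftrightarrow> invertible A \<and>
    (\<forall>l v. v \<noteq> 0 \<and> complex_matrix A *v v = l *s v \<longrightarrow> cmod l \<noteq> 1)"

lemma real_matrix_lattice2: "v \<in> lattice2 \<Longrightarrow> real_matrix A *v v \<in> lattice2"
  by (auto simp: lattice2_def real_matrix_def matrix_vector_mult_def intro!: Ints_sum Ints_mult)

lift_definition toral_map :: "int^2^2 \<Rightarrow> torus2 \<Rightarrow> torus2"
  is "\<lambda>A x. real_matrix A *v x"
  by (metis matrix_vector_mult_diff_distrib real_matrix_lattice2)

definition matrix_norm :: "real^2^2 \<Rightarrow> real" where
  "matrix_norm B = onorm (\<lambda>x. B *v x)"

definition ph_skew_product :: "int^2^2 \<Rightarrow> (torus3 \<Rightarrow> torus3) \<Rightarrow> bool" where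
  "ph_skew_product A f \<longleftrightarrow> partially_hyperbolic f \<and>
    (\<exists>\<phi> :: torus2 \<Rightarrow> circle \<Rightarrow> circle.
      (\<forall>x t. f (x, t) = (toral_map A x, \<phi> x t)) \<and>
      (\<forall>x t. inverse (matrix_norm (matrix_inv (real_matrix A))) < onorm (D_circle (\<phi> x) t) \<and>
             onorm (D_circle (\<phi> x) t) < matrix_norm (real_matrix A)))"


section \<open>Strong foliations and accessibility\<close>

text \<open>A curve in \<open>torus3\<close> of class \<open>C\<^sup>1\<close> on \<open>{-1<..<1}\<close>, regular, with velocity spanning \<open>E\<close>.\<close>

definition integral_curve :: "subbundle \<Rightarrow> (real \<Rightarrow> torus3) \<Rightarrow> bool" where
  "integral_curve E \<gamma> \<longleftrightarrow>
    (\<exists>v. continuous_on {-1<..<1} v \<and>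
      (\<forall>s\<in>{-1<..<1}. has_cover_deriv id cover3 \<gamma> s (\<lambda>r. r *\<^sub>R v s) \<and>
        v s \<noteq> 0 \<and> E (\<gamma> s) = span {v s}))"

text \<open>\<open>W x\<close> is the leaf through \<open>x\<close>. The three bundles of a partially hyperbolic splitting
  in dimension three are line bundles, so only foliations with one-dimensional leaves occur.
  A foliated chart \<open>h\<close> identifies \<open>(-1,1)\<^sup>3\<close> with an open set \<open>U\<close> such that the connected components of
  the intersection of any leaf with \<open>U\<close> are plaques \<open>h ((-1,1) \<times> {z})\<close>. Leaves are required to be path
  connected rather than merely connected: a union of two dense leaves
  is connected in the subspace topology, but must not count as a single leaf.\<close>

definition foliation_tangent :: "(torus3 \<Rightarrow> torus3 set) \<Rightarrow> subbundle \<Rightarrow> bool" where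
  "foliation_tangent W E \<longleftrightarrow>
    (\<forall>x. x \<in> W x \<and> path_connected (W x)) \<and> (\<forall>x. \<forall>y\<in>W x. W y = W x) \<and>
    (\<forall>x. \<exists>U h. open U \<and> x \<in> U \<and>
      (\<exists>g. homeomorphism ({-1<..<1::real} \<times> box (-1) (1::real^2)) U h g) \<and>
      (\<forall>y. components (W y \<inter> U) \<subseteq>
        (\<lambda>z. h ` ({-1<..<1} \<times> {z})) ` box (-1) 1) \<and>
      (\<forall>z\<in>box (-1) 1. integral_curve E (\<lambda>s. h (s, z))))"

definition invariant_foliation ::
  "(torus3 \<Rightarrow> torus3) \<Rightarrow> (torus3 \<Rightarrow> torus3 set) \<Rightarrow> subbundle \<Rightarrow> bool" where
  "invariant_foliation f W E \<longleftrightarrow> foliation_tangent W E \<and> (\<forall>x. f ` W x = W (f x))"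

text \<open>\<open>path_component S x y\<close>: there is a path from \<open>x\<close> to \<open>y\<close> inside \<open>S\<close>.\<close>

definition su_segment ::
  "(torus3 \<Rightarrow> torus3 set) \<Rightarrow> (torus3 \<Rightarrow> torus3 set) \<Rightarrow> torus3 \<Rightarrow> torus3 \<Rightarrow> bool" where
  "su_segment Ws Wu x y \<longleftrightarrow> path_component (Ws x) x y \<or> path_component (Wu x) x y"

text \<open>The splitting and the two foliations are unique, so it does not matter that they are
  quantified existentially.\<close>

definition accessible :: "(torus3 \<Rightarrow> torus3) \<Rightarrow> bool" where
  "accessible f \<longleftrightarrow> partially_hyperbolic f \<and>
    (\<exists>Es Ec Eu Ws Wu. ph_splitting f Es Ec Eu \<and>
      invariant_foliation f Ws Es \<and> invariant_foliation f Wu Eu \<and>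
      (\<forall>x y. (su_segment Ws Wu)\<^sup>*\<^sup>* x y))"


section \<open>Recurrence\<close>

definition chain_attainable :: "('a::metric_space \<Rightarrow> 'a) \<Rightarrow> 'a \<Rightarrow> 'a \<Rightarrow> bool" where
  "chain_attainable f x y \<longleftrightarrow>
    (\<forall>e>0. \<exists>n\<ge>1. \<exists>u :: nat \<Rightarrow> 'a. u 0 = x \<and> u n = y \<and>
      (\<forall>i<n. dist (f (u i)) (u (Suc i)) < e))"

definition chain_recurrent :: "('a::metric_space \<Rightarrow> 'a) \<Rightarrow> 'a \<Rightarrow> bool" where
  "chain_recurrent f x \<longleftrightarrow> chain_attainable f x x"

definition chain_transitive :: "('a::metric_space \<Rightarrow> 'a) \<Rightarrow> bool" where
  "chain_transitive f \<longleftrightarrow> (\<forall>x. chain_recurrent f x)"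

definition topologically_transitive :: "('a::topological_space \<Rightarrow> 'a) \<Rightarrow> bool" where
  "topologically_transitive f \<longleftrightarrow>
    (\<forall>U V. open U \<and> U \<noteq> {} \<and> open V \<and> V \<noteq> {} \<longrightarrow>
      (\<exists>n>0. (f ^^ n) ` U \<inter> V \<noteq> {}))"

end

theory Submission
  imports Defs
begin

text \<open>
  The base map is \<open>A = (5 2; 2 1)\<close>, which is the identity modulo 2, and the fibre maps are
  \<open>t \<mapsto> t + (sin\<^sup>2(\<pi> x\<^sub>1) cos(\<pi> t) + sin\<^sup>2(\<pi> x\<^sub>2) sin(\<pi> t)) / 100\<close>. They push \<open>t = 0\<close> up and \<open>t = 1\<close> down,
  so \<open>\<T>\<^sup>2 \<times> (0,1)\<close> is forward invariant and \<open>f\<close> is not transitive. The fibre over \<open>0\<close> is pointwise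
  fixed, and the stable and unstable lines of lattice points are dense; hence every point has chains
  to and from this fibre, and \<open>f\<close> is chain transitive.

  Holonomies are geometric limits of \<open>(\<phi>\<^sup>n\<^bsub>y\<^esub>)\<^sup>-\<^sup>1 \<circ> \<phi>\<^sup>n\<^bsub>x\<^esub>\<close>, and their derivatives span the strong bundles;
  the unstable ones are the stable ones of the inverse. If some holonomy around a
  quadrilateral based at \<open>(0,t)\<close> moves \<open>t\<close>, the accessibility class of \<open>(0,t)\<close> is open in the fibre. Otherwise
  there is a saturated graph \<open>w\<close> over the universal cover of \<open>\<T>\<^sup>2\<close>, invariant under the lift of \<open>f\<close>. At the
  fixed points \<open>(1/2,0)\<close> and \<open>(0,1/2)\<close> of \<open>A\<close> invariance forces \<open>w \<in> 1/2 + \<int>\<close> and \<open>w \<in> \<int>\<close> respectively, but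
  \<open>w\<close> varies too little between them. So all classes in the fibre are open, and there is only one.
\<close>

section \<open>The covering of the torus\<close>

text \<open>The argument about \<open>w\<close> lives on the universal cover because there
  \<open>w\<close> is real-valued: holonomies are increasing, so saturated graphs are ordered by
  their values over 0, and two that meet coincide. Invariance follows: the lift of \<open>f\<close>
  permutes saturated graphs, and since it fixes the fibre over 0 pointwise, the image graph meets
  the old one there. The obstacle is that a half-integer point q is fixed only modulo the lattice: A
  q = q + k, so invariance speaks about w(q + k). Periodicity of \<open>w\<close> under k comes from
  j = 2 q, a lattice point with A j = j + 2 k whose fibre is pointwise fixed: this gives period 2 k,
  and the order of the reals improves it to k. The congruence modulo 2 is what makes k integral. The
  perturbation is made for these points: both squared sines vanish on the lattice, exactly one
  survives at each of the two half-integer points, and the zeros of cos(pi t) and sin(pi t) are 1/2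
  apart. The factor 1/100 keeps fibre derivatives in [0.92, 1.08], far from the base rate
  \<open>mu\<close> < 0.18, and lets a holonomy move points by at most a quarter of its base
  parameter.\<close>

lemma torus2_of_eq_iff: "torus2_of x = torus2_of y \<longleftrightarrow> x - y \<in> lattice2"
  by (rule torus2.abs_eq_iff)

lemma circle_of_eq_iff: "circle_of x = circle_of y \<longleftrightarrow> x - y \<in> lattice1"
  by (rule circle.abs_eq_iff)

lemma torus2_of_rep [simp]: "torus2_of (rep_torus2 x) = x"
  by (rule Quotient3_abs_rep[OF Quotient3_torus2])

lemma circle_of_rep [simp]: "circle_of (rep_circle x) = x"
  by (rule Quotient3_abs_rep[OF Quotient3_circle])

lemma dist_torus2_of: "dist (torus2_of x) (torus2_of y) = infdist (x - y) lattice2"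
  by (rule dist_torus2.abs_eq)

lemma dist_circle_of: "dist (circle_of x) (circle_of y) = infdist (x - y) lattice1"
  by (rule dist_circle.abs_eq)

lemma dist_torus2_of_le: "dist (torus2_of x) (torus2_of y) \<le> dist x y"
  using infdist_le[OF lattice2_0, of "x - y"] by (simp add: dist_torus2_of dist_norm)

lemma dist_circle_of_le: "dist (circle_of x) (circle_of y) \<le> dist x y"
  using infdist_le[OF lattice1_0, of "x - y"] by (simp add: dist_circle_of dist_norm)

lemma dist_torus2_attained: "\<exists>y'. torus2_of y' = y \<and> dist x y' = dist (torus2_of x) y"
proof -
  obtain k where k: "k \<in> lattice2" "infdist (x - rep_torus2 y) lattice2 = dist (x - rep_torus2 y) k"
    using infdist_attains_inf[OF closed_lattice2] lattice2_0 by blast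
  have "dist (torus2_of x) y = dist (torus2_of x) (torus2_of (rep_torus2 y))" by simp
  also have "\<dots> = dist x (rep_torus2 y + k)"
    unfolding dist_torus2_of k by (simp add: dist_norm algebra_simps)
  finally have "dist x (rep_torus2 y + k) = dist (torus2_of x) y" by simp
  moreover have "torus2_of (rep_torus2 y + k) = torus2_of (rep_torus2 y)"
    unfolding torus2_of_eq_iff using k(1) by simp
  ultimately show ?thesis by auto
qed

lemma dist_circle_attained: "\<exists>y'. circle_of y' = y \<and> dist x y' = dist (circle_of x) y"
proof -
  obtain k where k: "k \<in> lattice1" "infdist (x - rep_circle y) lattice1 = dist (x - rep_circle y) k"
    using infdist_attains_inf[OF closed_lattice1] lattice1_0 by blast
  have "dist (circle_of x) y = dist (circle_of x) (circle_of (rep_circle y))" by simp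
  also have "\<dots> = dist x (rep_circle y + k)"
    unfolding dist_circle_of k by (simp add: dist_norm algebra_simps)
  finally have "dist x (rep_circle y + k) = dist (circle_of x) y" by simp
  moreover have "circle_of (rep_circle y + k) = circle_of (rep_circle y)"
    unfolding circle_of_eq_iff using k(1) by simp
  ultimately show ?thesis by auto
qed

definition lattice3 :: "space3 set" where
  "lattice3 = lattice2 \<times> lattice1"

lemma lattice3_add: "u \<in> lattice3 \<Longrightarrow> v \<in> lattice3 \<Longrightarrow> u + v \<in> lattice3"
  by (auto simp: lattice3_def lattice2_add lattice1_add)

lemma lattice3_minus: "u \<in> lattice3 \<Longrightarrow> - u \<in> lattice3"
  by (auto simp: lattice3_def lattice2_minus lattice1_minus)

lemma lattice3_diff: "u \<in> lattice3 \<Longrightarrow> v \<in> lattice3 \<Longrightarrow> u - v \<in> lattice3"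
  using lattice3_add[of u "- v"] lattice3_minus[of v] by simp

lemma Ints_abs_less_1: "(a::real) \<in> \<int> \<Longrightarrow> \<bar>a\<bar> < 1 \<Longrightarrow> a = 0"
  by (auto elim!: Ints_cases)

lemma lattice2_discrete: "v \<in> lattice2 \<Longrightarrow> (\<And>i. \<bar>v $ i\<bar> < 1) \<Longrightarrow> v = 0"
  by (auto simp: lattice2_def vec_eq_iff intro!: Ints_abs_less_1)

lemma lattice1_discrete: "t \<in> lattice1 \<Longrightarrow> \<bar>t\<bar> < 2 \<Longrightarrow> t = 0"
  using Ints_abs_less_1[of "t / 2"] by (auto simp: lattice1_def)

lemma lattice3_discrete:
  assumes "v \<in> lattice3" "norm v < 1"
  shows "v = 0"
proof -
  have "norm (fst v) < 1" "norm (snd v) < 1"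
    using assms(2) norm_fst_le[of "fst v" "snd v"] norm_snd_le[of "snd v" "fst v"]
    by (simp_all del: norm_fst_le norm_snd_le)
  moreover have "\<bar>fst v $ i\<bar> \<le> norm (fst v)" for i by (rule component_le_norm_cart)
  ultimately have "\<bar>fst v $ i\<bar> < 1" "\<bar>snd v\<bar> < 2" for i
    by (auto intro: order_le_less_trans)
  then have "fst v = 0" "snd v = 0"
    using assms(1) lattice2_discrete[of "fst v"] lattice1_discrete[of "snd v"]
    by (auto simp: lattice3_def)
  then show ?thesis by (simp add: prod_eq_iff)
qed

lemma cover3_eq_iff: "cover3 p = cover3 q \<longleftrightarrow> p - q \<in> lattice3"
  by (cases p; cases q) (simp add: cover3_def torus2_of_eq_iff circle_of_eq_iff lattice3_def)

definition rep3 :: "torus3 \<Rightarrow> space3" where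
  "rep3 y = (rep_torus2 (fst y), rep_circle (snd y))"

lemma cover3_rep3 [simp]: "cover3 (rep3 y) = y"
  by (simp add: rep3_def cover3_def)

lemma cover3_cases: obtains p where "y = cover3 p"
  by (metis cover3_rep3)

lemma dist_cover3_le: "dist (cover3 p) (cover3 q) \<le> dist p q"
  unfolding cover3_def dist_prod_def fst_conv snd_conv
  by (intro real_sqrt_le_mono add_mono power_mono dist_torus2_of_le dist_circle_of_le zero_le_dist)

text \<open>Nearest representatives can be chosen in each factor separately. Small balls therefore
  lift, which makes \<open>cover3\<close> open and lets continuity descend to the torus.\<close>

lemma dist_cover3_attained: "\<exists>q. cover3 q = y \<and> dist p q = dist (cover3 p) y"
proof -
  obtain a where "torus2_of a = fst y" "dist (fst p) a = dist (torus2_of (fst p)) (fst y)"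
    using dist_torus2_attained by blast
  moreover obtain b where "circle_of b = snd y" "dist (snd p) b = dist (circle_of (snd p)) (snd y)"
    using dist_circle_attained by blast
  ultimately show ?thesis
    by (intro exI[of _ "(a, b)"]) (simp add: cover3_def dist_prod_def prod_eq_iff)
qed

lemma continuous_on_cover3 [continuous_intros]:
  assumes "continuous_on S g"
  shows "continuous_on S (\<lambda>x. cover3 (g x))"
proof -
  have "continuous_on UNIV cover3"
    unfolding continuous_on_iff by (metis dist_cover3_le order_le_less_trans)
  from continuous_on_compose2[OF this assms] show ?thesis by simp
qed

lemma open_cover3:
  assumes "open S"
  shows "open (cover3 ` S)"
  unfolding open_dist
proof (intro ballI)
  fix y assume "y \<in> cover3 ` S"
  then obtain p where p: "p \<in> S" "y = cover3 p" by blast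
  then obtain d where d: "d > 0" "\<And>q. dist q p < d \<Longrightarrow> q \<in> S"
    using assms by (metis open_dist)
  have "z \<in> cover3 ` S" if "dist z y < d" for z
  proof -
    obtain q where q: "cover3 q = z" "dist p q = dist (cover3 p) z"
      using dist_cover3_attained by blast
    then have "q \<in> S" using that p d(2)[of q] by (simp add: dist_commute)
    with q show ?thesis by blast
  qed
  with d(1) show "\<exists>e>0. \<forall>z. dist z y < e \<longrightarrow> z \<in> cover3 ` S" by blast
qed

lemma continuous_on_descend:
  fixes g :: "torus3 \<Rightarrow> 'a::metric_space"
  assumes "continuous_on UNIV (\<lambda>p. g (cover3 p))"
  shows "continuous_on UNIV g"
  unfolding continuous_on_iff
proof (intro ballI allI impI)
  fix y :: torus3 and e :: real assume "e > 0"
  obtain p where p: "y = cover3 p" by (rule cover3_cases)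
  from assms \<open>e > 0\<close> obtain d where d: "d > 0" "\<And>q. dist q p < d \<Longrightarrow> dist (g (cover3 q)) (g y) < e"
    unfolding continuous_on_iff p by blast
  have "dist (g z) (g y) < e" if "dist z y < d" for z
  proof -
    obtain q where q: "cover3 q = z" "dist p q = dist (cover3 p) z"
      using dist_cover3_attained by blast
    then show ?thesis using that p d(2)[of q] by (simp add: dist_commute)
  qed
  with d(1) show "\<exists>d>0. \<forall>z\<in>UNIV. dist z y < d \<longrightarrow> dist (g z) (g y) < e" by blast
qed

text \<open>Once both lifts are moved to the same base point, their difference has values in a
  discrete group and is constant nearby. This justifies the \<open>THE\<close> in
  \<open>cover_deriv\<close>.\<close>

lemma has_cover_deriv_unique:
  fixes \<pi> :: "'v::real_normed_vector \<Rightarrow> 'a" and \<pi>' :: "'w::real_normed_vector \<Rightarrow> 'b"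
  assumes cov: "\<And>p q. \<pi> p = \<pi> q \<longleftrightarrow> p - q \<in> \<Gamma>" "\<And>p q. \<pi>' p = \<pi>' q \<longleftrightarrow> p - q \<in> \<Gamma>'"
    and diff: "\<And>u v. u \<in> \<Gamma>' \<Longrightarrow> v \<in> \<Gamma>' \<Longrightarrow> u - v \<in> \<Gamma>'"
    and discr: "\<And>u. u \<in> \<Gamma>' \<Longrightarrow> norm u < 1 \<Longrightarrow> u = 0"
    and L: "has_cover_deriv \<pi> \<pi>' f x L" and M: "has_cover_deriv \<pi> \<pi>' f x M"
  shows "L = M"
proof -
  obtain p F S where p: "\<pi> p = x" "open S" "p \<in> S" "is_lift \<pi> \<pi>' f F S" "(F has_derivative L) (at p)"
    using L unfolding has_cover_deriv_def by blast
  obtain p' F' S' where p': "\<pi> p' = x" "open S'" "p' \<in> S'" "is_lift \<pi> \<pi>' f F' S'"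
      "(F' has_derivative M) (at p')"
    using M unfolding has_cover_deriv_def by blast
  define H where "H q = F' (q + (p' - p))" for q
  have H: "(H has_derivative M) (at p)"
  proof -
    have "((\<lambda>q. q + (p' - p)) has_derivative (\<lambda>v. v)) (at p)"
      by (auto intro!: derivative_eq_intros)
    from has_derivative_compose[OF this, of F' M] p'(5) show ?thesis
      by (simp add: H_def[abs_def])
  qed
  define D where "D q = H q - F q" for q
  have cont: "isCont D p"
    unfolding D_def by (intro continuous_diff has_derivative_continuous[OF H] has_derivative_continuous[OF p(5)])
  have "open (S \<inter> (\<lambda>q. q + (p' - p)) -` S')"
    by (intro open_Int open_vimage p p' continuous_intros)
  moreover have "p \<in> S \<inter> (\<lambda>q. q + (p' - p)) -` S'"
    using p(3) p'(3) by simp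
  ultimately have ev1: "eventually (\<lambda>q. q \<in> S \<inter> (\<lambda>q. q + (p' - p)) -` S') (nhds p)"
    by (rule eventually_nhds_in_open)
  have D_lat: "D q \<in> \<Gamma>'" if "q \<in> S" "q + (p' - p) \<in> S'" for q
  proof -
    have "p' - p \<in> \<Gamma>" using p(1) p'(1) cov(1) by metis
    then have "\<pi> (q + (p' - p)) = \<pi> q" using cov(1) by simp
    then have "\<pi>' (H q) = \<pi>' (F q)"
      using that p(4) p'(4) by (simp add: is_lift_def H_def)
    then show ?thesis using cov(2) by (simp add: D_def)
  qed
  \<comment> \<open>Continuity of \<open>D\<close> is available at \<open>p\<close> only, but
    discreteness still turns closeness to \<open>D p\<close> into equality with
    \<open>D p\<close>.\<close>
  have "eventually (\<lambda>q. dist (D q) (D p) < 1) (nhds p)"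
    using cont unfolding isCont_def tendsto_at_iff_tendsto_nhds by (rule tendstoD) simp
  with ev1 have "eventually (\<lambda>q. H q - D p = F q) (nhds p)"
  proof eventually_elim
    case (elim q)
    have "D q - D p \<in> \<Gamma>'"
      using elim p(3) p'(3) by (intro diff D_lat) auto
    then have "D q - D p = 0" using elim by (intro discr) (auto simp: dist_norm)
    then show ?case by (simp add: D_def algebra_simps)
  qed
  moreover have "((\<lambda>q. H q - D p) has_derivative M) (at p)"
    using has_derivative_diff[OF H has_derivative_const[of "D p"]] by simp
  ultimately have "(F has_derivative M) (at p)"
    using has_derivative_transform_eventually[of "\<lambda>q. H q - D p" M p UNIV F]
    unfolding eventually_nhds_conv_at by simp
  from has_derivative_unique[OF p(5) this] show ?thesis .
qed

lemma has_cover_derivI: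
  assumes "\<And>q. \<pi>' (F q) = f (\<pi> q)" and "(F has_derivative L) (at p)"
  shows "has_cover_deriv \<pi> \<pi>' f (\<pi> p) L"
  unfolding has_cover_deriv_def is_lift_def using assms by (intro exI[of _ p] exI[of _ F] exI[of _ UNIV]) auto

lemma D3_eq:
  assumes "\<And>q. cover3 (F q) = f (cover3 q)" and "(F has_derivative L) (at p)"
  shows "D3 f (cover3 p) = L"
proof -
  have "has_cover_deriv cover3 cover3 f (cover3 p) L"
    using assms by (rule has_cover_derivI)
  then show ?thesis
    unfolding cover_deriv_def
    by (intro the_equality has_cover_deriv_unique[OF cover3_eq_iff cover3_eq_iff lattice3_diff
          lattice3_discrete])
qed

lemma D_circle_eq:
  assumes "\<And>q. circle_of (F q) = f (circle_of q)" and "(F has_derivative L) (at p)"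
  shows "D_circle f (circle_of p) = L"
proof -
  have diff: "u - v \<in> lattice1" if "u \<in> lattice1" "v \<in> lattice1" for u v
    using lattice1_add[OF that(1) lattice1_minus[OF that(2)]] by simp
  have discr: "u = 0" if "u \<in> lattice1" "norm u < 1" for u
    using lattice1_discrete[of u] that by auto
  have "has_cover_deriv circle_of circle_of f (circle_of p) L"
    using assms by (rule has_cover_derivI)
  then show ?thesis
    unfolding cover_deriv_def
    by (intro the_equality has_cover_deriv_unique[OF circle_of_eq_iff circle_of_eq_iff diff discr])
qed


section \<open>Stable holonomies of a skew product\<close>

lemma geometric_limit:
  fixes a :: "nat \<Rightarrow> real"
  assumes step: "\<And>n. \<bar>a (Suc n) - a n\<bar> \<le> B * r ^ n" and r: "0 \<le> r" "r < 1"
  shows "a \<longlonglongrightarrow> lim a" and "\<bar>a n - lim a\<bar> \<le> B / (1 - r) * r ^ n"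
proof -
  \<comment> \<open>Keeping the term \<open>r ^ (n + k)\<close> lets the induction close with an
    exact identity; \<open>le\<close> drops it afterwards.\<close>
  have part: "\<bar>a (n + k) - a n\<bar> \<le> B / (1 - r) * (r ^ n - r ^ (n + k))" for n k
  proof (induction k)
    case (Suc k)
    have "\<bar>a (n + Suc k) - a n\<bar> \<le> \<bar>a (n + k) - a n\<bar> + \<bar>a (Suc (n + k)) - a (n + k)\<bar>"
      by simp
    also have "\<dots> \<le> B / (1 - r) * (r ^ n - r ^ (n + k)) + B * r ^ (n + k)"
      by (intro add_mono Suc step)
    also have "\<dots> = B / (1 - r) * (r ^ n - r ^ (n + Suc k))"
      using r by (simp add: field_simps)
    finally show ?case .
  qed simp
  have B: "0 \<le> B" using step[of 0] by simp
  have le: "\<bar>a (n + k) - a n\<bar> \<le> B / (1 - r) * r ^ n" for n k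
  proof -
    have "B / (1 - r) * (r ^ n - r ^ (n + k)) \<le> B / (1 - r) * r ^ n"
      using B r by (intro mult_left_mono) auto
    with part[of n k] show ?thesis by linarith
  qed
  have "(\<lambda>n. B / (1 - r) * r ^ n) \<longlonglongrightarrow> B / (1 - r) * 0"
    using r by (intro tendsto_mult_left LIMSEQ_realpow_zero)
  then have null: "(\<lambda>n. B / (1 - r) * r ^ n) \<longlonglongrightarrow> 0" by simp
  have "Cauchy a"
  proof (rule CauchyI')
    fix e :: real assume "e > 0"
    then obtain M where M: "B / (1 - r) * r ^ n < e" if "n \<ge> M" for n
      using order_tendstoD(2)[OF null \<open>e > 0\<close>] by (auto simp: eventually_sequentially)
    have "dist (a i) (a j) < e" if "M \<le> i" "i < j" for i j
      using le[of i "j - i"] M[OF that(1)] that(2) by (simp add: dist_real_def abs_minus_commute)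
    then show "\<exists>M. \<forall>i\<ge>M. \<forall>j>i. dist (a i) (a j) < e" by blast
  qed
  then show conv: "a \<longlonglongrightarrow> lim a"
    using convergent_LIMSEQ_iff Cauchy_convergent by blast
  have "(\<lambda>k. \<bar>a (k + n) - a n\<bar>) \<longlonglongrightarrow> \<bar>lim a - a n\<bar>"
    by (intro tendsto_intros LIMSEQ_ignore_initial_segment conv)
  from LIMSEQ_le_const2[OF this, of "B / (1 - r) * r ^ n"] le[of n]
  show "\<bar>a n - lim a\<bar> \<le> B / (1 - r) * r ^ n"
    by (simp add: add.commute abs_minus_commute)
qed

lemma uniform_limit_geometric:
  fixes f :: "nat \<Rightarrow> 'a \<Rightarrow> real"
  assumes "\<And>n x. x \<in> S \<Longrightarrow> \<bar>f n x - l x\<bar> \<le> K * r ^ n" and r: "0 \<le> r" "r < 1"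
  shows "uniform_limit S f l sequentially"
proof (rule uniform_limitI)
  fix e :: real assume "e > 0"
  have "(\<lambda>n. K * r ^ n) \<longlonglongrightarrow> K * 0"
    using r by (intro tendsto_mult_left LIMSEQ_realpow_zero)
  then have "eventually (\<lambda>n. K * r ^ n < e) sequentially"
    using order_tendstoD(2)[of _ 0 sequentially e] \<open>e > 0\<close> by simp
  then show "eventually (\<lambda>n. \<forall>x\<in>S. dist (f n x) (l x) < e) sequentially"
    by (rule eventually_mono) (auto simp: dist_real_def intro: order_le_less_trans assms(1))
qed

text \<open>\<open>P x\<close> is the lift of the fibre map over \<open>x\<close>, \<open>Q x\<close> its inverse, \<open>e\<close> the contracted direction
  of the base map \<open>L\<close>, \<open>e'\<close> a complementary direction, and \<open>ca\<close>, \<open>cb\<close> are the coordinates in the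
  basis \<open>e\<close>, \<open>e'\<close>.\<close>

locale stable_skew =
  fixes L :: "real^2 \<Rightarrow> real^2" and P Q :: "real^2 \<Rightarrow> real \<Rightarrow> real"
    and dQ :: "space3 \<Rightarrow> space3 \<Rightarrow> real"
    and e e' :: "real^2" and ca cb :: "real^2 \<Rightarrow> real" and \<mu> m C :: real
  assumes linear_L: "linear L" and L_e: "L e = \<mu> *\<^sub>R e" and mu_pos: "0 < \<mu>"
    and P_Q: "P x (Q x t) = t" and Q_P: "Q x (P x t) = t"
    and cont_P_aux: "continuous_on UNIV (\<lambda>p. P (fst p) (snd p))"
    and dQ: "((\<lambda>p. Q (fst p) (snd p)) has_derivative dQ p) (at p)"
    and cont_dQ: "continuous_on UNIV (\<lambda>p. dQ p v)"
    and dQ_fiber: "\<bar>dQ p (0, 1)\<bar> \<le> m" and dQ_base: "\<bar>dQ p (e, 0)\<bar> \<le> C"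
    and mu_m: "\<mu> * m < 1"
    and L_lattice: "k \<in> lattice2 \<Longrightarrow> L k \<in> lattice2"
    and P_base_periodic: "k \<in> lattice2 \<Longrightarrow> P (x + k) t = P x t"
    and P_fiber_periodic: "j \<in> lattice1 \<Longrightarrow> P x (t + j) = P x t + j"
    and linear_ca: "linear ca" and linear_cb: "linear cb"
    and ca_e: "ca e = 1" and ca_e': "ca e' = 0" and cb_e: "cb e = 0" and cb_e': "cb e' = 1"
    and basis_expansion: "ca x *\<^sub>R e + cb x *\<^sub>R e' = x"
begin

abbreviation "\<kappa> \<equiv> \<mu> * m"

lemma m_nonneg: "0 \<le> m"
  using dQ_fiber[of undefined] by linarith

lemma C_nonneg: "0 \<le> C"
  using dQ_base[of undefined] by linarith

lemma kappa_nonneg: "0 \<le> \<kappa>"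
  using mu_pos m_nonneg by simp

lemma linear_dQ: "linear (dQ p)"
  using has_derivative_linear[OF dQ] .

lemma dQ_scaled: "dQ p (r *\<^sub>R e, r * c) = r * dQ p (e, c)"
  using linear_scale[OF linear_dQ, of p r "(e, c)"] by simp

lemma dQ_split: "dQ p (e, c) = dQ p (e, 0) + c * dQ p (0, 1)"
  using linear_add[OF linear_dQ, of p "(e, 0)" "c *\<^sub>R (0, 1)"]
    linear_scale[OF linear_dQ, of p c "(0, 1)"] by simp

lemma cont_Q [continuous_intros]:
  assumes "continuous_on S f" "continuous_on S g"
  shows "continuous_on S (\<lambda>z. Q (f z) (g z))"
proof -
  have "continuous_on UNIV (\<lambda>p. Q (fst p) (snd p))"
    by (rule has_derivative_continuous_on) (rule has_derivative_at_withinI[OF dQ])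
  from continuous_on_compose2[OF this continuous_on_Pair[OF assms]] show ?thesis by simp
qed

lemma cont_P [continuous_intros]:
  assumes "continuous_on S f" "continuous_on S g"
  shows "continuous_on S (\<lambda>z. P (f z) (g z))"
  using continuous_on_compose2[OF cont_P_aux continuous_on_Pair[OF assms]] by simp

lemma cont_L [continuous_intros]:
  "continuous_on S f \<Longrightarrow> continuous_on S (\<lambda>z. L (f z))"
  by (rule continuous_on_compose2[OF linear_continuous_on[OF iffD2[OF linear_linear linear_L]]]) auto

lemma cont_ca [continuous_intros]:
  "continuous_on S f \<Longrightarrow> continuous_on S (\<lambda>z. ca (f z))"
  by (rule continuous_on_compose2[OF linear_continuous_on[OF iffD2[OF linear_linear linear_ca]]]) auto

lemma cont_cb [continuous_intros]:
  "continuous_on S f \<Longrightarrow> continuous_on S (\<lambda>z. cb (f z))"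
  by (rule continuous_on_compose2[OF linear_continuous_on[OF iffD2[OF linear_linear linear_cb]]]) auto

lemma cont_dQ_apply:
  assumes "continuous_on S f" "continuous_on S g"
  shows "continuous_on S (\<lambda>z. dQ (f z) (e, g z))"
proof -
  have "continuous_on S (\<lambda>z. dQ (f z) v)" for v
    using continuous_on_compose2[OF cont_dQ assms(1)] by simp
  then show ?thesis
    by (subst dQ_split) (intro continuous_intros assms)
qed

lemma Q_lipschitz: "\<bar>Q x t - Q x t'\<bar> \<le> m * \<bar>t - t'\<bar>"
proof -
  have der: "((\<lambda>u. Q x u) has_derivative (\<lambda>r. dQ (x, u) (0, r))) (at u)" for u
  proof -
    have "((\<lambda>u. (x, u)) has_derivative (\<lambda>r. (0, r))) (at u)"
      by (auto intro!: derivative_eq_intros)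
    from has_derivative_compose[OF this, of "\<lambda>p. Q (fst p) (snd p)" "dQ (x, u)"] show ?thesis
      using dQ by simp
  qed
  have "onorm (\<lambda>r. dQ (x, u) (0, r)) \<le> m" for u
  proof (rule onorm_le)
    fix r :: real
    have "dQ (x, u) (0, r) = r * dQ (x, u) (0, 1)"
      using linear_scale[OF linear_dQ, of "(x, u)" r "(0, 1)"] by simp
    then show "norm (dQ (x, u) (0, r)) \<le> m * norm r"
      using mult_left_mono[OF dQ_fiber[of "(x, u)"], of "\<bar>r\<bar>"] by (simp add: abs_mult mult.commute)
  qed
  from differentiable_bound[OF convex_UNIV der this, of t t'] show ?thesis by simp
qed

lemma Q_lipschitz_base: "\<bar>Q (x + s *\<^sub>R e) t - Q x t\<bar> \<le> C * \<bar>s\<bar>"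
proof -
  have der: "((\<lambda>s. Q (x + s *\<^sub>R e) t) has_derivative (\<lambda>r. dQ (x + s *\<^sub>R e, t) (r *\<^sub>R e, 0))) (at s)" for s
  proof -
    have "((\<lambda>s. (x + s *\<^sub>R e, t)) has_derivative (\<lambda>r. (r *\<^sub>R e, 0))) (at s)"
      by (auto intro!: derivative_eq_intros)
    from has_derivative_compose[OF this, of "\<lambda>p. Q (fst p) (snd p)" "dQ (x + s *\<^sub>R e, t)"] show ?thesis
      using dQ by simp
  qed
  have "onorm (\<lambda>r. dQ (x + s *\<^sub>R e, t) (r *\<^sub>R e, 0)) \<le> C" for s
  proof (rule onorm_le)
    fix r :: real
    show "norm (dQ (x + s *\<^sub>R e, t) (r *\<^sub>R e, 0)) \<le> C * norm r"
      using mult_left_mono[OF dQ_base[of "(x + s *\<^sub>R e, t)"], of "\<bar>r\<bar>"]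
        dQ_scaled[of "(x + s *\<^sub>R e, t)" r 0]
      by (simp add: abs_mult mult.commute)
  qed
  from differentiable_bound[OF convex_UNIV der this, of s 0] show ?thesis by simp
qed

text \<open>\<open>th n s x t\<close> is \<open>(P\<^sup>n\<^bsub>x + s e\<^esub>)\<^sup>-\<^sup>1 (P\<^sup>n\<^bsub>x\<^esub> t)\<close>, where \<open>P\<^sup>n\<close> is the cocycle of fibre maps; it
  converges to the holonomy from the fibre over \<open>x\<close> to the fibre over \<open>x + s e\<close>.\<close>

primrec th :: "nat \<Rightarrow> real \<Rightarrow> real^2 \<Rightarrow> real \<Rightarrow> real" where
  "th 0 s x t = t"
| "th (Suc n) s x t = Q (x + s *\<^sub>R e) (th n (\<mu> * s) (L x) (P x t))"

definition theta :: "real \<Rightarrow> real^2 \<Rightarrow> real \<Rightarrow> real" where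
  "theta s x t = lim (\<lambda>n. th n s x t)"

lemma L_line: "L (x + s *\<^sub>R e) = L x + (\<mu> * s) *\<^sub>R e"
  by (simp add: linear_add[OF linear_L] linear_scale[OF linear_L] L_e mult.commute)

text \<open>Each step shrinks the base displacement by \<open>\<mu>\<close> while pulling back
  through \<open>Q\<close> expands by at most \<open>m\<close>. The domination hypothesis
  \<open>\<mu> * m < 1\<close> thus gives geometric convergence.\<close>

lemma th_step: "\<bar>th (Suc n) s x t - th n s x t\<bar> \<le> C * \<bar>s\<bar> * \<kappa> ^ n"
proof (induction n arbitrary: s x t)
  case 0
  show ?case using Q_lipschitz_base[of x s "P x t"] by (simp add: Q_P)
next
  case (Suc n)
  have "\<bar>th (Suc (Suc n)) s x t - th (Suc n) s x t\<bar>
      \<le> m * \<bar>th (Suc n) (\<mu> * s) (L x) (P x t) - th n (\<mu> * s) (L x) (P x t)\<bar>"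
    unfolding th.simps(2)[of "Suc n"] th.simps(2)[of n s x t] by (rule Q_lipschitz)
  also have "\<dots> \<le> m * (C * \<bar>\<mu> * s\<bar> * \<kappa> ^ n)"
    by (intro mult_left_mono Suc m_nonneg)
  also have "\<dots> = C * \<bar>s\<bar> * \<kappa> ^ Suc n"
    using mu_pos by (simp add: abs_mult)
  finally show ?case .
qed

lemma th_tendsto: "(\<lambda>n. th n s x t) \<longlonglongrightarrow> theta s x t"
  unfolding theta_def by (rule geometric_limit(1)[OF th_step kappa_nonneg mu_m])

lemma th_tail: "\<bar>th n s x t - theta s x t\<bar> \<le> C * \<bar>s\<bar> / (1 - \<kappa>) * \<kappa> ^ n"
  unfolding theta_def by (rule geometric_limit(2)[OF th_step kappa_nonneg mu_m])

lemma theta_bound: "\<bar>theta s x t - t\<bar> \<le> C / (1 - \<kappa>) * \<bar>s\<bar>"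
  using th_tail[of 0 s x t] by (simp add: abs_minus_commute)

lemma theta_0 [simp]: "theta 0 x t = t"
  using theta_bound[of 0 x t] by simp

lemma theta_equivariant_Q: "theta s x t = Q (x + s *\<^sub>R e) (theta (\<mu> * s) (L x) (P x t))"
proof -
  have "continuous_on UNIV (Q (x + s *\<^sub>R e))"
    by (intro continuous_intros)
  then have "(\<lambda>n. th (Suc n) s x t) \<longlonglongrightarrow> Q (x + s *\<^sub>R e) (theta (\<mu> * s) (L x) (P x t))"
    unfolding th.simps by (rule continuous_on_tendsto_compose[OF _ th_tendsto]) auto
  then show ?thesis
    using LIMSEQ_unique LIMSEQ_Suc[OF th_tendsto[of s x t]] by blast
qed

lemma theta_equivariant: "theta (\<mu> * s) (L x) (P x t) = P (x + s *\<^sub>R e) (theta s x t)"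
  by (subst theta_equivariant_Q[of s x t]) (simp add: P_Q)

lemma cont_th [continuous_intros]:
  assumes "continuous_on S a" "continuous_on S b" "continuous_on S c"
  shows "continuous_on S (\<lambda>z. th n (a z) (b z) (c z))"
  using assms
proof (induction n arbitrary: a b c)
  case (Suc n)
  show ?case unfolding th.simps by (intro continuous_intros Suc)
qed simp

text \<open>The tail bound grows with the base parameter, so convergence is uniform only on the open
  slabs \<open>B R\<close>; these exhaust the space.\<close>

lemma cont_theta [continuous_intros]:
  assumes "continuous_on S a" "continuous_on S b" "continuous_on S c"
  shows "continuous_on S (\<lambda>z. theta (a z) (b z) (c z))"
proof -
  define B where "B R = {z :: real \<times> (real^2) \<times> real. \<bar>fst z\<bar> < R}" for R
  have cont: "continuous_on (B R) (\<lambda>z. theta (fst z) (fst (snd z)) (snd (snd z)))" for R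
  proof (rule uniform_limit_theorem)
    show "\<forall>\<^sub>F n in sequentially. continuous_on (B R) (\<lambda>z. th n (fst z) (fst (snd z)) (snd (snd z)))"
      by (intro always_eventually allI continuous_intros)
    show "uniform_limit (B R) (\<lambda>n z. th n (fst z) (fst (snd z)) (snd (snd z)))
        (\<lambda>z. theta (fst z) (fst (snd z)) (snd (snd z))) sequentially"
    proof (rule uniform_limit_geometric[OF _ kappa_nonneg mu_m])
      fix n and z :: "real \<times> (real^2) \<times> real" assume "z \<in> B R"
      then have "C * \<bar>fst z\<bar> / (1 - \<kappa>) * \<kappa> ^ n \<le> C * R / (1 - \<kappa>) * \<kappa> ^ n"
        using C_nonneg kappa_nonneg mu_m
        by (intro mult_right_mono divide_right_mono mult_left_mono) (auto simp: B_def)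
      with th_tail[of n "fst z"]
      show "\<bar>th n (fst z) (fst (snd z)) (snd (snd z)) - theta (fst z) (fst (snd z)) (snd (snd z))\<bar>
          \<le> C * R / (1 - \<kappa>) * \<kappa> ^ n"
        by (rule order_trans)
    qed
  qed simp
  have "open (B R)" for R
    unfolding B_def by (intro open_Collect_less continuous_intros)
  with cont have "continuous_on (\<Union>R. B R) (\<lambda>z. theta (fst z) (fst (snd z)) (snd (snd z)))"
    by (intro continuous_on_open_UN)
  moreover have "(\<Union>R. B R) = UNIV"
    by (auto simp: B_def intro: gt_ex)
  ultimately have "continuous_on UNIV (\<lambda>z. theta (fst z) (fst (snd z)) (snd (snd z)))" by simp
  from continuous_on_compose2[OF this continuous_on_Pair[OF assms(1) continuous_on_Pair[OF assms(2,3)]]]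
  show ?thesis by simp
qed

text \<open>Exact already at finite level: in the composition of two approximate holonomies, the
  cocycle over the middle point cancels against its inverse.\<close>

lemma th_flow: "th n s' (x + s *\<^sub>R e) (th n s x t) = th n (s + s') x t"
  by (induction n arbitrary: s s' x t)
    (simp_all add: P_Q L_line algebra_simps scaleR_add_left[symmetric] del: scaleR_add_left)

lemma th_0 [simp]: "th n 0 x t = t"
  using th_tail[of n 0 x t] by simp

lemma theta_flow: "theta s' (x + s *\<^sub>R e) (theta s x t) = theta (s + s') x t"
proof -
  let ?y = "x + s *\<^sub>R e"
  have "continuous_on UNIV (theta s' ?y)"
    by (intro continuous_intros)
  then have 1: "(\<lambda>n. theta s' ?y (th n s x t)) \<longlonglongrightarrow> theta s' ?y (theta s x t)"
    by (rule continuous_on_tendsto_compose[OF _ th_tendsto]) auto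
  have "(\<lambda>n. C * \<bar>s'\<bar> / (1 - \<kappa>) * \<kappa> ^ n) \<longlonglongrightarrow> C * \<bar>s'\<bar> / (1 - \<kappa>) * 0"
    using kappa_nonneg mu_m by (intro tendsto_mult_left LIMSEQ_realpow_zero)
  then have null: "(\<lambda>n. C * \<bar>s'\<bar> / (1 - \<kappa>) * \<kappa> ^ n) \<longlonglongrightarrow> 0" by simp
  \<comment> \<open>The bound in \<open>th_tail\<close> does not depend on the fibre coordinate, so
    it applies at the moving point \<open>th n s x t\<close>.\<close>
  have "(\<lambda>n. th n s' ?y (th n s x t) - theta s' ?y (th n s x t)) \<longlonglongrightarrow> 0"
    by (rule Lim_null_comparison[OF always_eventually null], unfold real_norm_def) (intro allI th_tail)
  from tendsto_add[OF this 1] show ?thesis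
    using LIMSEQ_unique th_tendsto[of "s + s'" x t] by (simp add: th_flow)
qed

lemma theta_inverse [simp]:
  "theta (- s) (x + s *\<^sub>R e) (theta s x t) = t"
  "theta s x (theta (- s) (x + s *\<^sub>R e) t) = t"
  using theta_flow[of "- s" x s t] theta_flow[of s "x + s *\<^sub>R e" "- s" t] by simp_all

text \<open>Holonomies are injective and are joined to the identity by shrinking \<open>s\<close> to
  0. If the order of two points were lost, the intermediate value theorem would make some
  intermediate holonomy identify them.\<close>

lemma theta_strict_mono:
  assumes "t < t'"
  shows "theta s x t < theta s x t'"
proof (rule ccontr)
  assume *: "\<not> ?thesis"
  let ?d = "\<lambda>r. theta (r * s) x t' - theta (r * s) x t"
  have "continuous_on {0..1} ?d" by (intro continuous_intros)
  then have "\<exists>r. 0 \<le> r \<and> r \<le> 1 \<and> ?d r = 0"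
    using * assms by (intro IVT2') auto
  then obtain r where "theta (r * s) x t' = theta (r * s) x t" by auto
  then show False
    using theta_inverse(1)[of "r * s" x t] theta_inverse(1)[of "r * s" x t'] assms by simp
qed

lemma Q_base_periodic: "k \<in> lattice2 \<Longrightarrow> Q (x + k) t = Q x t"
  by (metis P_Q Q_P P_base_periodic)

lemma Q_fiber_periodic: "j \<in> lattice1 \<Longrightarrow> Q x (t + j) = Q x t + j"
  by (metis P_Q Q_P P_fiber_periodic)

lemma th_periodic:
  assumes "k \<in> lattice2" "j \<in> lattice1"
  shows "th n s (x + k) (t + j) = th n s x t + j"
  using assms(1)
proof (induction n arbitrary: s x t k)
  case (Suc n)
  have "Q (x + k + s *\<^sub>R e) u = Q (x + s *\<^sub>R e) u" for u
    using Q_base_periodic[OF Suc.prems, of "x + s *\<^sub>R e"] by (simp add: algebra_simps)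
  then show ?case
    using Suc assms(2)
    by (simp add: P_base_periodic P_fiber_periodic Q_fiber_periodic linear_add[OF linear_L] L_lattice)
qed simp

lemma theta_periodic:
  assumes "k \<in> lattice2" "j \<in> lattice1"
  shows "theta s (x + k) (t + j) = theta s x t + j"
  using LIMSEQ_unique[OF th_tendsto[of s "x + k" "t + j"]]
    tendsto_add[OF th_tendsto[of s x t] tendsto_const[of j]] by (simp add: th_periodic[OF assms])

text \<open>The derivative of \<open>th n\<close> in the base parameter at 0, obtained by
  differentiating the recursion for \<open>th\<close>; see \<open>th_deriv_0\<close>.\<close>

primrec sg :: "nat \<Rightarrow> real^2 \<Rightarrow> real \<Rightarrow> real" where
  "sg 0 x t = 0"
| "sg (Suc n) x t = dQ (x, P x t) (e, \<mu> * sg n (L x) (P x t))"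

text \<open>\<open>(e, sigma x t)\<close> spans the strong stable direction at \<open>(x, t)\<close>.\<close>

definition sigma :: "real^2 \<Rightarrow> real \<Rightarrow> real" where
  "sigma x t = lim (\<lambda>n. sg n x t)"

lemma sg_step: "\<bar>sg (Suc n) x t - sg n x t\<bar> \<le> C * \<kappa> ^ n"
proof (induction n arbitrary: x t)
  case 0
  show ?case using dQ_base[of "(x, P x t)"] by simp
next
  case (Suc n)
  let ?a = "sg (Suc n) (L x) (P x t)" and ?b = "sg n (L x) (P x t)"
  have "\<bar>sg (Suc (Suc n)) x t - sg (Suc n) x t\<bar> = \<bar>dQ (x, P x t) (e, \<mu> * ?a) - dQ (x, P x t) (e, \<mu> * ?b)\<bar>"
    by simp
  also have "\<dots> = \<mu> * (\<bar>?a - ?b\<bar> * \<bar>dQ (x, P x t) (0, 1)\<bar>)"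
  proof -
    have "dQ (x, P x t) (e, \<mu> * ?a) - dQ (x, P x t) (e, \<mu> * ?b) = \<mu> * ((?a - ?b) * dQ (x, P x t) (0, 1))"
      unfolding dQ_split[of _ "\<mu> * _"] by (simp add: algebra_simps del: sg.simps)
    then show ?thesis using mu_pos by (simp add: abs_mult del: sg.simps)
  qed
  also have "\<dots> \<le> \<mu> * ((C * \<kappa> ^ n) * m)"
    using mu_pos C_nonneg kappa_nonneg by (intro mult_left_mono mult_mono Suc dQ_fiber) auto
  finally show ?case by (simp add: algebra_simps)
qed

lemma sg_tendsto: "(\<lambda>n. sg n x t) \<longlonglongrightarrow> sigma x t"
  unfolding sigma_def by (rule geometric_limit(1)[OF sg_step kappa_nonneg mu_m])

lemma sg_tail: "\<bar>sg n x t - sigma x t\<bar> \<le> C / (1 - \<kappa>) * \<kappa> ^ n"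
  unfolding sigma_def by (rule geometric_limit(2)[OF sg_step kappa_nonneg mu_m])

lemma sigma_bound: "\<bar>sigma x t\<bar> \<le> C / (1 - \<kappa>)"
  using sg_tail[of 0 x t] by simp

lemma cont_sg:
  assumes "continuous_on S b" "continuous_on S c"
  shows "continuous_on S (\<lambda>z. sg n (b z) (c z))"
  using assms
proof (induction n arbitrary: b c)
  case (Suc n)
  show ?case unfolding sg.simps by (intro continuous_intros cont_dQ_apply Suc)
qed simp

lemma cont_sigma [continuous_intros]:
  assumes "continuous_on S b" "continuous_on S c"
  shows "continuous_on S (\<lambda>z. sigma (b z) (c z))"
proof (rule uniform_limit_theorem)
  show "\<forall>\<^sub>F n in sequentially. continuous_on S (\<lambda>z. sg n (b z) (c z))"
    by (intro always_eventually allI cont_sg assms)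
  show "uniform_limit S (\<lambda>n z. sg n (b z) (c z)) (\<lambda>z. sigma (b z) (c z)) sequentially"
    by (rule uniform_limit_geometric[OF sg_tail kappa_nonneg mu_m])
qed simp

text \<open>Invariance of the strong direction, expressed through the derivative of the inverse
  fibre map because that is what the recursion uses.\<close>

lemma sigma_invariant: "sigma x t = dQ (x, P x t) (e, \<mu> * sigma (L x) (P x t))"
proof -
  have "continuous_on UNIV (\<lambda>c. dQ (x, P x t) (e, \<mu> * c))"
    by (intro cont_dQ_apply continuous_intros)
  then have "(\<lambda>n. sg (Suc n) x t) \<longlonglongrightarrow> dQ (x, P x t) (e, \<mu> * sigma (L x) (P x t))"
    unfolding sg.simps by (rule continuous_on_tendsto_compose[OF _ sg_tendsto]) auto
  then show ?thesis
    using LIMSEQ_unique LIMSEQ_Suc[OF sg_tendsto[of x t]] by blast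
qed

lemma th_deriv_0: "((\<lambda>s. th n s x t) has_derivative (\<lambda>r. r * sg n x t)) (at 0)"
proof (induction n arbitrary: x t)
  case (Suc n)
  have "((\<lambda>s. th n s (L x) (P x t)) has_derivative (\<lambda>r. r * sg n (L x) (P x t))) (at (\<mu> * 0))"
    using Suc by simp
  from has_derivative_compose[OF has_derivative_mult_right[OF has_derivative_ident] this]
  have "((\<lambda>s. th n (\<mu> * s) (L x) (P x t)) has_derivative (\<lambda>r. \<mu> * r * sg n (L x) (P x t))) (at 0)" .
  then have "((\<lambda>s. (x + s *\<^sub>R e, th n (\<mu> * s) (L x) (P x t))) has_derivative
      (\<lambda>r. (r *\<^sub>R e, r * (\<mu> * sg n (L x) (P x t))))) (at 0)"
    by (auto intro!: derivative_eq_intros simp: mult_ac)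
  from has_derivative_compose[OF this, of "\<lambda>p. Q (fst p) (snd p)" "dQ (x, P x t)"]
  show ?case using dQ by (simp add: dQ_scaled)
qed simp

text \<open>The tail bound for \<open>th\<close> is linear in the base parameter, so the difference
  quotients converge uniformly and the two limits may be exchanged. With the flow property this
  yields the derivative at every parameter.\<close>

lemma theta_deriv_0: "((\<lambda>s. theta s x t) has_real_derivative sigma x t) (at 0)"
proof -
  have "((\<lambda>s. (theta s x t - t) / s) \<longlongrightarrow> sigma x t) (at 0)"
  proof (rule swap_uniform_limit[OF _ sg_tendsto])
    show "\<forall>\<^sub>F n in sequentially. ((\<lambda>s. (th n s x t - t) / s) \<longlongrightarrow> sg n x t) (at 0)"
    proof (intro always_eventually allI)
      fix n
      have "((\<lambda>s. th n s x t) has_real_derivative sg n x t) (at 0)"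
        using th_deriv_0[of n x t] by (simp add: has_field_derivative_def mult_commute_abs)
      then show "((\<lambda>s. (th n s x t - t) / s) \<longlongrightarrow> sg n x t) (at 0)"
        by (simp add: DERIV_def)
    qed
    show "uniform_limit UNIV (\<lambda>n s. (th n s x t - t) / s) (\<lambda>s. (theta s x t - t) / s) sequentially"
    proof (rule uniform_limit_geometric[OF _ kappa_nonneg mu_m])
      fix n and s :: real
      show "\<bar>(th n s x t - t) / s - (theta s x t - t) / s\<bar> \<le> C / (1 - \<kappa>) * \<kappa> ^ n"
      proof (cases "s = 0")
        case True
        then show ?thesis using C_nonneg kappa_nonneg mu_m by simp
      next
        case False
        have "\<bar>(th n s x t - t) / s - (theta s x t - t) / s\<bar> = \<bar>th n s x t - theta s x t\<bar> / \<bar>s\<bar>"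
          by (simp add: diff_divide_distrib[symmetric])
        also have "\<dots> \<le> (C * \<bar>s\<bar> / (1 - \<kappa>) * \<kappa> ^ n) / \<bar>s\<bar>"
          by (intro divide_right_mono th_tail) simp
        finally show ?thesis using False by simp
      qed
    qed
  qed simp
  then show ?thesis by (simp add: DERIV_def)
qed

lemma theta_deriv: "((\<lambda>s. theta s x t) has_real_derivative sigma (x + s *\<^sub>R e) (theta s x t)) (at s)"
proof -
  have "((\<lambda>h. theta (h + s) x t) has_real_derivative sigma (x + s *\<^sub>R e) (theta s x t)) (at 0)"
    using theta_deriv_0[of "x + s *\<^sub>R e" "theta s x t"] by (simp add: theta_flow add.commute)
  then show ?thesis
    using DERIV_shift[of "\<lambda>s. theta s x t" _ 0 s] by simp
qed

lemma sigma_periodic: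
  assumes "k \<in> lattice2" "j \<in> lattice1"
  shows "sigma (x + k) (t + j) = sigma x t"
proof -
  have "((\<lambda>s. theta s x t + j) has_real_derivative sigma x t) (at 0)"
    by (auto intro!: derivative_eq_intros theta_deriv_0)
  moreover have "((\<lambda>s. theta s x t + j) has_real_derivative sigma (x + k) (t + j)) (at 0)"
    using theta_deriv_0[of "x + k" "t + j"] by (simp add: theta_periodic[OF assms])
  ultimately show ?thesis using DERIV_unique by blast
qed

end


section \<open>The strong stable foliation\<close>

text \<open>Ensures that a single leaf on the torus has only countably many transversal coordinates
  in a foliated chart.\<close>

lemma countable_lattice3: "countable lattice3"
proof -
  have "lattice2 \<subseteq> (\<lambda>(a, b). \<chi> i. if i = 1 then of_int a else of_int b) ` (UNIV :: (int \<times> int) set)"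
  proof
    fix v assume "v \<in> lattice2"
    then have "v $ 1 \<in> \<int>" "v $ 2 \<in> \<int>"
      by (simp_all add: lattice2_def)
    then obtain a b where "v $ 1 = of_int a" "v $ 2 = of_int b"
      using Ints_cases by metis
    then have "v = (\<chi> i. if i = 1 then of_int a else of_int b)"
      by (simp add: vec_eq_iff forall_2)
    then show "v \<in> (\<lambda>(a, b). \<chi> i. if i = 1 then of_int a else of_int b) ` (UNIV :: (int \<times> int) set)"
      by (auto intro!: image_eqI[of _ _ "(a, b)"])
  qed
  then have "countable lattice2"
    by (rule countable_subset) auto
  moreover have "lattice1 \<subseteq> (\<lambda>a. 2 * of_int a) ` (UNIV :: int set)"
    by (auto simp: lattice1_def elim!: Ints_cases intro!: image_eqI)
  then have "countable lattice1"
    by (rule countable_subset) auto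
  ultimately show ?thesis
    unfolding lattice3_def by simp
qed

context stable_skew
begin

definition leaf :: "space3 \<Rightarrow> space3 set" where
  "leaf p = range (\<lambda>s. (fst p + s *\<^sub>R e, theta s (fst p) (snd p)))"

definition W :: "torus3 \<Rightarrow> torus3 set" where
  "W y = cover3 ` leaf (rep3 y)"

definition E_frame :: "torus3 \<Rightarrow> space3" where
  "E_frame y = (e, sigma (fst (rep3 y)) (snd (rep3 y)))"

definition E :: subbundle where
  "E y = span {E_frame y}"

lemma leaf_translate:
  assumes "g \<in> lattice3"
  shows "leaf (p + g) = (\<lambda>q. q + g) ` leaf p"
proof -
  have g: "fst g \<in> lattice2" "snd g \<in> lattice1"
    using assms by (simp_all add: lattice3_def mem_Times_iff)
  have "(fst (p + g) + s *\<^sub>R e, theta s (fst (p + g)) (snd (p + g))) =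
      (fst p + s *\<^sub>R e, theta s (fst p) (snd p)) + g" for s
    by (simp add: theta_periodic[OF g] prod_eq_iff)
  then show ?thesis unfolding leaf_def image_image by simp
qed

lemma cover3_image_leaf: "cover3 p = cover3 q \<Longrightarrow> cover3 ` leaf p = cover3 ` leaf q"
proof -
  assume "cover3 p = cover3 q"
  then have g: "p - q \<in> lattice3" by (simp add: cover3_eq_iff)
  have "cover3 (l + (p - q)) = cover3 l" for l
    unfolding cover3_eq_iff using g by simp
  then show ?thesis
    using leaf_translate[OF g, of q] by (simp add: image_image)
qed

lemma W_cover3: "W (cover3 p) = cover3 ` leaf p"
  unfolding W_def by (rule cover3_image_leaf) simp

lemma mem_leaf_self: "p \<in> leaf p"
  unfolding leaf_def by (rule range_eqI[of _ _ 0]) simp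

lemma leaf_eq:
  assumes "q \<in> leaf p"
  shows "leaf q = leaf p"
proof -
  obtain s where q: "q = (fst p + s *\<^sub>R e, theta s (fst p) (snd p))"
    using assms by (auto simp: leaf_def)
  let ?c = "\<lambda>r. (fst p + r *\<^sub>R e, theta r (fst p) (snd p))"
  have "leaf q = range (\<lambda>r. ?c (s + r))"
    unfolding leaf_def q by (simp add: theta_flow scaleR_add_left add.assoc)
  also have "\<dots> = ?c ` range (\<lambda>r. s + r)"
    by (simp only: image_image)
  also have "range (\<lambda>r. s + r) = UNIV"
    by (rule surj_plus)
  finally show ?thesis by (simp add: leaf_def)
qed

lemma mem_W_self: "y \<in> W y"
  unfolding W_def using mem_leaf_self[of "rep3 y"] image_eqI[of y cover3 "rep3 y"] by simp

lemma W_eq: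
  assumes "z \<in> W y"
  shows "W z = W y"
proof -
  obtain q where "q \<in> leaf (rep3 y)" "z = cover3 q"
    using assms by (auto simp: W_def)
  then show ?thesis by (simp add: W_cover3 leaf_eq) (simp add: W_def)
qed

lemma theta_mem_W: "cover3 (x + s *\<^sub>R e, theta s x t) \<in> W (cover3 (x, t))"
  unfolding W_cover3 leaf_def by auto

lemma path_connected_W: "path_connected (W y)"
  unfolding W_def leaf_def
  by (intro path_connected_continuous_image path_connected_UNIV continuous_intros continuous_on_id)

lemma E_frame_cover3: "E_frame (cover3 p) = (e, sigma (fst p) (snd p))"
proof -
  let ?g = "rep3 (cover3 p) - p"
  have "?g \<in> lattice3" using cover3_eq_iff cover3_rep3 by metis
  then have "fst ?g \<in> lattice2" "snd ?g \<in> lattice1" by (simp_all only: lattice3_def mem_Times_iff)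
  from sigma_periodic[OF this, of "fst p" "snd p"] show ?thesis
    by (simp add: E_frame_def)
qed

text \<open>Although \<open>rep3\<close> is not continuous, periodicity of \<open>sigma\<close>
  removes the choice of representative after composing with \<open>cover3\<close>.\<close>

lemma cont_E_frame: "continuous_on UNIV E_frame"
  by (rule continuous_on_descend) (auto simp: E_frame_cover3 intro!: continuous_intros)

lemma e_nonzero: "e \<noteq> 0"
  using ca_e linear_0[OF linear_ca] by auto

lemma E_frame_nonzero: "E_frame y \<noteq> 0"
  using e_nonzero by (simp add: E_frame_def zero_prod_def)

lemma continuous_bundle_E: "continuous_bundle E"
  unfolding continuous_bundle_def
proof (intro allI)
  fix y
  show "\<exists>U n b. open U \<and> y \<in> U \<and> (\<forall>i<n. continuous_on U (b i)) \<and>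
      (\<forall>y\<in>U. inj_on (\<lambda>i. b i y) {..<n} \<and> independent ((\<lambda>i. b i y) ` {..<n}) \<and>
        E y = span ((\<lambda>i. b i y) ` {..<n::nat}))"
    by (rule exI[of _ UNIV], rule exI[of _ 1], rule exI[of _ "\<lambda>i. E_frame"])
      (auto simp: cont_E_frame E_def E_frame_nonzero lessThan_Suc)
qed

lemma image_W:
  assumes f: "\<And>x t. f (cover3 (x, t)) = cover3 (L x, P x t)"
  shows "f ` W y = W (f y)"
proof -
  obtain x t where y: "y = cover3 (x, t)"
    by (metis cover3_cases surj_pair)
  let ?c = "\<lambda>s. cover3 (L x + s *\<^sub>R e, theta s (L x) (P x t))"
  have "f ` W y = range (\<lambda>s. ?c (\<mu> * s))"
    by (simp add: y W_cover3 leaf_def image_image f L_line theta_equivariant)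
  also have "\<dots> = ?c ` range (\<lambda>s. \<mu> * s)"
    by (simp only: image_image)
  also have "range (\<lambda>s. \<mu> * s) = UNIV"
    using mu_pos by (intro surjI[of _ "\<lambda>s. s / \<mu>"]) simp
  also have "range ?c = W (f y)"
    by (simp add: y f W_cover3 leaf_def image_image)
  finally show ?thesis .
qed

text \<open>The second argument selects a point of the transversal plane through \<open>p\<close>
  spanned by \<open>e'\<close> and the fibre; the first slides it along its leaf. The scale
  \<open>d\<close> is later chosen to make the box embed in the torus.\<close>

definition box_map :: "real \<Rightarrow> space3 \<Rightarrow> real \<times> (real^2) \<Rightarrow> space3" where
  "box_map d p q = (fst p + (d * snd q $ 1) *\<^sub>R e' + (d * fst q) *\<^sub>R e,
    theta (d * fst q) (fst p + (d * snd q $ 1) *\<^sub>R e') (snd p + d * snd q $ 2))"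

text \<open>The inverse of \<open>box_map\<close>: holonomy back to the transversal plane, where the
  remaining two coordinates are read off.\<close>

definition box_coord :: "real \<Rightarrow> space3 \<Rightarrow> space3 \<Rightarrow> real \<times> (real^2)" where
  "box_coord d p q = (ca (fst q - fst p) / d,
    (cb (fst q - fst p) / d) *\<^sub>R axis 1 1 +
    ((theta (- ca (fst q - fst p)) (fst q) (snd q) - snd p) / d) *\<^sub>R axis 2 1)"

lemma cont_box_map: "continuous_on UNIV (box_map d p)"
  unfolding box_map_def by (intro continuous_intros continuous_on_id)

lemma cont_box_coord: "continuous_on UNIV (box_coord d p)"
  unfolding box_coord_def divide_inverse by (intro continuous_intros continuous_on_id)

lemma ca_comb: "ca (a *\<^sub>R e' + b *\<^sub>R e) = b" and cb_comb: "cb (a *\<^sub>R e' + b *\<^sub>R e) = a"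
  by (simp_all add: linear_add[OF linear_ca] linear_scale[OF linear_ca] ca_e ca_e'
      linear_add[OF linear_cb] linear_scale[OF linear_cb] cb_e cb_e')

lemma box_coord_map:
  assumes "d \<noteq> 0"
  shows "box_coord d p (box_map d p q) = q"
proof -
  have "fst (box_map d p q) - fst p = (d * snd q $ 1) *\<^sub>R e' + (d * fst q) *\<^sub>R e"
    by (simp add: box_map_def)
  then show ?thesis
    using assms
    by (auto simp: box_coord_def ca_comb cb_comb box_map_def prod_eq_iff vec_eq_iff forall_2 axis_def)
qed

lemma box_map_coord:
  assumes "d \<noteq> 0"
  shows "box_map d p (box_coord d p q) = q"
proof -
  let ?v = "fst q - fst p"
  have *: "fst p + cb ?v *\<^sub>R e' = fst q + (- ca ?v) *\<^sub>R e"
    using basis_expansion[of ?v] by (simp add: algebra_simps)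
  have "theta (ca ?v) (fst q + (- ca ?v) *\<^sub>R e) (theta (- ca ?v) (fst q) (snd q)) = snd q"
    unfolding theta_flow by simp
  with * show ?thesis
    using assms by (simp add: box_map_def box_coord_def axis_def prod_eq_iff)
qed

text \<open>Holds along the whole leaf in the cover and not just inside the box, since the chart
  straightens the foliation of the cover globally.\<close>

lemma box_coord_leaf:
  assumes "d \<noteq> 0" "q \<in> leaf r"
  shows "snd (box_coord d p q) = snd (box_coord d p r)"
proof -
  obtain s where q: "q = (fst r + s *\<^sub>R e, theta s (fst r) (snd r))"
    using assms by (auto simp: leaf_def)
  have lin: "ca (fst r + s *\<^sub>R e - fst p) = ca (fst r - fst p) + s"
    "cb (fst r + s *\<^sub>R e - fst p) = cb (fst r - fst p)"
    by (simp_all add: linear_add[OF linear_ca] linear_diff[OF linear_ca] linear_scale[OF linear_ca] ca_e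
        linear_add[OF linear_cb] linear_diff[OF linear_cb] linear_scale[OF linear_cb] cb_e)
  show ?thesis
    by (simp add: box_coord_def q lin theta_flow)
qed

lemma box_map_leaf: "box_map d p (s, z) \<in> leaf (box_map d p (s', z))"
proof -
  let ?x = "fst p + (d * z $ 1) *\<^sub>R e'" and ?t = "snd p + d * z $ 2"
  have "box_map d p (r, z) \<in> leaf (?x, ?t)" for r
    unfolding box_map_def leaf_def by auto
  then show ?thesis using leaf_eq by metis
qed

lemma box_map_deriv:
  "((\<lambda>s. box_map d p (s, z)) has_derivative
    (\<lambda>r. r *\<^sub>R (d *\<^sub>R E_frame (cover3 (box_map d p (s, z)))))) (at s)"
proof -
  let ?x = "fst p + (d * z $ 1) *\<^sub>R e'" and ?t = "snd p + d * z $ 2"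
  have "((\<lambda>s. theta (d * s) ?x ?t) has_real_derivative
      sigma (?x + (d * s) *\<^sub>R e) (theta (d * s) ?x ?t) * d) (at s)"
    by (rule DERIV_chain2[OF theta_deriv]) (auto intro!: derivative_eq_intros)
  then have "((\<lambda>s. theta (d * s) ?x ?t) has_derivative
      (\<lambda>r. r * (d * sigma (?x + (d * s) *\<^sub>R e) (theta (d * s) ?x ?t)))) (at s)"
    by (simp add: has_field_derivative_def mult_commute_abs mult.commute)
  then show ?thesis
    unfolding box_map_def E_frame_cover3
    by (auto intro!: derivative_eq_intros simp: mult_ac)
qed

text \<open>The global chart of the cover is restricted to a small box and projected. The delicate
  point is that a dense leaf may return to the box; countability of its returns separates the
  plaques.\<close>

lemma foliated_chart:
  "\<exists>U h. open U \<and> y \<in> U \<and>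
      (\<exists>g. homeomorphism ({-1<..<1::real} \<times> box (-1) (1::real^2)) U h g) \<and>
      (\<forall>w. components (W w \<inter> U) \<subseteq> (\<lambda>z. h ` ({-1<..<1} \<times> {z})) ` box (-1) 1) \<and>
      (\<forall>z\<in>box (-1) 1. integral_curve E (\<lambda>s. h (s, z)))"
proof -
  define K where "K = C / (1 - \<kappa>)"
  have K: "0 \<le> K" using C_nonneg mu_m by (simp add: K_def)
  \<comment> \<open>With this scale the box stays within 1/2 of \<open>p\<close> in the base and
    within 1 in the fibre, so no two of its points differ by a nonzero lattice vector.\<close>
  define d where "d = 1 / (4 * (1 + K + norm e + norm e'))"
  have pos: "0 < 1 + K + norm e + norm e'" using K norm_ge_zero[of e] norm_ge_zero[of e'] by linarith
  have d: "0 < d" using pos by (simp add: d_def)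
  have "d * (1 + K + norm e + norm e') = 1 / 4"
    using pos by (simp add: d_def)
  then have sum_d: "d + d * K + d * norm e + d * norm e' = 1 / 4"
    by (simp add: algebra_simps)
  moreover have "0 \<le> d * K" "0 \<le> d * norm e" "0 \<le> d * norm e'"
    using d K by simp_all
  ultimately have d_small: "d * norm e' + d * norm e < 1 / 2" "K * d + d < 1"
    using d unfolding mult.commute[of K d] by linarith+
  define p where "p = rep3 y"
  let ?B = "{-1<..<1::real} \<times> box (-1) (1::real^2)"
  let ?H = "box_map d p" and ?G = "box_coord d p"
  let ?h = "\<lambda>q. cover3 (?H q)"
  have GH: "?G (?H q) = q" and HG: "?H (?G r) = r" for q r
    using box_coord_map box_map_coord d by auto
  have "?H ` S = ?G -` S" for S
  proof
    show "?G -` S \<subseteq> ?H ` S"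
      by (metis HG image_eqI subsetI vimageE)
  qed (simp add: image_subset_iff GH)
  then have open_H: "open (?H ` S)" if "open S" for S
    using open_vimage[OF that cont_box_coord] by simp
  have open_B: "open ?B" by (intro open_Times open_greaterThanLessThan open_box)
  have B_comp: "\<bar>s\<bar> < 1" "\<bar>z $ i\<bar> < 1" if "(s, z) \<in> ?B" for s z i
    using that by (auto simp: mem_box_cart abs_less_iff)
  have near: "norm (fst (?H q) - fst p) < 1 / 2" "\<bar>snd (?H q) - snd p\<bar> < 1" if "q \<in> ?B" for q
  proof -
    obtain s z where q: "q = (s, z)" by (cases q)
    note b = B_comp[OF that[unfolded q]]
    have "norm (fst (?H q) - fst p) = norm ((d * z $ 1) *\<^sub>R e' + (d * s) *\<^sub>R e)"
      by (simp add: box_map_def q)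
    also have "\<dots> \<le> \<bar>d * z $ 1\<bar> * norm e' + \<bar>d * s\<bar> * norm e"
      using norm_triangle_ineq[of "(d * z $ 1) *\<^sub>R e'" "(d * s) *\<^sub>R e"] by simp
    also have "\<dots> \<le> d * norm e' + d * norm e"
      using b(1) b(2)[of 1] d by (intro add_mono mult_right_mono) (auto simp: abs_mult)
    also have "\<dots> < 1 / 2" by (rule d_small)
    finally show "norm (fst (?H q) - fst p) < 1 / 2" .
    have "\<bar>snd (?H q) - snd p\<bar> \<le> K * \<bar>d * s\<bar> + \<bar>d * z $ 2\<bar>"
      using theta_bound[of "d * s" "fst p + (d * z $ 1) *\<^sub>R e'" "snd p + d * z $ 2"]
      by (simp add: box_map_def q K_def)
    also have "\<dots> \<le> K * d + d"
      using b(1) b(2)[of 2] d K by (intro add_mono mult_left_mono) (auto simp: abs_mult)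
    also have "\<dots> < 1" by (rule d_small)
    finally show "\<bar>snd (?H q) - snd p\<bar> < 1" .
  qed
  have inj: "q = q'" if "q \<in> ?B" "q' \<in> ?B" "?h q = ?h q'" for q q'
  proof -
    let ?u = "?H q - ?H q'"
    have "?u \<in> lattice3" using that(3) by (simp add: cover3_eq_iff)
    moreover have "norm (fst ?u) < 1"
      using norm_triangle_ineq4[of "fst (?H q) - fst p" "fst (?H q') - fst p"]
        near(1)[OF that(1)] near(1)[OF that(2)] by simp
    then have "\<bar>fst ?u $ i\<bar> < 1" for i
      using component_le_norm_cart[of "fst ?u" i] by linarith
    moreover have "\<bar>snd ?u\<bar> < 2"
      using near(2)[OF that(1)] near(2)[OF that(2)] by simp
    ultimately have "fst ?u = 0" "snd ?u = 0"
      using lattice2_discrete[of "fst ?u"] lattice1_discrete[of "snd ?u"]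
      by (auto simp: lattice3_def mem_Times_iff)
    then have "?H q = ?H q'" by (simp add: prod_eq_iff)
    then show ?thesis using GH by metis
  qed
  define U where "U = ?h ` ?B"
  have open_h: "open (?h ` S)" if "open S" for S
    using open_cover3[OF open_H[OF that]] by (simp add: image_image)
  have U_cases: "\<exists>s z. (s, z) \<in> ?B \<and> v = ?h (s, z)" if v: "v \<in> U" for v
  proof -
    obtain q where "v = ?h q" "q \<in> ?B"
      using v unfolding U_def by (rule imageE)
    then show ?thesis by (intro exI[of _ "fst q"] exI[of _ "snd q"]) (simp only: prod.collapse simp_thms)
  qed
  have open_U: "open U" unfolding U_def by (rule open_h[OF open_B])
  have "(0, 0) \<in> ?B" by (simp add: mem_box_cart)
  moreover have "?h (0, 0) = y"
    by (simp add: box_map_def p_def)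
  ultimately have y: "y \<in> U" unfolding U_def by force
  have cont_h: "continuous_on S ?h" for S
    by (intro continuous_intros continuous_on_subset[OF cont_box_map]) auto
  obtain g where g: "homeomorphism ?B U ?h g"
  proof (rule homeomorphism_injective_open_map[OF cont_h])
    show "?h ` ?B = U" by (simp add: U_def)
    show "inj_on ?h ?B" using inj by (auto intro!: inj_onI)
    show "openin (top_of_set U) (?h ` S)" if "openin (top_of_set ?B) S" for S
    proof -
      have "open S" "S \<subseteq> ?B" using that open_B openin_open_eq openin_imp_subset by blast+
      then show ?thesis using open_U open_h openin_open_eq unfolding U_def by blast
    qed
  qed
  have plaques: "c \<in> (\<lambda>z. ?h ` ({-1<..<1} \<times> {z})) ` box (-1) 1" if c: "c \<in> components (W w \<inter> U)" for w c
  proof -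
    define r where "r = rep3 w"
    have sub: "c \<subseteq> W w \<inter> U" and conn: "connected c" and ne: "c \<noteq> {}"
      using in_components_subset[OF c] in_components_connected[OF c] in_components_nonempty[OF c] by auto
    define Z where "Z = (\<lambda>v. snd (g v))"
    have Z_h: "Z (?h (s, z)) = z" if "(s, z) \<in> ?B" for s z
      using homeomorphism_apply1[OF g that] by (simp add: Z_def)
    have "continuous_on U Z"
      unfolding Z_def using homeomorphism_cont2[OF g] by (intro continuous_intros)
    then have conn_Z: "connected (Z ` c)"
      using sub conn by (intro connected_continuous_image) (auto elim: continuous_on_subset)
    \<comment> \<open>Every lattice translate of the lifted leaf contributes one transversal value.
      A connected set with countably many values is a single point, so \<open>c\<close> lies in one
      plaque.\<close>
    have "Z ` c \<subseteq> (\<lambda>k. snd (?G (r + k))) ` lattice3"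
    proof (rule image_subsetI)
      fix v assume "v \<in> c"
      then have "v \<in> W w" "v \<in> U" using sub by auto
      then obtain s z l where sz: "(s, z) \<in> ?B" "v = ?h (s, z)" and l: "l \<in> leaf r" "v = cover3 l"
        using U_cases[of v] unfolding W_def r_def by blast
      let ?k = "?H (s, z) - l"
      have k: "?k \<in> lattice3" using sz l cover3_eq_iff by metis
      then have "?H (s, z) \<in> leaf (r + ?k)"
        unfolding leaf_translate[OF k] using l(1) by (intro image_eqI[of _ _ l]) simp_all
      then have "snd (?G (?H (s, z))) = snd (?G (r + ?k))"
        using d by (intro box_coord_leaf) auto
      then have "Z v = snd (?G (r + ?k))"
        using sz Z_h GH by simp
      with k show "Z v \<in> (\<lambda>k. snd (?G (r + k))) ` lattice3" by blast
    qed
    then have "countable (Z ` c)"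
      by (rule countable_subset) (intro countable_image countable_lattice3)
    then have const: "Z u = Z v" if "u \<in> c" "v \<in> c" for u v
      using connected_uncountable[OF conn_Z] that by blast
    obtain v0 where v0: "v0 \<in> c" using ne by auto
    then obtain s0 z0 where sz0: "(s0, z0) \<in> ?B" "v0 = ?h (s0, z0)"
      using sub U_cases[of v0] by blast
    let ?p = "?h ` ({-1<..<1} \<times> {z0})"
    have z0: "z0 \<in> box (-1) 1" using sz0 by auto
    have "c \<subseteq> ?p"
    proof
      fix v assume v: "v \<in> c"
      then obtain s z where sz: "(s, z) \<in> ?B" "v = ?h (s, z)"
        using sub U_cases[of v] by blast
      then have "z = z0" using const[OF v v0] Z_h[of s z] Z_h[of s0 z0] sz0 by simp
      with sz show "v \<in> ?p" by auto
    qed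
    moreover have "?p \<subseteq> c"
    proof (rule components_maximal[OF c])
      show "connected ?p"
        by (intro connected_continuous_image cont_h connected_Times convex_connected) auto
      have "W v0 = W w" using v0 sub by (intro W_eq) auto
      moreover have "?h (s, z0) \<in> W v0" for s
        unfolding sz0(2) W_cover3 using box_map_leaf by blast
      ultimately show "?p \<subseteq> W w \<inter> U" using z0 unfolding U_def by auto
      show "c \<inter> ?p \<noteq> {}" using v0 sz0 by auto
    qed
    ultimately show ?thesis using z0 by auto
  qed
  have "integral_curve E (\<lambda>s. ?h (s, z))" for z
    unfolding integral_curve_def
  proof (intro exI conjI ballI)
    let ?v = "\<lambda>s. d *\<^sub>R E_frame (?h (s, z))"
    have "continuous_on UNIV (\<lambda>s. ?h (s, z))"
      using continuous_on_compose2[OF cont_h[of UNIV], of UNIV "\<lambda>s. (s, z)"] by (simp add: continuous_intros)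
    from continuous_on_compose2[OF cont_E_frame this] show "continuous_on {-1<..<1} ?v"
      by (intro continuous_intros) (auto elim: continuous_on_subset)
    fix s :: real
    have "has_cover_deriv id cover3 (\<lambda>s. ?h (s, z)) (id s) (\<lambda>r. r *\<^sub>R ?v s)"
      by (rule has_cover_derivI[where F = "\<lambda>s. ?H (s, z)", OF _ box_map_deriv]) simp
    then show "has_cover_deriv id cover3 (\<lambda>s. ?h (s, z)) s (\<lambda>r. r *\<^sub>R ?v s)" by simp
    show "?v s \<noteq> 0" using d E_frame_nonzero by simp
    show "E (?h (s, z)) = span {?v s}"
      unfolding E_def using d span_image_scale[of "{E_frame (?h (s, z))}" "\<lambda>_. d"] by simp
  qed
  then show ?thesis
    using open_U y g plaques by (intro exI[of _ U] exI[of _ ?h]) blast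
qed

lemma foliation_tangent_W: "foliation_tangent W E"
  unfolding foliation_tangent_def
  using mem_W_self path_connected_W W_eq foliated_chart by (intro conjI allI ballI) auto

end


section \<open>The fibre maps\<close>

text \<open>The squared sines of the overview are written as half of 1 - cos of the double angle,
  whence the denominator 200.\<close>

definition phi :: "real^2 \<Rightarrow> real \<Rightarrow> real" where
  "phi x t = t + ((1 - cos (2 * pi * x $ 1)) * cos (pi * t) + (1 - cos (2 * pi * x $ 2)) * sin (pi * t)) / 200"

definition phi_t :: "real^2 \<Rightarrow> real \<Rightarrow> real" where
  "phi_t x t = 1 + pi / 200 *
    ((1 - cos (2 * pi * x $ 2)) * cos (pi * t) - (1 - cos (2 * pi * x $ 1)) * sin (pi * t))"

definition phi_x :: "real^2 \<Rightarrow> real \<Rightarrow> real^2 \<Rightarrow> real" where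
  "phi_x x t v = pi / 100 *
    (sin (2 * pi * x $ 1) * cos (pi * t) * v $ 1 + sin (2 * pi * x $ 2) * sin (pi * t) * v $ 2)"

definition psi :: "real^2 \<Rightarrow> real \<Rightarrow> real" where
  "psi x u = (THE t. phi x t = u)"

lemma has_derivative_phi:
  "((\<lambda>p. phi (fst p) (snd p)) has_derivative
    (\<lambda>v. phi_x (fst p) (snd p) (fst v) + phi_t (fst p) (snd p) * snd v)) (at p)"
proof -
  have comp: "((\<lambda>p::space3. fst p $ i) has_derivative (\<lambda>v. fst v $ i)) (at p)" for i
    by (rule bounded_linear_imp_has_derivative)
      (rule bounded_linear_compose[OF bounded_linear_vec_nth bounded_linear_fst])
  show ?thesis
    unfolding phi_def
    by (rule derivative_eq_intros comp refl | simp)+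
      (auto simp: phi_x_def phi_t_def fun_eq_iff field_simps)
qed

lemma trig_product_bound: "\<bar>(1 - cos a) * cos b\<bar> \<le> 2" "\<bar>(1 - cos a) * sin b\<bar> \<le> (2::real)"
proof -
  have "\<bar>1 - cos a\<bar> \<le> 2" using cos_ge_minus_one[of a] cos_le_one[of a] by simp
  then show "\<bar>(1 - cos a) * cos b\<bar> \<le> 2" "\<bar>(1 - cos a) * sin b\<bar> \<le> (2::real)"
    using mult_mono[of "\<bar>1 - cos a\<bar>" 2 "\<bar>cos b\<bar>" 1] mult_mono[of "\<bar>1 - cos a\<bar>" 2 "\<bar>sin b\<bar>" 1]
    by (simp_all add: abs_mult)
qed

lemma phi_near: "\<bar>phi x t - t\<bar> \<le> 1 / 50"
  using trig_product_bound(1)[of "2 * pi * x $ 1" "pi * t"] trig_product_bound(2)[of "2 * pi * x $ 2" "pi * t"]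
  by (simp add: phi_def)

text \<open>The crude bound pi < 4 suffices. From here come the fibre rates 10/9 and 11/10 used for
  the map and its inverse.\<close>

lemma phi_t_near: "\<bar>phi_t x t - 1\<bar> \<le> 8 / 100"
proof -
  let ?w = "(1 - cos (2 * pi * x $ 2)) * cos (pi * t) - (1 - cos (2 * pi * x $ 1)) * sin (pi * t)"
  have "\<bar>?w\<bar> \<le> 4"
    using trig_product_bound(1)[of "2 * pi * x $ 2" "pi * t"] trig_product_bound(2)[of "2 * pi * x $ 1" "pi * t"]
    by linarith
  then have "pi * \<bar>?w\<bar> \<le> 4 * 4"
    using pi_less_4 by (intro mult_mono) auto
  then show ?thesis by (simp add: phi_t_def abs_mult)
qed

lemma phi_t_pos: "0 < phi_t x t"
  using phi_t_near[of x t] by linarith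

lemma phi_x_bound: "\<bar>phi_x x t v\<bar> \<le> 4 / 100 * (\<bar>v $ 1\<bar> + \<bar>v $ 2\<bar>)"
proof -
  have *: "\<bar>sin a * b * c\<bar> \<le> \<bar>c\<bar>" if "\<bar>b\<bar> \<le> 1" for a b c :: real
    using mult_mono[of "\<bar>sin a\<bar>" 1 "\<bar>b\<bar>" 1] that mult_right_mono[of "\<bar>sin a\<bar> * \<bar>b\<bar>" 1 "\<bar>c\<bar>"]
    by (simp add: abs_mult)
  let ?w = "sin (2 * pi * x $ 1) * cos (pi * t) * v $ 1 + sin (2 * pi * x $ 2) * sin (pi * t) * v $ 2"
  have "\<bar>?w\<bar> \<le> \<bar>v $ 1\<bar> + \<bar>v $ 2\<bar>"
    using *[of "cos (pi * t)" "2 * pi * x $ 1" "v $ 1"] *[of "sin (pi * t)" "2 * pi * x $ 2" "v $ 2"]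
    by simp
  then have "pi * \<bar>?w\<bar> \<le> 4 * (\<bar>v $ 1\<bar> + \<bar>v $ 2\<bar>)"
    using pi_less_4 by (intro mult_mono) auto
  then show ?thesis by (simp add: phi_x_def abs_mult)
qed

lemma cos_shift_2pi: "n \<in> \<int> \<Longrightarrow> cos (a + 2 * pi * n) = cos (a::real)"
  by (simp add: cos_add cos_integer_2pi sin_integer_2pi)

lemma sin_shift_2pi: "n \<in> \<int> \<Longrightarrow> sin (a + 2 * pi * n) = sin (a::real)"
  by (simp add: sin_add cos_integer_2pi sin_integer_2pi)

lemma phi_base_periodic:
  assumes "k \<in> lattice2"
  shows "phi (x + k) t = phi x t"
proof -
  have "cos (2 * pi * (x + k) $ i) = cos (2 * pi * x $ i)" for i
    using cos_shift_2pi[of "k $ i" "2 * pi * x $ i"] assms by (simp add: lattice2_def algebra_simps)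
  then show ?thesis by (simp add: phi_def)
qed

lemma phi_fiber_periodic:
  assumes "j \<in> lattice1"
  shows "phi x (t + j) = phi x t + j"
proof -
  have j: "j / 2 \<in> \<int>" using assms by (simp add: lattice1_def)
  have "cos (pi * (t + j)) = cos (pi * t)" "sin (pi * (t + j)) = sin (pi * t)"
    using cos_shift_2pi[OF j, of "pi * t"] sin_shift_2pi[OF j, of "pi * t"] by (simp_all add: algebra_simps)
  then show ?thesis by (simp add: phi_def)
qed

lemma phi_fiber_deriv: "(phi x has_real_derivative phi_t x t) (at t)"
proof -
  have "((\<lambda>u. (x, u)) has_derivative (\<lambda>r. (0, r))) (at t)"
    by (auto intro!: derivative_eq_intros)
  from has_derivative_compose[OF this, of "\<lambda>p. phi (fst p) (snd p)"] has_derivative_phi[of "(x, t)"]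
  have "(phi x has_derivative (\<lambda>r. phi_x x t 0 + phi_t x t * r)) (at t)" by fastforce
  then show ?thesis by (simp add: has_field_derivative_def phi_x_def)
qed

lemma phi_expand: "9 / 10 * \<bar>s - t\<bar> \<le> \<bar>phi x s - phi x t\<bar>"
proof -
  have *: "9 / 10 * (s - t) \<le> phi x s - phi x t" if less: "t < s" for s t
  proof -
    obtain z where "phi x s - phi x t = (s - t) * phi_t x z"
      using MVT2[OF less, of "phi x" "phi_t x"] phi_fiber_deriv by blast
    moreover have "9 / 10 \<le> phi_t x z" using phi_t_near[of x z] by linarith
    ultimately show ?thesis
      using less mult_left_mono[of "9 / 10" "phi_t x z" "s - t"] by simp
  qed
  show ?thesis
    using *[of s t] *[of t s] by (cases s t rule: linorder_cases) auto
qed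

lemma phi_strict_mono:
  assumes "t < s"
  shows "phi x t < phi x s"
proof -
  obtain z where "phi x s - phi x t = (s - t) * phi_t x z"
    using MVT2[OF assms, of "phi x" "phi_t x"] phi_fiber_deriv by blast
  then show ?thesis using assms phi_t_pos[of x z] by (smt (verit) mult_pos_pos)
qed

lemma phi_inj: "phi x s = phi x t \<Longrightarrow> s = t"
  using phi_expand[of s t x] by simp

lemma phi_psi: "phi x (psi x u) = u"
proof -
  have "continuous_on UNIV (phi x)"
    by (intro continuous_at_imp_continuous_on ballI) (rule DERIV_isCont[OF phi_fiber_deriv])
  moreover have "phi x (u - 1) \<le> u" "u \<le> phi x (u + 1)"
    using phi_near[of x "u - 1"] phi_near[of x "u + 1"] by linarith+
  ultimately have "\<exists>t\<ge>u - 1. t \<le> u + 1 \<and> phi x t = u"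
    by (intro IVT') (auto elim: continuous_on_subset)
  then have "\<exists>!t. phi x t = u" using phi_inj by blast
  then show ?thesis unfolding psi_def by (rule theI')
qed

lemma psi_phi: "psi x (phi x t) = t"
  using phi_psi phi_inj by blast

lemma isCont_phi_pair: "isCont (\<lambda>p. phi (fst p) (snd p)) p"
  using has_derivative_continuous[OF has_derivative_phi] .

text \<open>\<open>phi_expand\<close> makes the inverse Lipschitz in the fibre, which reduces the
  claim to continuity of \<open>phi\<close>. Continuity has to precede differentiability: the
  inverse function rule assumes it.\<close>

lemma isCont_psi_pair: "isCont (\<lambda>p. psi (fst p) (snd p)) p"
proof -
  let ?b = "psi (fst p) (snd p)"
  have "isCont (\<lambda>q. phi (fst q) ?b) p"
    using isCont_o2[of p "\<lambda>q. (fst q, ?b)" "\<lambda>p. phi (fst p) (snd p)"] isCont_phi_pair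
    by (simp add: continuous_intros)
  then have "isCont (\<lambda>q. 10 / 9 * \<bar>snd q - phi (fst q) ?b\<bar>) p"
    by (intro continuous_intros)
  then have "((\<lambda>q. 10 / 9 * \<bar>snd q - phi (fst q) ?b\<bar>) \<longlongrightarrow> 0) (at p)"
    by (simp add: isCont_def phi_psi)
  moreover have "norm (psi (fst q) (snd q) - ?b) \<le> 10 / 9 * \<bar>snd q - phi (fst q) ?b\<bar>" for q
    using phi_expand[of "psi (fst q) (snd q)" ?b "fst q"] by (simp add: phi_psi)
  ultimately have "((\<lambda>q. psi (fst q) (snd q) - ?b) \<longlongrightarrow> 0) (at p)"
    by (rule Lim_null_comparison[OF always_eventually[OF allI], rotated])
  then show ?thesis unfolding isCont_def by (rule LIM_zero_cancel)
qed

definition d_psi :: "space3 \<Rightarrow> space3 \<Rightarrow> real" where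
  "d_psi p v = (snd v - phi_x (fst p) (psi (fst p) (snd p)) (fst v)) * inverse (phi_t (fst p) (psi (fst p) (snd p)))"

text \<open>Carrying the base point along turns the fibrewise inverse into the inverse of a map of
  \<open>space3\<close> to itself, to which the inverse function rule applies.\<close>

lemma has_derivative_psi: "((\<lambda>p. psi (fst p) (snd p)) has_derivative d_psi p) (at p)"
proof -
  let ?\<Phi> = "\<lambda>q::space3. (fst q, phi (fst q) (snd q))" and ?\<Psi> = "\<lambda>q::space3. (fst q, psi (fst q) (snd q))"
  let ?D = "\<lambda>v. (fst v, phi_x (fst p) (psi (fst p) (snd p)) (fst v) + phi_t (fst p) (psi (fst p) (snd p)) * snd v)"
  have D: "(?\<Phi> has_derivative ?D) (at (?\<Psi> p))"
    using has_derivative_phi[of "?\<Psi> p"] by (auto intro!: derivative_eq_intros)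
  have nz: "phi_t (fst p) (psi (fst p) (snd p)) \<noteq> 0"
    using phi_t_pos by (metis less_irrefl)
  have "linear (\<lambda>v. (fst v, d_psi p v))"
    by (rule linearI) (auto simp: d_psi_def phi_x_def algebra_simps)
  then have bl: "bounded_linear (\<lambda>v. (fst v, d_psi p v))"
    by (simp add: linear_linear)
  have "(?\<Psi> has_derivative (\<lambda>v. (fst v, d_psi p v))) (at p)"
  proof (rule has_derivative_inverse_basic[where f = ?\<Phi> and g = ?\<Psi> and y = p and T = UNIV, OF D bl])
    show "(\<lambda>v. (fst v, d_psi p v)) \<circ> ?D = id"
      using nz by (auto simp: d_psi_def fun_eq_iff)
    show "continuous (at p) ?\<Psi>"
      by (intro continuous_intros isCont_psi_pair)
  qed (auto simp: phi_psi)
  from has_derivative_snd[OF this] show ?thesis by simp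
qed

section \<open>A class of smooth functions\<close>

text \<open>The class is designed to be closed under differentiation, so that all orders follow by
  one induction. The derivative of \<open>psi\<close> involves sine and cosine of \<open>psi\<close>
  itself and the reciprocal of \<open>phi_t\<close>, hence the last two rules.\<close>

inductive smooth_fn :: "(space3 \<Rightarrow> real) \<Rightarrow> bool" where
  const: "smooth_fn (\<lambda>p. c)"
| lin: "bounded_linear l \<Longrightarrow> smooth_fn l"
| add: "smooth_fn g \<Longrightarrow> smooth_fn h \<Longrightarrow> smooth_fn (\<lambda>p. g p + h p)"
| mult: "smooth_fn g \<Longrightarrow> smooth_fn h \<Longrightarrow> smooth_fn (\<lambda>p. g p * h p)"
| sin: "smooth_fn g \<Longrightarrow> smooth_fn (\<lambda>p. sin (g p))"
| cos: "smooth_fn g \<Longrightarrow> smooth_fn (\<lambda>p. cos (g p))"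
| inverse: "smooth_fn g \<Longrightarrow> (\<And>p. g p \<noteq> 0) \<Longrightarrow> smooth_fn (\<lambda>p. inverse (g p))"
| psi: "bounded_linear l \<Longrightarrow> smooth_fn (\<lambda>p. psi (fst (l p)) (snd (l p)))"

lemma smooth_fn_diff: "smooth_fn g \<Longrightarrow> smooth_fn h \<Longrightarrow> smooth_fn (\<lambda>p. g p - h p)"
  using smooth_fn.add[of g "\<lambda>p. - 1 * h p"] smooth_fn.mult[OF smooth_fn.const[of "- 1"], of h] by simp

lemma smooth_fn_divide_const: "smooth_fn g \<Longrightarrow> smooth_fn (\<lambda>p. g p / c)"
  using smooth_fn.mult[OF smooth_fn.const[of "inverse c"], of g] by (simp add: field_simps)

lemma smooth_fn_base: "bounded_linear l \<Longrightarrow> smooth_fn (\<lambda>p. fst (l p) $ i)"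
  for l :: "space3 \<Rightarrow> space3"
  by (intro smooth_fn.lin bounded_linear_compose[OF bounded_linear_vec_nth]
      bounded_linear_compose[OF bounded_linear_fst])

lemma smooth_fn_fiber: "bounded_linear l \<Longrightarrow> smooth_fn (\<lambda>p. snd (l p))"
  for l :: "space3 \<Rightarrow> space3"
  by (intro smooth_fn.lin bounded_linear_compose[OF bounded_linear_snd])

lemmas smooth_fn_intros = smooth_fn.const smooth_fn.add smooth_fn.mult smooth_fn.sin smooth_fn.cos
  smooth_fn_diff smooth_fn_divide_const smooth_fn_base smooth_fn_fiber smooth_fn.psi

lemma smooth_fn_d_psi:
  assumes l: "bounded_linear l"
  shows "smooth_fn (\<lambda>p. d_psi (l p) v)"
  unfolding d_psi_def
proof (rule smooth_fn.mult)
  show "smooth_fn (\<lambda>p. snd v - phi_x (fst (l p)) (psi (fst (l p)) (snd (l p))) (fst v))"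
    unfolding phi_x_def by (intro smooth_fn_intros l)
  show "smooth_fn (\<lambda>p. inverse (phi_t (fst (l p)) (psi (fst (l p)) (snd (l p)))))"
  proof (rule smooth_fn.inverse)
    show "smooth_fn (\<lambda>p. phi_t (fst (l p)) (psi (fst (l p)) (snd (l p))))"
      unfolding phi_t_def by (intro smooth_fn_intros l)
  qed (use phi_t_pos in \<open>metis less_irrefl\<close>)
qed

lemma smooth_fn_derivative:
  assumes "smooth_fn g"
  shows "\<exists>g'. (\<forall>p. (g has_derivative g' p) (at p)) \<and> (\<forall>v. smooth_fn (\<lambda>p. g' p v))"
  using assms
proof induction
  case (const c)
  show ?case
    by (rule exI[of _ "\<lambda>p v. 0"]) (auto intro: smooth_fn_intros)
next
  case (lin l)
  then show ?case
    by (intro exI[of _ "\<lambda>p. l"]) (auto intro: smooth_fn_intros bounded_linear_imp_has_derivative)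
next
  case (add g h)
  then obtain g' h' where "\<And>p. (g has_derivative g' p) (at p)" "\<And>v. smooth_fn (\<lambda>p. g' p v)"
      "\<And>p. (h has_derivative h' p) (at p)" "\<And>v. smooth_fn (\<lambda>p. h' p v)" by blast
  then show ?case
    by (intro exI[of _ "\<lambda>p v. g' p v + h' p v"]) (auto intro: smooth_fn_intros derivative_intros)
next
  case (mult g h)
  then obtain g' h' where *: "\<And>p. (g has_derivative g' p) (at p)" "\<And>v. smooth_fn (\<lambda>p. g' p v)"
      "\<And>p. (h has_derivative h' p) (at p)" "\<And>v. smooth_fn (\<lambda>p. h' p v)" by blast
  show ?case
    by (intro exI[of _ "\<lambda>p v. g p * h' p v + g' p v * h p"] conjI allI smooth_fn_intros
        has_derivative_mult mult.hyps *)
next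
  case (sin g)
  then obtain g' where "\<And>p. (g has_derivative g' p) (at p)" "\<And>v. smooth_fn (\<lambda>p. g' p v)" by blast
  with sin.hyps show ?case
    by (intro exI[of _ "\<lambda>p v. cos (g p) * g' p v"]) (auto intro: smooth_fn_intros intro!: derivative_eq_intros)
next
  case (cos g)
  then obtain g' where "\<And>p. (g has_derivative g' p) (at p)" "\<And>v. smooth_fn (\<lambda>p. g' p v)" by blast
  note g' = this
  show ?case
  proof (intro exI conjI allI)
    show "((\<lambda>p. cos (g p)) has_derivative (\<lambda>v. - 1 * (sin (g p) * g' p v))) (at p)" for p
      by (auto intro!: derivative_eq_intros g')
    show "smooth_fn (\<lambda>p. - 1 * (sin (g p) * g' p v))" for v
      by (intro smooth_fn_intros cos.hyps g')
  qed
next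
  case (inverse g)
  then obtain g' where g': "\<And>p. (g has_derivative g' p) (at p)" "\<And>v. smooth_fn (\<lambda>p. g' p v)" by blast
  have inv: "smooth_fn (\<lambda>p. inverse (g p))"
    using inverse.hyps by (rule smooth_fn.inverse)
  show ?case
  proof (intro exI conjI allI)
    show "((\<lambda>p. inverse (g p)) has_derivative (\<lambda>v. - 1 * (inverse (g p) * g' p v * inverse (g p)))) (at p)" for p
      using Deriv.has_derivative_inverse[OF inverse.hyps(2) g'(1), of p] by simp
    show "smooth_fn (\<lambda>p. - 1 * (inverse (g p) * g' p v * inverse (g p)))" for v
      by (intro smooth_fn_intros inv g')
  qed
next
  case (psi l)
  show ?case
  proof (intro exI conjI allI)
    show "((\<lambda>p. psi (fst (l p)) (snd (l p))) has_derivative (\<lambda>v. d_psi (l p) (l v))) (at p)" for p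
      using has_derivative_compose[OF bounded_linear_imp_has_derivative[OF psi] has_derivative_psi] .
    show "smooth_fn (\<lambda>p. d_psi (l p) (l v))" for v
      by (rule smooth_fn_d_psi[OF psi])
  qed
qed

lemma smooth_fn_continuous:
  assumes "smooth_fn g"
  shows "continuous_on UNIV g"
proof -
  obtain g' where "\<And>p. (g has_derivative g' p) (at p)"
    using smooth_fn_derivative[OF assms] by blast
  then show ?thesis
    by (intro continuous_at_imp_continuous_on ballI) (rule has_derivative_continuous)
qed

lemma Ck_on_smooth_fn:
  fixes H :: "space3 \<Rightarrow> space3"
  assumes "\<And>b. b \<in> Basis \<Longrightarrow> smooth_fn (\<lambda>p. H p \<bullet> b)"
  shows "Ck_on k H UNIV"
  using assms
proof (induction k arbitrary: H)
  case 0
  have "continuous_on UNIV (\<lambda>p. H p \<bullet> b)" if "b \<in> Basis" for b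
    by (rule smooth_fn_continuous[OF 0[OF that]])
  then show ?case by (simp add: continuous_on_componentwise[of _ H])
next
  case (Suc k)
  have "\<exists>g'. (\<forall>p. ((\<lambda>p. H p \<bullet> b) has_derivative g' p) (at p)) \<and> (\<forall>v. smooth_fn (\<lambda>p. g' p v))"
    if "b \<in> Basis" for b
    by (rule smooth_fn_derivative[OF Suc.prems[OF that]])
  then obtain g' where g': "\<And>b p. b \<in> Basis \<Longrightarrow> ((\<lambda>p. H p \<bullet> b) has_derivative g' b p) (at p)"
      "\<And>b v. b \<in> Basis \<Longrightarrow> smooth_fn (\<lambda>p. g' b p v)"
    by metis
  define H' where "H' p v = (\<Sum>b\<in>Basis. g' b p v *\<^sub>R b)" for p v
  have H'_b: "H' p v \<bullet> b = g' b p v" if "b \<in> Basis" for p v b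
    using that by (simp add: H'_def)
  have H': "(H has_derivative H' p) (at p)" for p
    unfolding has_derivative_componentwise_within[of H] using g'(1) H'_b by simp
  then have "frechet_derivative H (at p) = H' p" for p
    using frechet_derivative_at by metis
  moreover have "Ck_on k (\<lambda>p. H' p v) UNIV" for v
    by (rule Suc.IH) (simp add: H'_b g'(2))
  ultimately show ?case
    using differentiableI[OF H'] by simp
qed

lemma Basis_space3_cases:
  assumes "b \<in> (Basis :: space3 set)"
  obtains "b = (axis 1 1, 0)" | "b = (axis 2 1, 0)" | "b = (0, 1)"
proof (cases "snd b = 0")
  case True
  then obtain i where "b = (axis i 1, 0)"
    using assms by (auto simp: Basis_prod_def Basis_vec_def)
  then show ?thesis using that exhaust_2[of i] by auto
next
  case False
  then show ?thesis using assms that by (auto simp: Basis_prod_def)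
qed

lemma Ck_on_space3:
  fixes H :: "space3 \<Rightarrow> space3"
  assumes "\<And>i. smooth_fn (\<lambda>p. fst (H p) $ i)" and "smooth_fn (\<lambda>p. snd (H p))"
  shows "Ck_on k H UNIV"
proof (rule Ck_on_smooth_fn)
  fix b :: space3 assume "b \<in> Basis"
  then show "smooth_fn (\<lambda>p. H p \<bullet> b)"
    by (cases rule: Basis_space3_cases) (simp_all add: inner_prod_def inner_axis assms)
qed


section \<open>The base automorphism and the skew product\<close>

definition cat_matrix :: "int^2^2" where
  "cat_matrix = vector [vector [5, 2], vector [2, 1]]"

definition Lm :: "real^2 \<Rightarrow> real^2" where
  "Lm x = vector [5 * x $ 1 + 2 * x $ 2, 2 * x $ 1 + x $ 2]"

definition Li :: "real^2 \<Rightarrow> real^2" where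
  "Li x = vector [x $ 1 - 2 * x $ 2, 5 * x $ 2 - 2 * x $ 1]"

definition mu :: real where "mu = 3 - 2 * sqrt 2"

definition eu :: "real^2" where "eu = vector [1, sqrt 2 - 1]"
definition es :: "real^2" where "es = vector [1 - sqrt 2, 1]"

text \<open>The matrix is symmetric, so \<open>eu\<close> and \<open>es\<close> are orthogonal, and
  these coordinates are inner products with them divided by their common squared norm 4 - 2 sqrt
  2.\<close>

definition cu :: "real^2 \<Rightarrow> real" where "cu x = ((2 + sqrt 2) * x $ 1 + sqrt 2 * x $ 2) / 4"
definition cs :: "real^2 \<Rightarrow> real" where "cs x = ((2 + sqrt 2) * x $ 2 - sqrt 2 * x $ 1) / 4"

lemma sqrt2_bounds: "141 / 100 < sqrt (2::real)" "sqrt (2::real) < 142 / 100"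
  by (rule real_less_rsqrt, simp add: power2_eq_square) (rule real_less_lsqrt, simp_all add: power2_eq_square)

lemma sqrt2_mult: "sqrt 2 * (sqrt 2 * y) = 2 * (y::real)"
  by (simp flip: mult.assoc)

lemma mu_bounds: "0 < mu" "mu < 18 / 100" "16 / 100 \<le> mu"
  using sqrt2_bounds by (simp_all add: mu_def)

lemma Lm_Li [simp]: "Lm (Li x) = x" and Li_Lm [simp]: "Li (Lm x) = x"
  by (simp_all add: Lm_def Li_def vec_eq_iff forall_2 vector_2 algebra_simps)

lemma linear_Lm: "linear Lm" and linear_Li: "linear Li"
  by (auto intro!: linearI simp: Lm_def Li_def vec_eq_iff forall_2 vector_2 algebra_simps)

lemma linear_cu: "linear cu" and linear_cs: "linear cs"
  by (auto intro!: linearI simp: cu_def cs_def field_simps)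

lemma Lm_eigen: "Lm es = mu *\<^sub>R es" and Li_eigen: "Li eu = mu *\<^sub>R eu"
  by (simp_all add: Lm_def Li_def es_def eu_def mu_def vec_eq_iff forall_2 vector_2 algebra_simps)

lemma coordinates: "cs es = 1" "cs eu = 0" "cu es = 0" "cu eu = 1"
  by (simp_all add: cs_def cu_def es_def eu_def vector_2 algebra_simps)

lemma basis_expansion_su: "cs x *\<^sub>R es + cu x *\<^sub>R eu = x"
  by (simp add: cs_def cu_def es_def eu_def vec_eq_iff forall_2 vector_2 field_simps sqrt2_mult)

lemma Lm_lattice: "k \<in> lattice2 \<Longrightarrow> Lm k \<in> lattice2" and Li_lattice: "k \<in> lattice2 \<Longrightarrow> Li k \<in> lattice2"
  by (simp_all add: lattice2_def Lm_def Li_def forall_2 vector_2)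

lemma coordinate_sum: "\<bar>es $ 1\<bar> + \<bar>es $ 2\<bar> \<le> 3 / 2" "\<bar>eu $ 1\<bar> + \<bar>eu $ 2\<bar> \<le> 3 / 2"
  using sqrt2_bounds by (simp_all add: es_def eu_def vector_2)

text \<open>The rate 10/9 is the reciprocal of the lower bound 9/10 for \<open>phi_t\<close>, and
  1/10 exceeds 4/100 * 3/2 * 10/9. Domination holds because \<open>mu\<close> is below
  18/100.\<close>

interpretation S: stable_skew Lm phi psi d_psi es eu cs cu mu "10 / 9" "1 / 10"
proof (rule stable_skew.intro)
  show "continuous_on UNIV (\<lambda>p. phi (fst p) (snd p))"
    by (intro continuous_at_imp_continuous_on ballI isCont_phi_pair)
  show "continuous_on UNIV (\<lambda>p. d_psi p v)" for v
    using smooth_fn_continuous[OF smooth_fn_d_psi[OF bounded_linear_ident]] .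
  fix p
  let ?t = "phi_t (fst p) (psi (fst p) (snd p))"
  have t: "9 / 10 \<le> ?t" using phi_t_near[of "fst p" "psi (fst p) (snd p)"] by linarith
  then have inv: "0 \<le> inverse ?t" "inverse ?t \<le> 10 / 9"
    by (auto simp: field_simps)
  show "\<bar>d_psi p (0, 1)\<bar> \<le> 10 / 9"
    using inv by (simp add: d_psi_def phi_x_def)
  have "\<bar>phi_x (fst p) (psi (fst p) (snd p)) es\<bar> \<le> 4 / 100 * (3 / 2)"
    by (rule order_trans[OF phi_x_bound mult_left_mono[OF coordinate_sum(1)]]) simp
  then have "\<bar>phi_x (fst p) (psi (fst p) (snd p)) es\<bar> * inverse ?t \<le> 4 / 100 * (3 / 2) * (10 / 9)"
    using inv by (intro mult_mono) auto
  then show "\<bar>d_psi p (es, 0)\<bar> \<le> 1 / 10"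
    using inv by (simp add: d_psi_def abs_mult)
qed (use mu_bounds in \<open>auto simp: linear_Lm Lm_eigen phi_psi psi_phi has_derivative_psi Lm_lattice
    phi_base_periodic phi_fiber_periodic linear_cs linear_cu coordinates basis_expansion_su\<close>)

definition d_phi_Li :: "space3 \<Rightarrow> space3 \<Rightarrow> real" where
  "d_phi_Li p v = phi_x (Li (fst p)) (snd p) (Li (fst v)) + phi_t (Li (fst p)) (snd p) * snd v"

lemma bounded_linear_Li_pair: "bounded_linear (\<lambda>p::space3. (Li (fst p), snd p))"
proof -
  have "linear (\<lambda>p::space3. (Li (fst p), snd p))"
    by (rule linearI) (auto simp: linear_add[OF linear_Li] linear_scale[OF linear_Li])
  then show ?thesis by (simp add: linear_linear)
qed

text \<open>The inverse map has base map \<open>Li\<close>, which contracts \<open>eu\<close>, and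
  fibre map \<open>psi (Li x)\<close> over \<open>x\<close>; the roles of \<open>phi\<close> and
  \<open>psi\<close> are exchanged. Its stable objects are the unstable ones of the original
  map.\<close>

interpretation U: stable_skew Li "\<lambda>x. psi (Li x)" "\<lambda>x. phi (Li x)" d_phi_Li eu es cu cs mu "11 / 10" "1 / 10"
proof (rule stable_skew.intro)
  have der: "((\<lambda>p. phi (Li (fst p)) (snd p)) has_derivative d_phi_Li p) (at p)" for p
    using has_derivative_compose[OF bounded_linear_imp_has_derivative[OF bounded_linear_Li_pair] has_derivative_phi]
    by (simp add: d_phi_Li_def[abs_def])
  then show "((\<lambda>p. phi (Li (fst p)) (snd p)) has_derivative d_phi_Li p) (at p)" for p .
  have "continuous_on UNIV (\<lambda>p. psi (fst p) (snd p))"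
    by (intro continuous_at_imp_continuous_on ballI isCont_psi_pair)
  from continuous_on_compose2[OF this linear_continuous_on[OF bounded_linear_Li_pair]]
  show "continuous_on UNIV (\<lambda>p. psi (Li (fst p)) (snd p))" by simp
  show "continuous_on UNIV (\<lambda>p. d_phi_Li p v)" for v
    unfolding d_phi_Li_def phi_x_def phi_t_def
    by (rule smooth_fn_continuous)
      (intro smooth_fn_intros smooth_fn_base[OF bounded_linear_Li_pair, simplified]
        smooth_fn_fiber[OF bounded_linear_ident])
  fix p
  have "\<bar>phi_t (Li (fst p)) (snd p)\<bar> \<le> 11 / 10"
    using phi_t_near[of "Li (fst p)" "snd p"] by linarith
  then show "\<bar>d_phi_Li p (0, 1)\<bar> \<le> 11 / 10"
    by (simp add: d_phi_Li_def phi_x_def linear_0[OF linear_Li])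
  have "\<bar>phi_x (Li (fst p)) (snd p) (mu *\<^sub>R eu)\<bar> \<le> 4 / 100 * (mu * (\<bar>eu $ 1\<bar> + \<bar>eu $ 2\<bar>))"
    using phi_x_bound[of "Li (fst p)" "snd p" "mu *\<^sub>R eu"] mu_bounds
    by (simp add: abs_mult algebra_simps)
  also have "\<dots> \<le> 4 / 100 * (1 * (3 / 2))"
    using mu_bounds coordinate_sum(2) by (intro mult_left_mono mult_mono) auto
  finally show "\<bar>d_phi_Li p (eu, 0)\<bar> \<le> 1 / 10"
    by (simp add: d_phi_Li_def Li_eigen)
next
  show "psi (Li (x + k)) t = psi (Li x) t" if "k \<in> lattice2" for x k t
    using S.Q_base_periodic[OF Li_lattice[OF that]] by (simp add: linear_add[OF linear_Li])
  show "psi (Li x) (t + j) = psi (Li x) t + j" if "j \<in> lattice1" for x j t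
    using S.Q_fiber_periodic[OF that] .
  show "cu x *\<^sub>R eu + cs x *\<^sub>R es = x" for x
    using basis_expansion_su[of x] by (simp add: add.commute)
qed (use mu_bounds in \<open>auto simp: linear_Li Li_eigen phi_psi psi_phi Li_lattice
    linear_cs linear_cu coordinates\<close>)

definition F :: "space3 \<Rightarrow> space3" where
  "F p = (Lm (fst p), phi (fst p) (snd p))"

definition G :: "space3 \<Rightarrow> space3" where
  "G p = (Li (fst p), psi (Li (fst p)) (snd p))"

definition DF :: "space3 \<Rightarrow> space3 \<Rightarrow> space3" where
  "DF p v = (Lm (fst v), phi_x (fst p) (snd p) (fst v) + phi_t (fst p) (snd p) * snd v)"

definition DG :: "space3 \<Rightarrow> space3 \<Rightarrow> space3" where
  "DG p v = (Li (fst v), d_psi (Li (fst p), snd p) (Li (fst v), snd v))"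

lemma G_F [simp]: "G (F p) = p" and F_G [simp]: "F (G p) = p"
  by (simp_all add: F_def G_def phi_psi psi_phi)

lemma bounded_linear_base_map:
  fixes l :: "real^2 \<Rightarrow> real^2"
  assumes "linear l"
  shows "bounded_linear (\<lambda>p::space3. l (fst p))"
  by (rule bounded_linear_compose[OF iffD2[OF linear_linear assms] bounded_linear_fst])

lemma has_derivative_F: "(F has_derivative DF p) (at p)"
  unfolding F_def DF_def
  by (intro has_derivative_Pair has_derivative_phi bounded_linear_imp_has_derivative
      bounded_linear_base_map linear_Lm)

lemma has_derivative_G: "(G has_derivative DG p) (at p)"
proof -
  have "((\<lambda>p. psi (Li (fst p)) (snd p)) has_derivative (\<lambda>v. d_psi (Li (fst p), snd p) (Li (fst v), snd v))) (at p)"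
    using has_derivative_compose[OF bounded_linear_imp_has_derivative[OF bounded_linear_Li_pair] has_derivative_psi]
    by simp
  then show ?thesis
    unfolding G_def DG_def
    by (intro has_derivative_Pair bounded_linear_imp_has_derivative bounded_linear_base_map linear_Li)
qed

text \<open>The chain rule applied to \<open>F_G\<close> and \<open>G_F\<close> avoids multiplying
  out the explicit derivatives.\<close>

lemma DF_DG: "DF p (DG (F p) v) = v" and DG_DF: "DG (F p) (DF p v) = v"
proof -
  have "((\<lambda>q. F (G q)) has_derivative (\<lambda>v. DF p (DG (F p) v))) (at (F p))"
    using has_derivative_compose[OF has_derivative_G[of "F p"], of F "DF p"] has_derivative_F[of p] by simp
  then have "(\<lambda>v. DF p (DG (F p) v)) = (\<lambda>v. v)"
    using has_derivative_unique[OF _ has_derivative_ident] by simp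
  then show "DF p (DG (F p) v) = v" by metis
  have "((\<lambda>q. G (F q)) has_derivative (\<lambda>v. DG (F p) (DF p v))) (at p)"
    using has_derivative_compose[OF has_derivative_F has_derivative_G] .
  then have "(\<lambda>v. DG (F p) (DF p v)) = (\<lambda>v. v)"
    using has_derivative_unique[OF _ has_derivative_ident] by simp
  then show "DG (F p) (DF p v) = v" by metis
qed

lemma linear_DF: "linear (DF p)" and linear_DG: "linear (DG p)"
  using has_derivative_linear[OF has_derivative_F] has_derivative_linear[OF has_derivative_G] by auto

definition frame_s :: "space3 \<Rightarrow> space3" where
  "frame_s p = (es, S.sigma (fst p) (snd p))"

definition frame_u :: "space3 \<Rightarrow> space3" where
  "frame_u p = (eu, U.sigma (fst p) (snd p))"

text \<open>\<open>sigma_invariant\<close> speaks about the inverse derivative, so the relation is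
  established for \<open>DG\<close> and then inverted by \<open>DF_DG\<close>.\<close>

lemma DF_frame_s: "DF p (frame_s p) = mu *\<^sub>R frame_s (F p)"
proof -
  have Li_es: "Li (mu *\<^sub>R es) = es"
    unfolding Lm_eigen[symmetric] by simp
  have "DG (F p) (mu *\<^sub>R frame_s (F p)) = frame_s p"
    using S.sigma_invariant[of "fst p" "snd p"]
    by (simp add: DG_def frame_s_def F_def Li_es)
  then show ?thesis by (metis DF_DG)
qed

lemma DF_frame_u: "DF p (frame_u p) = inverse mu *\<^sub>R frame_u (F p)"
proof -
  have "mu *\<^sub>R DF p (frame_u p) = DF p (mu *\<^sub>R frame_u p)"
    by (simp add: linear_scale[OF linear_DF])
  also have "mu *\<^sub>R frame_u p = (Li eu, mu * U.sigma (fst p) (snd p))"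
    by (simp add: frame_u_def Li_eigen)
  also have "DF p \<dots> = frame_u (F p)"
    using U.sigma_invariant[of "Lm (fst p)" "phi (fst p) (snd p)"]
    by (simp add: DF_def frame_u_def F_def psi_phi d_phi_Li_def)
  finally have "inverse mu *\<^sub>R (mu *\<^sub>R DF p (frame_u p)) = inverse mu *\<^sub>R frame_u (F p)" by simp
  then show ?thesis using mu_bounds by simp
qed

lemma DF_center: "DF p (0, 1) = phi_t (fst p) (snd p) *\<^sub>R (0, 1)"
  by (simp add: DF_def phi_x_def linear_0[OF linear_Lm])

lemma norm_es: "(norm es)\<^sup>2 = 4 - 2 * sqrt 2" and norm_eu: "(norm eu)\<^sup>2 = 4 - 2 * sqrt 2"
  using sqrt2_bounds by (simp_all add: norm_vec_def L2_set_def sum_2 es_def eu_def vector_2 power2_eq_square algebra_simps)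

lemma sigma_small: "\<bar>S.sigma x t\<bar> \<le> 1 / 4" "\<bar>U.sigma x t\<bar> \<le> 1 / 4"
proof -
  have "1 / 10 / (1 - mu * (10 / 9)) \<le> 1 / 4" "1 / 10 / (1 - mu * (11 / 10)) \<le> 1 / 4"
    using mu_bounds by (simp_all add: field_simps)
  then show "\<bar>S.sigma x t\<bar> \<le> 1 / 4" "\<bar>U.sigma x t\<bar> \<le> 1 / 4"
    using S.sigma_bound[of x t] U.sigma_bound[of x t] by linarith+
qed

lemma frame_norm_aux:
  fixes e :: "real^2" and r :: real
  assumes "(norm e)\<^sup>2 = 4 - 2 * sqrt 2" "\<bar>r\<bar> \<le> 1 / 4"
  shows "1 \<le> norm (e, r)" "norm (e, r) \<le> 2"
proof -
  have r: "r\<^sup>2 \<le> 1" using assms(2) by (simp add: abs_square_le_1)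
  have "norm (e, r) = sqrt (4 - 2 * sqrt 2 + r\<^sup>2)"
    by (simp add: norm_Pair assms(1))
  moreover have "1 \<le> 4 - 2 * sqrt 2 + r\<^sup>2" "4 - 2 * sqrt 2 + r\<^sup>2 \<le> 4"
    using sqrt2_bounds r zero_le_power2[of r] by linarith+
  ultimately show "1 \<le> norm (e, r)" "norm (e, r) \<le> 2"
    using real_sqrt_le_mono[of "4 - 2 * sqrt 2 + r\<^sup>2" 4] by simp_all
qed

lemma frame_s_norm: "1 \<le> norm (frame_s p)" "norm (frame_s p) \<le> 2"
  unfolding frame_s_def by (rule frame_norm_aux[OF norm_es sigma_small(1)])+

lemma frame_u_norm: "1 \<le> norm (frame_u p)" "norm (frame_u p) \<le> 2"
  unfolding frame_u_def by (rule frame_norm_aux[OF norm_eu sigma_small(2)])+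


section \<open>Partial hyperbolicity\<close>

definition skew_map :: "torus3 \<Rightarrow> torus3" where
  "skew_map y = cover3 (F (rep3 y))"

definition skew_inv :: "torus3 \<Rightarrow> torus3" where
  "skew_inv y = cover3 (G (rep3 y))"

lemma rep3_diff: "rep3 (cover3 p) - p \<in> lattice3"
  using cover3_eq_iff cover3_rep3 by metis

lemma F_translate:
  assumes "g \<in> lattice3"
  shows "F (p + g) - F p \<in> lattice3"
proof -
  have g: "fst g \<in> lattice2" "snd g \<in> lattice1"
    using assms by (simp_all add: lattice3_def mem_Times_iff)
  show ?thesis
    using g by (simp add: F_def phi_base_periodic phi_fiber_periodic linear_add[OF linear_Lm]
        lattice3_def Lm_lattice)
qed

lemma G_translate:
  assumes "g \<in> lattice3"
  shows "G (p + g) - G p \<in> lattice3"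
proof -
  have g: "fst g \<in> lattice2" "snd g \<in> lattice1"
    using assms by (simp_all add: lattice3_def mem_Times_iff)
  show ?thesis
    using g by (simp add: G_def U.P_base_periodic U.P_fiber_periodic linear_add[OF linear_Li]
        lattice3_def Li_lattice flip: linear_add[OF linear_Li])
      (simp add: linear_add[OF linear_Li] Li_lattice)
qed

lemma skew_map_cover3: "skew_map (cover3 p) = cover3 (F p)"
  using F_translate[OF rep3_diff[of p], of p] by (simp add: skew_map_def cover3_eq_iff)

lemma skew_inv_cover3: "skew_inv (cover3 p) = cover3 (G p)"
  using G_translate[OF rep3_diff[of p], of p] by (simp add: skew_inv_def cover3_eq_iff)

lemma skew_inv_map: "skew_inv (skew_map y) = y" and skew_map_inv: "skew_map (skew_inv y) = y"
  by (cases y rule: cover3_cases; simp add: skew_map_cover3 skew_inv_cover3)+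

lemma bij_skew_map: "bij skew_map"
  by (rule o_bij[of skew_inv]) (auto simp: skew_inv_map skew_map_inv)

lemma inv_skew_map: "inv skew_map = skew_inv"
  by (rule inv_unique_comp) (auto simp: skew_inv_map skew_map_inv)

lemma smooth_diffeo_skew_map: "smooth_diffeo skew_map"
proof -
  have fst_lin: "smooth_fn (\<lambda>p. fst p $ i)" for i
    using smooth_fn_base[OF bounded_linear_ident] .
  have snd_lin: "smooth_fn (\<lambda>p. snd p)"
    using smooth_fn_fiber[OF bounded_linear_ident] .
  have "Ck_on k F UNIV" for k
  proof (rule Ck_on_space3)
    show "smooth_fn (\<lambda>p. fst (F p) $ i)" for i
      using exhaust_2[of i] by (auto simp: F_def Lm_def vector_2 intro!: smooth_fn_intros fst_lin)
    show "smooth_fn (\<lambda>p. snd (F p))"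
      by (simp add: F_def phi_def) (intro smooth_fn_intros fst_lin snd_lin)
  qed
  moreover have "Ck_on k G UNIV" for k
  proof (rule Ck_on_space3)
    show "smooth_fn (\<lambda>p. fst (G p) $ i)" for i
      using exhaust_2[of i] by (auto simp: G_def Li_def vector_2 intro!: smooth_fn_intros fst_lin)
    show "smooth_fn (\<lambda>p. snd (G p))"
      using smooth_fn.psi[OF bounded_linear_Li_pair] by (simp add: G_def)
  qed
  ultimately have "Ck_map k skew_map" "Ck_map k skew_inv" for k
    unfolding Ck_map_def is_lift_def
    using skew_map_cover3 skew_inv_cover3 open_UNIV UNIV_I by metis+
  then show ?thesis
    by (simp add: smooth_diffeo_def Ck_diffeo_def bij_skew_map inv_skew_map)
qed

lemma funpow_cover3: "cover3 ((F ^^ n) p) = (skew_map ^^ n) (cover3 p)"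
  by (induction n arbitrary: p) (simp_all flip: skew_map_cover3)

lemma D3_skew_map: "D3 skew_map (cover3 p) = DF p"
  by (rule D3_eq[OF _ has_derivative_F]) (simp add: skew_map_cover3)

lemma D3_skew_inv: "D3 (inv skew_map) (skew_map (cover3 p)) = DG (F p)"
  unfolding inv_skew_map skew_map_cover3
  by (rule D3_eq[OF _ has_derivative_G]) (simp add: skew_inv_cover3)

lemma D3_power:
  "D3 (skew_map ^^ n) (cover3 p) (r *\<^sub>R frame_s p) = (r * mu ^ n) *\<^sub>R frame_s ((F ^^ n) p) \<and>
   D3 (skew_map ^^ n) (cover3 p) (r *\<^sub>R frame_u p) = (r * inverse mu ^ n) *\<^sub>R frame_u ((F ^^ n) p)"
proof -
  have "\<exists>D. (F ^^ n has_derivative D) (at p) \<and> D (frame_s p) = mu ^ n *\<^sub>R frame_s ((F ^^ n) p) \<and>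
      D (frame_u p) = inverse mu ^ n *\<^sub>R frame_u ((F ^^ n) p)"
  proof (induction n)
    case 0
    show ?case by (rule exI[of _ "\<lambda>v. v"]) (simp add: id_def)
  next
    case (Suc n)
    then obtain D where D: "(F ^^ n has_derivative D) (at p)"
        "D (frame_s p) = mu ^ n *\<^sub>R frame_s ((F ^^ n) p)"
        "D (frame_u p) = inverse mu ^ n *\<^sub>R frame_u ((F ^^ n) p)" by blast
    have "(F ^^ Suc n has_derivative (\<lambda>v. DF ((F ^^ n) p) (D v))) (at p)"
      using has_derivative_compose[OF D(1) has_derivative_F] by (simp add: o_def)
    moreover have "DF ((F ^^ n) p) (D (frame_s p)) = mu ^ Suc n *\<^sub>R frame_s ((F ^^ Suc n) p)"
      "DF ((F ^^ n) p) (D (frame_u p)) = inverse mu ^ Suc n *\<^sub>R frame_u ((F ^^ Suc n) p)"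
      by (simp_all add: D linear_scale[OF linear_DF] DF_frame_s DF_frame_u mult.commute)
    ultimately show ?case by blast
  qed
  then obtain D where D: "(F ^^ n has_derivative D) (at p)"
      "D (frame_s p) = mu ^ n *\<^sub>R frame_s ((F ^^ n) p)"
      "D (frame_u p) = inverse mu ^ n *\<^sub>R frame_u ((F ^^ n) p)" by blast
  have "D3 (skew_map ^^ n) (cover3 p) = D"
    by (rule D3_eq[OF _ D(1)]) (rule funpow_cover3)
  then show ?thesis
    by (simp add: linear_scale[OF has_derivative_linear[OF D(1)]] D)
qed

definition Ec :: subbundle where
  "Ec y = span {(0, 1)}"

lemma E_s_cover3: "S.E (cover3 p) = range (\<lambda>r. r *\<^sub>R frame_s p)"
  by (simp add: S.E_def S.E_frame_cover3 frame_s_def span_singleton)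

lemma E_u_cover3: "U.E (cover3 p) = range (\<lambda>r. r *\<^sub>R frame_u p)"
  by (simp add: U.E_def U.E_frame_cover3 frame_u_def span_singleton)

lemma Ec_eq: "Ec y = range (\<lambda>r. r *\<^sub>R (0, 1))"
  by (simp add: Ec_def span_singleton)

lemma continuous_bundle_Ec: "continuous_bundle Ec"
  unfolding continuous_bundle_def
proof (intro allI)
  fix y
  show "\<exists>U n b. open U \<and> y \<in> U \<and> (\<forall>i<n. continuous_on U (b i)) \<and>
      (\<forall>y\<in>U. inj_on (\<lambda>i. b i y) {..<n} \<and> independent ((\<lambda>i. b i y) ` {..<n}) \<and>
        Ec y = span ((\<lambda>i. b i y) ` {..<n::nat}))"
    by (rule exI[of _ UNIV], rule exI[of _ 1], rule exI[of _ "\<lambda>i y. (0, 1)"])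
      (auto simp: Ec_def lessThan_Suc zero_prod_def)
qed

lemma image_line:
  fixes D :: "space3 \<Rightarrow> space3"
  assumes "linear D" "D v = c *\<^sub>R w" "c \<noteq> 0"
  shows "D ` range (\<lambda>r. r *\<^sub>R v) = range (\<lambda>r. r *\<^sub>R w)"
proof -
  have "D ` range (\<lambda>r. r *\<^sub>R v) = range (\<lambda>r. (r * c) *\<^sub>R w)"
    by (simp add: image_image linear_scale[OF assms(1)] assms(2))
  also have "\<dots> = (\<lambda>r. r *\<^sub>R w) ` range (\<lambda>r. r * c)"
    by (simp only: image_image)
  also have "range (\<lambda>r. r * c) = UNIV"
    using assms(3) by (intro surjI[of _ "\<lambda>r. r / c"]) simp
  finally show ?thesis .
qed

lemma onorm_on_line:
  assumes "linear D" "w \<noteq> 0"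
  shows "onorm_on (range (\<lambda>r. r *\<^sub>R w)) D = norm (D w) / norm w"
proof -
  let ?S = "{v \<in> range (\<lambda>r. r *\<^sub>R w). norm v = 1}"
  have "norm (D v) = norm (D w) / norm w" if v: "v \<in> ?S" for v
  proof -
    have "v \<in> range (\<lambda>r. r *\<^sub>R w)" "norm v = 1" using v by simp_all
    moreover from this obtain r where "v = r *\<^sub>R w" by blast
    ultimately have r: "v = r *\<^sub>R w" "\<bar>r\<bar> * norm w = 1" by simp_all
    have "norm (D v) = \<bar>r\<bar> * norm (D w)" by (simp add: r linear_scale[OF assms(1)])
    moreover have "\<bar>r\<bar> = 1 / norm w" using r assms(2) by (simp add: field_simps)
    ultimately show ?thesis by simp
  qed
  moreover have "(1 / norm w) *\<^sub>R w \<in> ?S" using assms(2) by auto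
  ultimately have "(\<lambda>v. norm (D v)) ` ?S = {norm (D w) / norm w}"
    by (intro equalityI subsetI) (auto simp del: mem_Collect_eq intro!: image_eqI)
  then show ?thesis by (simp add: onorm_on_def)
qed

text \<open>The base component alone determines the two strong components through \<open>cs\<close>
  and \<open>cu\<close>; the centre absorbs what remains in the fibre.\<close>

lemma splitting_unique:
  "\<exists>!(a, b, c). a \<in> S.E y \<and> b \<in> Ec y \<and> c \<in> U.E y \<and> v = a + b + c"
proof -
  obtain p where y: "y = cover3 p" by (rule cover3_cases)
  let ?a = "cs (fst v) *\<^sub>R frame_s p" and ?c = "cu (fst v) *\<^sub>R frame_u p"
  let ?b = "(snd v - snd ?a - snd ?c) *\<^sub>R (0, 1) :: space3"
  show ?thesis
  proof (rule ex1I[of _ "(?a, ?b, ?c)"])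
    show "case (?a, ?b, ?c) of (a, b, c) \<Rightarrow> a \<in> S.E y \<and> b \<in> Ec y \<and> c \<in> U.E y \<and> v = a + b + c"
      unfolding y E_s_cover3 E_u_cover3 Ec_eq prod.case
      by (intro conjI rangeI) (simp add: prod_eq_iff frame_s_def frame_u_def basis_expansion_su)
  next
    fix z
    assume "case z of (a, b, c) \<Rightarrow> a \<in> S.E y \<and> b \<in> Ec y \<and> c \<in> U.E y \<and> v = a + b + c"
    then obtain a b c where abc: "z = (a, b, c)" "a \<in> S.E y" "b \<in> Ec y" "c \<in> U.E y" "v = a + b + c"
      by (cases z) auto
    then obtain r q s where "a = r *\<^sub>R frame_s p" "b = q *\<^sub>R (0, 1)" "c = s *\<^sub>R frame_u p"
      unfolding y E_s_cover3 E_u_cover3 Ec_eq by blast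
    with abc have z: "z = (r *\<^sub>R frame_s p, q *\<^sub>R (0, 1), s *\<^sub>R frame_u p)"
        and v: "v = r *\<^sub>R frame_s p + q *\<^sub>R (0, 1) + s *\<^sub>R frame_u p" by simp_all
    have "fst v = r *\<^sub>R es + s *\<^sub>R eu" by (simp add: v frame_s_def frame_u_def)
    then have "cs (fst v) = r" "cu (fst v) = s"
      by (simp_all add: linear_add[OF linear_cs] linear_scale[OF linear_cs]
          linear_add[OF linear_cu] linear_scale[OF linear_cu] coordinates)
    moreover from this have "snd v - snd ?a - snd ?c = q" by (simp add: v)
    ultimately show "z = (?a, ?b, ?c)" by (simp add: z)
  qed
qed

lemma scaleR_solve: "c *\<^sub>R x = w \<Longrightarrow> c \<noteq> 0 \<Longrightarrow> x = inverse c *\<^sub>R w"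
  for x :: "'a::real_vector"
  by auto

lemma ph_splitting_skew_map: "ph_splitting skew_map S.E Ec U.E"
  unfolding ph_splitting_def
proof (intro conjI allI splitting_unique)
  have nz: "frame_s p \<noteq> 0" "frame_u p \<noteq> 0" "(0, 1) \<noteq> (0 :: space3)" for p
    using frame_s_norm(1)[of p] frame_u_norm(1)[of p] by (auto simp: zero_prod_def)
  have inv: "invariant_bundle skew_map S.E" "invariant_bundle skew_map U.E" "invariant_bundle skew_map Ec"
  proof -
    have "D3 skew_map y ` S.E y = S.E (skew_map y) \<and> D3 skew_map y ` U.E y = U.E (skew_map y) \<and>
        D3 skew_map y ` Ec y = Ec (skew_map y)" for y
    proof (cases y rule: cover3_cases)
      case (1 p)
      show ?thesis
        unfolding 1 D3_skew_map skew_map_cover3 E_s_cover3 E_u_cover3 Ec_eq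
        using mu_bounds phi_t_pos[of "fst p" "snd p"]
        by (intro conjI image_line[OF linear_DF DF_frame_s] image_line[OF linear_DF DF_frame_u]
            image_line[OF linear_DF DF_center]) auto
    qed
    then show "invariant_bundle skew_map S.E" "invariant_bundle skew_map U.E" "invariant_bundle skew_map Ec"
      by (auto simp: invariant_bundle_def)
  qed
  have nontrivial: "range (\<lambda>r. r *\<^sub>R w) \<noteq> {0}" if "w \<noteq> 0" for w :: space3
    using that by (metis rangeI scaleR_one singletonD)
  have "S.E y \<noteq> {0} \<and> U.E y \<noteq> {0} \<and> Ec y \<noteq> {0}" for y
  proof (cases y rule: cover3_cases)
    case (1 p)
    show ?thesis
      unfolding 1 E_s_cover3 E_u_cover3 Ec_eq by (intro conjI nontrivial nz)
  qed
  then show "\<forall>E\<in>{S.E, Ec, U.E}. continuous_bundle E \<and> invariant_bundle skew_map E \<and> (\<forall>x. E x \<noteq> {0})"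
    using inv S.continuous_bundle_E U.continuous_bundle_E continuous_bundle_Ec by blast
  show "uniformly_contracting skew_map S.E"
    unfolding uniformly_contracting_def
  proof (intro exI conjI allI ballI)
    fix n y v assume "v \<in> S.E y"
    then obtain p r where y: "y = cover3 p" "v = r *\<^sub>R frame_s p"
      by (metis E_s_cover3 cover3_cases imageE)
    have "norm (D3 (skew_map ^^ n) y v) = (\<bar>r\<bar> * mu ^ n) * norm (frame_s ((F ^^ n) p))"
      using mu_bounds by (simp add: y D3_power abs_mult)
    also have "\<dots> \<le> (\<bar>r\<bar> * mu ^ n) * (2 * norm (frame_s p))"
      using frame_s_norm(2)[of "(F ^^ n) p"] frame_s_norm(1)[of p] mu_bounds
      by (intro mult_left_mono) auto
    \<comment> \<open>This fixes the existential witnesses: the rate is \<open>mu\<close>, and the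
      constant 2 bounds the ratio of two frame norms, all of which lie between 1 and 2.\<close>
    finally show "norm (D3 (skew_map ^^ n) y v) \<le> 2 * mu ^ n * norm v"
      by (simp add: y algebra_simps)
  qed (use mu_bounds in auto)
  show "uniformly_expanding skew_map U.E"
    unfolding uniformly_expanding_def
  proof (intro exI conjI allI ballI)
    fix n y v assume "v \<in> U.E y"
    then obtain p r where y: "y = cover3 p" "v = r *\<^sub>R frame_u p"
      by (metis E_u_cover3 cover3_cases imageE)
    have "mu ^ n * norm (D3 (skew_map ^^ n) y v) = \<bar>r\<bar> * norm (frame_u ((F ^^ n) p))"
      using mu_bounds by (simp add: y D3_power abs_mult power_inverse)
    moreover have "norm v \<le> \<bar>r\<bar> * (2 * norm (frame_u ((F ^^ n) p)))"
      using frame_u_norm(2)[of p] frame_u_norm(1)[of "(F ^^ n) p"]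
      by (simp add: y) (intro mult_left_mono, auto)
    ultimately show "norm v \<le> 2 * mu ^ n * norm (D3 (skew_map ^^ n) y v)"
      by (simp add: algebra_simps)
  qed (use mu_bounds in auto)
  fix y
  obtain p where y: "y = cover3 p" by (rule cover3_cases)
  have t: "92 / 100 \<le> phi_t (fst p) (snd p)" "phi_t (fst p) (snd p) \<le> 108 / 100"
    using phi_t_near[of "fst p" "snd p"] by linarith+
  have DG_center: "DG (F p) (0, 1) = inverse (phi_t (fst p) (snd p)) *\<^sub>R (0, 1)"
    using DG_DF[of p "(0, 1)"] t unfolding DF_center linear_scale[OF linear_DG]
    by (intro scaleR_solve) auto
  have DG_u: "DG (F p) (frame_u (F p)) = mu *\<^sub>R frame_u p"
    using DG_DF[of p "frame_u p"] mu_bounds unfolding DF_frame_u linear_scale[OF linear_DG]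
    using scaleR_solve[of "inverse mu" _ "frame_u p"] by simp
  have c: "onorm_on (Ec (skew_map y)) (D3 (inv skew_map) (skew_map y)) = inverse (phi_t (fst p) (snd p))"
    unfolding y D3_skew_inv Ec_eq onorm_on_line[OF linear_DG nz(3)] DG_center
    using t by (simp add: norm_Pair)
  have c': "onorm_on (Ec y) (D3 skew_map y) = phi_t (fst p) (snd p)"
    unfolding y D3_skew_map Ec_eq onorm_on_line[OF linear_DF nz(3)] DF_center
    using t by (simp add: norm_Pair)
  have s: "onorm_on (S.E y) (D3 skew_map y) \<le> mu * 2"
  proof -
    have "mu * (norm (frame_s (F p)) / norm (frame_s p)) \<le> mu * (2 / 1)"
      using frame_s_norm[of p] frame_s_norm[of "F p"] mu_bounds
      by (intro mult_left_mono frac_le) auto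
    then show ?thesis
      unfolding y D3_skew_map E_s_cover3 onorm_on_line[OF linear_DF nz(1)] DF_frame_s
      using mu_bounds by simp
  qed
  have u: "onorm_on (U.E (skew_map y)) (D3 (inv skew_map) (skew_map y)) \<le> mu * 2"
      "0 < onorm_on (U.E (skew_map y)) (D3 (inv skew_map) (skew_map y))"
  proof -
    have "mu * (norm (frame_u p) / norm (frame_u (F p))) \<le> mu * (2 / 1)"
      using frame_u_norm[of p] frame_u_norm[of "F p"] mu_bounds
      by (intro mult_left_mono frac_le) auto
    moreover have eq: "onorm_on (U.E (skew_map y)) (D3 (inv skew_map) (skew_map y)) =
        mu * (norm (frame_u p) / norm (frame_u (F p)))"
      unfolding y D3_skew_inv unfolding skew_map_cover3 E_u_cover3 onorm_on_line[OF linear_DG nz(2)] DG_u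
      using mu_bounds by simp
    ultimately show "onorm_on (U.E (skew_map y)) (D3 (inv skew_map) (skew_map y)) \<le> mu * 2"
      by simp
    show "0 < onorm_on (U.E (skew_map y)) (D3 (inv skew_map) (skew_map y))"
      unfolding eq using nz mu_bounds by simp
  qed
  show "onorm_on (S.E y) (D3 skew_map y) < inverse (onorm_on (Ec (skew_map y)) (D3 (inv skew_map) (skew_map y)))"
    unfolding c using s t mu_bounds by simp
  \<comment> \<open>Pointwise domination survives the non-constant frame lengths: 2 *
    \<open>mu\<close> is below 36/100, so its reciprocal still exceeds the largest fibre
    derivative.\<close>
  have "inverse (mu * 2) \<le> inverse (onorm_on (U.E (skew_map y)) (D3 (inv skew_map) (skew_map y)))"
    using u by (intro le_imp_inverse_le)
  moreover have "108 / 100 < inverse (mu * 2)"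
    using mu_bounds by (simp add: field_simps)
  ultimately show "onorm_on (Ec y) (D3 skew_map y) < inverse (onorm_on (U.E (skew_map y)) (D3 (inv skew_map) (skew_map y)))"
    unfolding c' using t by linarith
qed

lemma partially_hyperbolic_skew_map: "partially_hyperbolic skew_map"
  using smooth_diffeo_skew_map ph_splitting_skew_map
  by (auto simp: partially_hyperbolic_def smooth_diffeo_def)

section \<open>The base matrix and the skew-product inequalities\<close>

lemma real_cat_matrix: "real_matrix cat_matrix *v x = Lm x"
  by (simp add: real_matrix_def cat_matrix_def Lm_def matrix_vector_mult_def vec_eq_iff forall_2 vector_2 sum_2)

lemma hyperbolic_cat_matrix: "hyperbolic_matrix cat_matrix"
  unfolding hyperbolic_matrix_def
proof (intro conjI allI impI)
  let ?B = "vector [vector [1, -2], vector [-2, 5]] :: int^2^2"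
  show "invertible cat_matrix"
    unfolding invertible_def
    by (rule exI[of _ ?B])
      (simp add: cat_matrix_def matrix_matrix_mult_def mat_def vec_eq_iff forall_2 vector_2 sum_2)
  fix l :: complex and v :: "complex^2"
  assume *: "v \<noteq> 0 \<and> complex_matrix cat_matrix *v v = l *s v"
  then have "(complex_matrix cat_matrix *v v) $ i = (l *s v) $ i" for i by simp
  from this[of 1] this[of 2]
  have e: "5 * v $ 1 + 2 * v $ 2 = l * v $ 1" "2 * v $ 1 + v $ 2 = l * v $ 2"
    by (simp_all add: complex_matrix_def cat_matrix_def matrix_vector_mult_def vector_2 sum_2)
  \<comment> \<open>Elimination gives the characteristic polynomial. On the unit circle the modulus
    of \<open>l\<^sup>2 + 1\<close> is at most 2, whereas \<open>6 * l\<close> has modulus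
    6.\<close>
  have "(l\<^sup>2 - 6 * l + 1) * v $ 1 = 0" "(l\<^sup>2 - 6 * l + 1) * v $ 2 = 0"
    using e by algebra+
  moreover have "v $ 1 \<noteq> 0 \<or> v $ 2 \<noteq> 0"
    using * by (auto simp: vec_eq_iff forall_2)
  ultimately have "l\<^sup>2 - 6 * l + 1 = 0" by auto
  then have quad: "l\<^sup>2 + 1 = 6 * l" by (simp add: algebra_simps)
  show "cmod l \<noteq> 1"
  proof
    assume "cmod l = 1"
    then have "6 = cmod (l\<^sup>2 + 1)" by (simp add: quad norm_mult)
    also have "\<dots> \<le> cmod (l\<^sup>2) + 1" using norm_triangle_ineq[of "l\<^sup>2" 1] by simp
    also have "\<dots> = 2" using \<open>cmod l = 1\<close> by (simp add: norm_power)
    finally show False by simp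
  qed
qed

lemma matrix_norm_ge:
  assumes "norm (x :: real^2) = 1" "k \<le> \<bar>(B *v x) $ i\<bar>"
  shows "k \<le> matrix_norm B"
proof -
  have "k \<le> norm (B *v x)" using assms(2) component_le_norm_cart[of "B *v x" i] by linarith
  also have "\<dots> \<le> matrix_norm B * norm x"
    unfolding matrix_norm_def by (rule onorm[OF matrix_vector_mul_bounded_linear])
  finally show ?thesis using assms(1) by simp
qed

lemma inverse_cat_matrix: "matrix_inv (real_matrix cat_matrix) *v x = Li x"
proof -
  let ?B = "vector [vector [1, -2], vector [-2, 5]] :: real^2^2"
  have "real_matrix cat_matrix ** ?B = mat 1" "?B ** real_matrix cat_matrix = mat 1"
    by (simp_all add: real_matrix_def cat_matrix_def matrix_matrix_mult_def mat_def vec_eq_iff forall_2 vector_2 sum_2)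
  then have "matrix_inv (real_matrix cat_matrix) ** real_matrix cat_matrix = mat 1"
    unfolding matrix_inv_def by (rule someI2[of _ ?B, OF conjI]) simp
  then have "matrix_inv (real_matrix cat_matrix) *v (real_matrix cat_matrix *v Li x) = Li x"
    by (simp add: matrix_vector_mul_assoc)
  then show ?thesis by (simp add: real_cat_matrix)
qed

lemma ph_skew_product_skew_map: "ph_skew_product cat_matrix skew_map"
  unfolding ph_skew_product_def
proof (intro conjI exI allI)
  let ?\<phi> = "\<lambda>x t. circle_of (phi (rep_torus2 x) (rep_circle t))"
  show "partially_hyperbolic skew_map" by (rule partially_hyperbolic_skew_map)
  fix x t
  have "toral_map cat_matrix x = torus2_of (Lm (rep_torus2 x))"
    using toral_map.abs_eq[of cat_matrix "rep_torus2 x"] by (simp add: real_cat_matrix)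
  then show "skew_map (x, t) = (toral_map cat_matrix x, ?\<phi> x t)"
    by (simp add: skew_map_def rep3_def F_def cover3_def)
  have "circle_of (phi (rep_torus2 x) q) = ?\<phi> x (circle_of q)" for q
  proof -
    have "rep_circle (circle_of q) - q \<in> lattice1"
      using circle_of_eq_iff circle_of_rep by metis
    then have "phi (rep_torus2 x) (rep_circle (circle_of q)) - phi (rep_torus2 x) q \<in> lattice1"
      using phi_fiber_periodic[of "rep_circle (circle_of q) - q" "rep_torus2 x" q] by simp
    then show ?thesis
      by (metis circle_of_eq_iff)
  qed
  then have "D_circle (?\<phi> x) (circle_of (rep_circle t)) = (*) (phi_t (rep_torus2 x) (rep_circle t))"
    by (rule D_circle_eq) (rule phi_fiber_deriv[unfolded has_field_derivative_def])
  moreover have "onorm ((*) c) = \<bar>c\<bar>" for c :: real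
  proof (rule antisym)
    show "onorm ((*) c) \<le> \<bar>c\<bar>" by (rule onorm_le) (simp add: abs_mult)
    show "\<bar>c\<bar> \<le> onorm ((*) c)" using onorm[OF bounded_linear_mult_right, of c 1] by simp
  qed
  ultimately have D: "onorm (D_circle (?\<phi> x) t) = phi_t (rep_torus2 x) (rep_circle t)"
    using phi_t_pos by (simp add: less_imp_le)
  \<comment> \<open>The entry 5 is read off the first column of the matrix and, below, the second
    column of its inverse; both bounds are far from the fibre derivatives.\<close>
  have "5 \<le> matrix_norm (real_matrix cat_matrix)"
    by (rule matrix_norm_ge[of "axis 1 1" _ _ 1]) (rule norm_axis_1, simp add: real_cat_matrix Lm_def vector_2 axis_def)
  then show "onorm (D_circle (?\<phi> x) t) < matrix_norm (real_matrix cat_matrix)"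
    unfolding D using phi_t_near[of "rep_torus2 x" "rep_circle t"] by linarith
  have 5: "5 \<le> matrix_norm (matrix_inv (real_matrix cat_matrix))"
    by (rule matrix_norm_ge[of "axis 2 1" _ _ 2]) (rule norm_axis_1, simp add: inverse_cat_matrix Li_def vector_2 axis_def)
  have "inverse (matrix_norm (matrix_inv (real_matrix cat_matrix))) \<le> 1 / 5"
    using le_imp_inverse_le[OF 5] by simp
  then show "inverse (matrix_norm (matrix_inv (real_matrix cat_matrix))) < onorm (D_circle (?\<phi> x) t)"
    unfolding D using phi_t_near[of "rep_torus2 x" "rep_circle t"] by linarith
qed


section \<open>Accessibility\<close>

lemma invariant_foliation_s: "invariant_foliation skew_map S.W S.E"
  unfolding invariant_foliation_def
  using S.foliation_tangent_W S.image_W[of skew_map] by (simp add: skew_map_cover3 F_def)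

lemma invariant_foliation_u: "invariant_foliation skew_map U.W U.E"
  unfolding invariant_foliation_def
proof (intro conjI allI U.foliation_tangent_W)
  fix y
  have "skew_inv ` U.W (skew_map y) = U.W y"
    using U.image_W[of skew_inv "skew_map y"] by (simp add: skew_inv_cover3 G_def skew_inv_map)
  then have "skew_map ` U.W y = skew_map ` skew_inv ` U.W (skew_map y)" by simp
  then show "skew_map ` U.W y = U.W (skew_map y)"
    by (simp add: image_image skew_map_inv)
qed

section \<open>Chains of strong leaves and their holonomies\<close>

abbreviation su_connected :: "torus3 \<Rightarrow> torus3 \<Rightarrow> bool" where
  "su_connected \<equiv> (su_segment S.W U.W)\<^sup>*\<^sup>*"

lemma su_segment_iff: "su_segment S.W U.W y z \<longleftrightarrow> z \<in> S.W y \<or> z \<in> U.W y"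
  using S.path_connected_W[of y] U.path_connected_W[of y] S.mem_W_self[of y] U.mem_W_self[of y]
  by (auto simp: su_segment_def path_connected_component dest: path_component_mem)

lemma su_segment_sym: "su_segment S.W U.W y z \<Longrightarrow> su_segment S.W U.W z y"
  unfolding su_segment_iff using S.W_eq U.W_eq S.mem_W_self U.mem_W_self by blast

lemma su_connected_sym: "su_connected y z \<Longrightarrow> su_connected z y"
  by (induction rule: rtranclp_induct) (auto intro: su_segment_sym converse_rtranclp_into_rtranclp)

lemma su_connected_s: "su_connected (cover3 (x, t)) (cover3 (x + s *\<^sub>R es, S.theta s x t))"
  using S.theta_mem_W by (simp add: su_segment_iff r_into_rtranclp)

lemma su_connected_u: "su_connected (cover3 (x, t)) (cover3 (x + s *\<^sub>R eu, U.theta s x t))"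
  using U.theta_mem_W by (simp add: su_segment_iff r_into_rtranclp)

text \<open>Holonomy along the quadrilateral with sides \<open>a\<close> along \<open>eu\<close>, \<open>b\<close> along \<open>es\<close>, and back, based at \<open>0\<close>.\<close>

definition su_loop :: "real \<Rightarrow> real \<Rightarrow> real \<Rightarrow> real" where
  "su_loop a b t = S.theta (- b) (b *\<^sub>R es)
    (U.theta (- a) (b *\<^sub>R es + a *\<^sub>R eu) (S.theta b (a *\<^sub>R eu) (U.theta a 0 t)))"

lemma su_loop_0: "su_loop 0 0 t = t"
  by (simp add: su_loop_def)

lemma cont_su_loop:
  assumes "continuous_on A f" "continuous_on A g" "continuous_on A h"
  shows "continuous_on A (\<lambda>z. su_loop (f z) (g z) (h z))"
  unfolding su_loop_def
  by (intro S.cont_theta U.cont_theta continuous_intros assms)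

lemma su_connected_loop: "su_connected (cover3 (0, t)) (cover3 (0, su_loop a b t))"
proof -
  let ?t1 = "U.theta a 0 t"
  let ?t2 = "S.theta b (a *\<^sub>R eu) ?t1"
  let ?t3 = "U.theta (- a) (b *\<^sub>R es + a *\<^sub>R eu) ?t2"
  have 1: "su_connected (cover3 (0, t)) (cover3 (a *\<^sub>R eu, ?t1))"
    using su_connected_u[of 0 t a] by simp
  have 2: "su_connected (cover3 (a *\<^sub>R eu, ?t1)) (cover3 (b *\<^sub>R es + a *\<^sub>R eu, ?t2))"
    using su_connected_s[of "a *\<^sub>R eu" ?t1 b] by (simp add: add.commute)
  have 3: "su_connected (cover3 (b *\<^sub>R es + a *\<^sub>R eu, ?t2)) (cover3 (b *\<^sub>R es, ?t3))"
    using su_connected_u[of "b *\<^sub>R es + a *\<^sub>R eu" ?t2 "- a"] by simp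
  have 4: "su_connected (cover3 (b *\<^sub>R es, ?t3)) (cover3 (0, su_loop a b t))"
    using su_connected_s[of "b *\<^sub>R es" ?t3 "- b"] by (simp add: su_loop_def)
  show ?thesis
    by (rule rtranclp_trans[OF rtranclp_trans[OF rtranclp_trans[OF 1 2] 3] 4])
qed

text \<open>Shrinking the loop sweeps out an interval of points accessible from \<open>t\<close>.
  One intermediate loop sends \<open>t\<close> to the midpoint of \<open>t\<close> and its image; by
  continuity it sends all nearby points into the same interval, hence they are accessible
  too.\<close>

lemma open_accessibility_class:
  assumes "su_loop a b t \<noteq> t"
  shows "\<exists>d>0. \<forall>s. \<bar>s - t\<bar> < d \<longrightarrow> su_connected (cover3 (0, t)) (cover3 (0, s))"
proof -
  let ?u = "su_loop a b t"
  let ?J = "(\<lambda>r. su_loop (r * a) (r * b) t) ` {0..1}"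
  have "connected ?J"
    by (intro connected_continuous_image cont_su_loop continuous_intros) auto
  then have J: "is_interval ?J" by (simp add: is_interval_connected_1)
  have ends: "t \<in> ?J" "?u \<in> ?J"
    using image_eqI[of t "\<lambda>r. su_loop (r * a) (r * b) t" 0 "{0..1}"]
      image_eqI[of ?u "\<lambda>r. su_loop (r * a) (r * b) t" 1 "{0..1}"] by (auto simp: su_loop_0)
  let ?m = "(t + ?u) / 2" and ?l = "\<bar>?u - t\<bar> / 2"
  have sub: "s \<in> ?J" if "\<bar>s - ?m\<bar> \<le> ?l" for s
  proof (cases "t \<le> ?u")
    case True
    then show ?thesis using mem_is_interval_1_I[OF J ends, of s] that by (auto simp: field_simps abs_le_iff)
  next
    case False
    then show ?thesis using mem_is_interval_1_I[OF J ends(2,1), of s] that by (auto simp: field_simps abs_le_iff)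
  qed
  have conn: "su_connected (cover3 (0, t)) (cover3 (0, s))" if "s \<in> ?J" for s
    using that su_connected_loop by auto
  obtain r where r: "?m = su_loop (r * a) (r * b) t"
    using sub[of ?m] by auto
  have "continuous_on UNIV (su_loop (r * a) (r * b))"
    by (intro cont_su_loop continuous_intros continuous_on_id)
  moreover have "0 < ?l" using assms by simp
  ultimately have "\<exists>d>0. \<forall>s. dist s t < d \<longrightarrow> dist (su_loop (r * a) (r * b) s) (su_loop (r * a) (r * b) t) < ?l"
    unfolding continuous_on_iff by blast
  then obtain d where d: "d > 0" "\<And>s. \<bar>s - t\<bar> < d \<Longrightarrow> \<bar>su_loop (r * a) (r * b) s - ?m\<bar> < ?l"
    unfolding r[symmetric] dist_real_def by auto
  have "su_connected (cover3 (0, t)) (cover3 (0, s))" if "\<bar>s - t\<bar> < d" for s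
    using conn[OF sub[OF less_imp_le[OF d(2)[OF that]]]] su_connected_sym[OF su_connected_loop[of s "r * a" "r * b"]]
    by (rule rtranclp_trans)
  with d(1) show ?thesis by blast
qed

text \<open>\<open>su_saturated w\<close>: the graph of \<open>w\<close> over the plane is a union of stable and of unstable leaves.\<close>

definition su_saturated :: "(real^2 \<Rightarrow> real) \<Rightarrow> bool" where
  "su_saturated w \<longleftrightarrow> (\<forall>v a. U.theta a v (w v) = w (v + a *\<^sub>R eu)) \<and>
    (\<forall>v b. S.theta b v (w v) = w (v + b *\<^sub>R es))"

text \<open>Transport from the fibre over 0, along \<open>eu\<close> first and \<open>es\<close>
  second. It is thus compatible with stable holonomy by construction; the unstable one requires
  trivial loops.\<close>

definition su_transport :: "real^2 \<Rightarrow> real \<Rightarrow> real" where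
  "su_transport v t = S.theta (cs v) (cu v *\<^sub>R eu) (U.theta (cu v) 0 t)"

lemma su_transport_strict_mono: "t < t' \<Longrightarrow> su_transport v t < su_transport v t'"
  unfolding su_transport_def by (intro S.theta_strict_mono U.theta_strict_mono)

lemma expansion_us: "cu v *\<^sub>R eu + cs v *\<^sub>R es = v"
  using basis_expansion_su[of v] by (simp add: add.commute)

lemma su_saturated_transport:
  assumes "su_saturated w"
  shows "w v = su_transport v (w 0)"
proof -
  have "U.theta (cu v) 0 (w 0) = w (cu v *\<^sub>R eu)"
    using assms by (simp add: su_saturated_def)
  then show ?thesis
    using assms by (simp add: su_transport_def su_saturated_def expansion_us)
qed

lemma su_saturated_less:
  assumes "su_saturated w" "su_saturated w'" "w 0 < w' 0"
  shows "w v < w' v"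
  using su_transport_strict_mono[OF assms(3), of v] assms(1,2)[THEN su_saturated_transport, of v] by simp

text \<open>Transport is strictly increasing, so graphs that differ over 0 are disjoint
  everywhere.\<close>

lemma su_saturated_eq:
  assumes "su_saturated w" "su_saturated w'" "w u = w' u"
  shows "w v = w' v"
proof -
  have "w 0 = w' 0"
    using su_saturated_less[OF assms(1,2), of u] su_saturated_less[OF assms(2,1), of u] assms(3)
    by (cases "w 0" "w' 0" rule: linorder_cases) auto
  then show ?thesis using assms(1,2)[THEN su_saturated_transport, of v] by simp
qed

lemma coordinate_shift:
  "cs (v + a *\<^sub>R eu) = cs v" "cu (v + a *\<^sub>R eu) = cu v + a"
  "cs (v + b *\<^sub>R es) = cs v + b" "cu (v + b *\<^sub>R es) = cu v"
  by (simp_all add: linear_add[OF linear_cs] linear_scale[OF linear_cs]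
      linear_add[OF linear_cu] linear_scale[OF linear_cu] coordinates)

text \<open>Trivial loops mean that both orders of transport agree. The order ending with
  \<open>es\<close> then yields stable saturation, and the order ending with \<open>eu\<close>
  unstable saturation.\<close>

lemma su_saturated_if_loops_trivial:
  assumes "\<And>a b. su_loop a b t = t"
  shows "su_saturated (\<lambda>v. su_transport v t)"
proof -
  have other: "su_transport v t = U.theta (cu v) (cs v *\<^sub>R es) (S.theta (cs v) 0 t)" for v
  proof -
    let ?a = "cu v" and ?b = "cs v"
    let ?r = "U.theta (- ?a) (?b *\<^sub>R es + ?a *\<^sub>R eu) (su_transport v t)"
    have "S.theta (- ?b) (?b *\<^sub>R es) ?r = t"
      using assms[of ?a ?b] by (simp add: su_loop_def su_transport_def)
    then have "S.theta ?b 0 t = ?r"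
      using S.theta_inverse(2)[of ?b 0 ?r] by simp
    then show ?thesis by simp
  qed
  show ?thesis
    unfolding su_saturated_def
  proof (intro conjI allI)
    fix v a
    show "U.theta a v (su_transport v t) = su_transport (v + a *\<^sub>R eu) t"
      unfolding other coordinate_shift
      using U.theta_flow[of a "cs v *\<^sub>R es" "cu v"] by (simp add: basis_expansion_su)
  next
    fix v b
    show "S.theta b v (su_transport v t) = su_transport (v + b *\<^sub>R es) t"
      unfolding su_transport_def coordinate_shift
      using S.theta_flow[of b "cu v *\<^sub>R eu" "cs v"] by (simp add: expansion_us)
  qed
qed

lemma su_saturated_translate:
  assumes "su_saturated w" "k \<in> lattice2"
  shows "su_saturated (\<lambda>v. w (v + k))"
proof -
  have "U.theta a (v + k) r = U.theta a v r" "S.theta a (v + k) r = S.theta a v r" for a v r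
    using U.theta_periodic[OF assms(2) lattice1_0] S.theta_periodic[OF assms(2) lattice1_0] by simp_all
  moreover have "v + a *\<^sub>R x + k = v + k + a *\<^sub>R x" for v x :: "real^2" and a
    by simp
  ultimately show ?thesis using assms(1) unfolding su_saturated_def by metis
qed

lemma Li_es: "Li (b *\<^sub>R es) = (b / mu) *\<^sub>R es"
proof -
  have "Lm ((b / mu) *\<^sub>R es) = b *\<^sub>R es"
    using mu_bounds by (simp add: linear_scale[OF linear_Lm] Lm_eigen)
  then show ?thesis by (metis Li_Lm)
qed

text \<open>The new function has as its graph the image of the old graph under \<open>F\<close>.
  Equivariance of the two holonomies shows that \<open>F\<close> carries leaves to leaves.\<close>

lemma su_saturated_push:
  assumes "su_saturated w"
  shows "su_saturated (\<lambda>v. phi (Li v) (w (Li v)))"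
  unfolding su_saturated_def
proof (intro conjI allI)
  fix v a
  have "psi (Li (v + a *\<^sub>R eu)) (U.theta a v (phi (Li v) (w (Li v)))) = U.theta (mu * a) (Li v) (w (Li v))"
    using U.theta_equivariant[of a v "phi (Li v) (w (Li v))"] by (simp add: psi_phi)
  also have "\<dots> = w (Li (v + a *\<^sub>R eu))"
    using assms by (simp add: su_saturated_def U.L_line)
  finally show "U.theta a v (phi (Li v) (w (Li v))) = phi (Li (v + a *\<^sub>R eu)) (w (Li (v + a *\<^sub>R eu)))"
    by (metis phi_psi)
next
  fix v b
  have "S.theta b v (phi (Li v) (w (Li v))) = phi (Li v + (b / mu) *\<^sub>R es) (S.theta (b / mu) (Li v) (w (Li v)))"
    using S.theta_equivariant[of "b / mu" "Li v" "w (Li v)"] mu_bounds by simp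
  also have "\<dots> = phi (Li (v + b *\<^sub>R es)) (w (Li (v + b *\<^sub>R es)))"
    using assms by (simp add: su_saturated_def linear_add[OF linear_Li] Li_es)
  finally show "S.theta b v (phi (Li v) (w (Li v))) = phi (Li (v + b *\<^sub>R es)) (w (Li (v + b *\<^sub>R es)))" .
qed

lemma phi_lattice: "k \<in> lattice2 \<Longrightarrow> phi k s = s"
  using phi_base_periodic[of k 0 s] by (simp add: phi_def)

text \<open>The graph and its image under \<open>F\<close> pass through the same point over 0, since
  the fibre there is pointwise fixed; hence they are equal.\<close>

lemma su_saturated_invariant:
  assumes "su_saturated w"
  shows "w (Lm v) = phi v (w v)"
proof -
  have "w 0 = phi (Li 0) (w (Li 0))"
    by (simp add: linear_0[OF linear_Li] phi_lattice lattice2_0)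
  from su_saturated_eq[OF assms su_saturated_push[OF assms] this, of "Lm v"]
  show ?thesis by simp
qed

text \<open>The fibre over \<open>0\<close> is pointwise fixed, so \<open>w\<close> agrees with its translate by \<open>2 k = Lm j - j\<close>;
  monotonicity of holonomies then excludes a nontrivial translation by \<open>k\<close>.\<close>

lemma su_saturated_periodic:
  assumes w: "su_saturated w" and lat: "k \<in> lattice2" "j \<in> lattice2" and j: "Lm j = j + k + k"
  shows "w (v + k) = w v"
proof -
  define w1 where "w1 v = w (v + k)" for v
  define w2 where "w2 v = w (v + (k + k))" for v
  have sat: "su_saturated w1" "su_saturated w2"
    unfolding w1_def w2_def by (intro su_saturated_translate w lat lattice2_add)+
  have "w2 j = w j"
    using su_saturated_invariant[OF w, of j] phi_lattice[OF lat(2)] by (simp add: w2_def j add.assoc)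
  then have "w2 0 = w 0" by (rule su_saturated_eq[OF sat(2) w])
  then have two: "w1 k = w 0" by (simp add: w1_def w2_def)
  have "w1 0 = w 0"
    using su_saturated_less[OF w sat(1), of k] su_saturated_less[OF sat(1) w, of k] two
    by (cases "w 0" "w1 0" rule: linorder_cases) (auto simp: w1_def)
  from su_saturated_eq[OF sat(1) w this, of v] show ?thesis by (simp add: w1_def)
qed

text \<open>The factor 1/4 is what the final contradiction needs: two displacements from 0 with
  coordinate sum below 1 change \<open>w\<close> by less than 1/4 each.\<close>

lemma theta_small: "\<bar>S.theta s x t - t\<bar> \<le> \<bar>s\<bar> / 4" "\<bar>U.theta s x t - t\<bar> \<le> \<bar>s\<bar> / 4"
proof -
  have "1 / 10 / (1 - mu * (10 / 9)) * \<bar>s\<bar> \<le> 1 / 4 * \<bar>s\<bar>" "1 / 10 / (1 - mu * (11 / 10)) * \<bar>s\<bar> \<le> 1 / 4 * \<bar>s\<bar>"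
    using mu_bounds by (intro mult_right_mono; simp add: field_simps)+
  then show "\<bar>S.theta s x t - t\<bar> \<le> \<bar>s\<bar> / 4" "\<bar>U.theta s x t - t\<bar> \<le> \<bar>s\<bar> / 4"
    using S.theta_bound[of s x t] U.theta_bound[of s x t] by linarith+
qed

lemma su_saturated_near:
  assumes "su_saturated w"
  shows "\<bar>w v - w 0\<bar> \<le> (\<bar>cs v\<bar> + \<bar>cu v\<bar>) / 4"
proof -
  have triangle: "\<bar>a - c\<bar> \<le> \<bar>a - b\<bar> + \<bar>b - c\<bar>" for a b c :: real by simp
  show ?thesis
    unfolding su_saturated_transport[OF assms, of v] su_transport_def add_divide_distrib
    by (rule order_trans[OF triangle add_mono[OF theta_small]])
qed

text \<open>At \<open>q1\<close> only the cosine term of \<open>phi\<close> survives and at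
  \<open>q2\<close> only the sine term. Fixedness of \<open>w\<close> there forces values an odd
  multiple of 1/2 apart, against a variation below 1/2; the cosine of the difference expresses this
  without integers.\<close>

lemma not_su_saturated: "\<not> su_saturated w"
proof
  assume w: "su_saturated w"
  define q1 q2 :: "real^2" where "q1 = vector [1 / 2, 0]" and "q2 = vector [0, 1 / 2]"
  have lat: "(vector [of_int a, of_int b] :: real^2) \<in> lattice2" for a b
    by (simp add: lattice2_def forall_2 vector_2)
  \<comment> \<open>Here \<open>?k1\<close> and \<open>?k2\<close> are the displacements of
    \<open>q1\<close> and \<open>q2\<close> under \<open>Lm\<close>, and \<open>?j1\<close>,
    \<open>?j2\<close> are twice these points, so that \<open>Lm j = j + k + k\<close>.\<close>
  let ?k1 = "vector [2, 1] :: real^2" and ?j1 = "vector [1, 0] :: real^2"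
  let ?k2 = "vector [1, 0] :: real^2" and ?j2 = "vector [0, 1] :: real^2"
  have "w (q1 + ?k1) = w q1"
    using lat[of 2 1] lat[of 1 0]
    by (intro su_saturated_periodic[OF w, of _ ?j1]) (simp_all add: Lm_def vec_eq_iff forall_2 vector_2)
  moreover have "q1 + ?k1 = Lm q1"
    by (simp add: Lm_def q1_def vec_eq_iff forall_2 vector_2)
  ultimately have "phi q1 (w q1) = w q1"
    using su_saturated_invariant[OF w, of q1] by simp
  then have c: "cos (pi * w q1) = 0"
    by (simp add: phi_def q1_def vector_2)
  have "w (q2 + ?k2) = w q2"
    using lat[of 1 0] lat[of 0 1]
    by (intro su_saturated_periodic[OF w, of _ ?j2]) (simp_all add: Lm_def vec_eq_iff forall_2 vector_2)
  moreover have "q2 + ?k2 = Lm q2"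
    by (simp add: Lm_def q2_def vec_eq_iff forall_2 vector_2)
  ultimately have "phi q2 (w q2) = w q2"
    using su_saturated_invariant[OF w, of q2] by simp
  then have s: "sin (pi * w q2) = 0"
    by (simp add: phi_def q2_def vector_2)
  have "\<bar>cs q1\<bar> + \<bar>cu q1\<bar> < 1" "\<bar>cs q2\<bar> + \<bar>cu q2\<bar> < 1"
    using sqrt2_bounds by (simp_all add: cs_def cu_def q1_def q2_def vector_2 add_divide_distrib)
  then have "(\<bar>cs q1\<bar> + \<bar>cu q1\<bar>) / 4 < 1 / 4" "(\<bar>cs q2\<bar> + \<bar>cu q2\<bar>) / 4 < 1 / 4"
    by (simp_all only: divide_strict_right_mono zero_less_numeral)
  from order_le_less_trans[OF su_saturated_near[OF w] this(1)]
    order_le_less_trans[OF su_saturated_near[OF w] this(2)]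
  have "\<bar>w q1 - w q2\<bar> < 1 / 2" by linarith
  then have "\<bar>pi * (w q1 - w q2)\<bar> < pi / 2"
    using pi_gt_zero by (simp add: abs_mult)
  then have "- (pi / 2) < pi * (w q1 - w q2)" "pi * (w q1 - w q2) < pi / 2"
    unfolding abs_less_iff by linarith+
  then have "0 < cos (pi * (w q1 - w q2))"
    by (rule cos_gt_zero_pi)
  moreover have "cos (pi * (w q1 - w q2)) = 0"
    using c s by (simp add: right_diff_distrib cos_diff)
  ultimately show False by simp
qed

text \<open>Every point of the fibre admits a nontrivial loop, so accessibility classes are open in
  the line; by symmetry complements are open as well, and connectedness finishes.\<close>

lemma su_connected_fiber: "su_connected (cover3 (0, 0)) (cover3 (0, t))"
proof -
  let ?A = "{t. su_connected (cover3 (0, 0)) (cover3 (0, t))}"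
  have near: "\<exists>d>0. \<forall>s. dist s t < d \<longrightarrow> su_connected (cover3 (0, t)) (cover3 (0, s))" for t
    using open_accessibility_class not_su_saturated su_saturated_if_loops_trivial
    unfolding dist_real_def by metis
  have "\<exists>d>0. \<forall>s. dist s t < d \<longrightarrow> s \<in> ?A" if t: "t \<in> ?A" for t
  proof -
    obtain d where "d > 0" "\<And>s. dist s t < d \<Longrightarrow> su_connected (cover3 (0, t)) (cover3 (0, s))"
      using near by blast
    then show ?thesis using t rtranclp_trans[of "su_segment S.W U.W" "cover3 (0, 0)"] by blast
  qed
  then have "open ?A" unfolding open_dist by blast
  moreover have "\<exists>d>0. \<forall>s. dist s t < d \<longrightarrow> s \<in> - ?A" if t: "t \<in> - ?A" for t
  proof -
    obtain d where "d > 0" "\<And>s. dist s t < d \<Longrightarrow> su_connected (cover3 (0, s)) (cover3 (0, t))"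
      using near su_connected_sym by blast
    then show ?thesis using t rtranclp_trans[of "su_segment S.W U.W" "cover3 (0, 0)"] by blast
  qed
  then have "open (- ?A)" unfolding open_dist by blast
  ultimately have "?A = {} \<or> ?A = UNIV" by (metis clopen closed_def)
  then show ?thesis by blast
qed

lemma su_connected_all: "su_connected y z"
proof -
  have "su_connected (cover3 (0, 0)) y" for y
  proof -
    obtain v r where y: "y = cover3 (v, r)" by (metis cover3_cases surj_pair)
    let ?s = "S.theta (- cs v) v r"
    let ?t = "U.theta (- cu v) (cu v *\<^sub>R eu) ?s"
    have "v + (- cs v) *\<^sub>R es = cu v *\<^sub>R eu"
      using basis_expansion_su[of v] by (simp add: algebra_simps)
    then have 1: "su_connected y (cover3 (cu v *\<^sub>R eu, ?s))"
      using su_connected_s[of v r "- cs v"] by (simp add: y)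
    have 2: "su_connected (cover3 (cu v *\<^sub>R eu, ?s)) (cover3 (0, ?t))"
      using su_connected_u[of "cu v *\<^sub>R eu" ?s "- cu v"] by simp
    show ?thesis
      by (rule rtranclp_trans[OF su_connected_fiber su_connected_sym[OF rtranclp_trans[OF 1 2]]])
  qed
  from rtranclp_trans[OF su_connected_sym[OF this[of y]] this[of z]] show ?thesis .
qed

lemma accessible_skew_map: "accessible skew_map"
  unfolding accessible_def
  using partially_hyperbolic_skew_map ph_splitting_skew_map invariant_foliation_s
    invariant_foliation_u su_connected_all by blast


section \<open>Chain recurrence\<close>

definition eps_step :: "real \<Rightarrow> torus3 \<Rightarrow> torus3 \<Rightarrow> bool" where
  "eps_step d y z \<longleftrightarrow> dist (skew_map y) z < d"

lemma chain_attainable_if_steps: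
  assumes "\<And>d. d > 0 \<Longrightarrow> (eps_step d)\<^sup>+\<^sup>+ y z"
  shows "chain_attainable skew_map y z"
  unfolding chain_attainable_def
proof (intro allI impI)
  fix d :: real assume "d > 0"
  then obtain n where "n > 0" "(eps_step d ^^ n) y z"
    using assms by (auto simp: tranclp_power)
  then show "\<exists>n\<ge>1. \<exists>u. u 0 = y \<and> u n = z \<and> (\<forall>i<n. dist (skew_map (u i)) (u (Suc i)) < d)"
    by (auto simp: relpowp_fun_conv eps_step_def Suc_le_eq)
qed

lemma eps_step_cover3:
  assumes "dist (F p) q < d"
  shows "eps_step d (cover3 p) (cover3 q)"
  using order_le_less_trans[OF dist_cover3_le assms] by (simp add: eps_step_def skew_map_cover3)

lemma eps_steps_orbit:
  assumes "d > 0"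
  shows "(eps_step d)\<^sup>*\<^sup>* (cover3 p) (cover3 ((F ^^ n) p))"
proof (induction n)
  case (Suc n)
  have "eps_step d (cover3 ((F ^^ n) p)) (cover3 ((F ^^ Suc n) p))"
    using assms by (intro eps_step_cover3) simp
  with Suc show ?case by (rule rtranclp.rtrancl_into_rtrancl)
qed simp

text \<open>The dynamics is the identity on this fibre, so jumps alone walk along it in equal steps
  shorter than \<open>d\<close>.\<close>

lemma eps_steps_fiber:
  assumes "d > 0"
  shows "(eps_step d)\<^sup>*\<^sup>* (cover3 (0, s)) (cover3 (0, s'))"
proof -
  obtain n :: nat where n: "\<bar>s' - s\<bar> / d < real n" using reals_Archimedean2 by blast
  define r where "r = (s' - s) / real n"
  have "0 \<le> \<bar>s' - s\<bar> / d" using assms by simp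
  with n have pos: "0 < real n" by linarith
  have r: "\<bar>r\<bar> < d" using n pos assms by (simp add: r_def field_simps)
  have "(eps_step d)\<^sup>*\<^sup>* (cover3 (0, s)) (cover3 (0, s + real k * r))" for k
  proof (induction k)
    case (Suc k)
    have "eps_step d (cover3 (0, s + real k * r)) (cover3 (0, s + real (Suc k) * r))"
      using r by (intro eps_step_cover3)
        (simp add: F_def linear_0[OF linear_Lm] phi_lattice lattice2_0 dist_Pair_Pair dist_real_def algebra_simps)
    with Suc show ?case by (rule rtranclp.rtrancl_into_rtrancl)
  qed simp
  from this[of n] show ?thesis using pos by (simp add: r_def)
qed

text \<open>\<open>(sqrt 2 - 1)\<^sup>n\<close> is a small positive element of \<open>\<int>[sqrt 2]\<close>, so its multiples come close to
  every real number.\<close>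

lemma sqrt2_power: "\<exists>p q :: int. (sqrt 2 - 1) ^ n = of_int p + of_int q * sqrt 2"
proof (induction n)
  case 0
  show ?case by (rule exI[of _ 1], rule exI[of _ 0]) simp
next
  case (Suc n)
  then obtain p q :: int where "(sqrt 2 - 1) ^ n = of_int p + of_int q * sqrt 2" by blast
  then have "(sqrt 2 - 1) ^ Suc n = of_int (2 * q - p) + of_int (p - q) * sqrt 2"
    by (simp add: algebra_simps)
  then show ?case by blast
qed

text \<open>Integer multiples of a lattice vector with small positive value under \<open>l\<close>
  come within that value of any real number. The factor 1/2 matches what \<open>cu\<close> and
  \<open>cs\<close> produce on suitable lattice vectors.\<close>

lemma lattice_dense:
  fixes l :: "real^2 \<Rightarrow> real"
  assumes "linear l" and v: "\<And>n. \<exists>v\<in>lattice2. l v = (sqrt 2 - 1) ^ n / 2" and "d > 0"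
  shows "\<exists>k\<in>lattice2. \<bar>l (x - k)\<bar> < d"
proof -
  have "(\<lambda>n. (sqrt 2 - 1) ^ n) \<longlonglongrightarrow> (0::real)"
    using sqrt2_bounds by (intro LIMSEQ_realpow_zero) auto
  then obtain n where n: "(sqrt 2 - 1) ^ n < d"
    using order_tendstoD(2)[OF _ \<open>d > 0\<close>] by (fastforce simp: eventually_sequentially)
  define h where "h = (sqrt 2 - 1) ^ n / 2"
  have "0 < h"
    using sqrt2_bounds by (simp add: h_def)
  then have h: "0 < h" "h < d"
    using n unfolding h_def by linarith+
  obtain v where v: "v \<in> lattice2" "l v = h" using v unfolding h_def by blast
  define m where "m = \<lfloor>l x / h\<rfloor>"
  have "of_int m *\<^sub>R v \<in> lattice2"
    using v(1) by (simp add: lattice2_def)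
  moreover have "l (x - of_int m *\<^sub>R v) = l x - of_int m * h"
    by (simp add: linear_diff[OF assms(1)] linear_scale[OF assms(1)] v(2))
  moreover have "of_int m \<le> l x / h" "l x / h < of_int m + 1"
    unfolding m_def by (rule of_int_floor_le, rule real_of_int_floor_add_one_gt)
  then have "of_int m * h \<le> l x" "l x < (of_int m + 1) * h"
    using h by (simp_all add: pos_le_divide_eq pos_divide_less_eq)
  ultimately show ?thesis
    using h by (intro bexI[of _ "of_int m *\<^sub>R v"]) (auto simp: algebra_simps abs_less_iff)
qed

lemma cu_lattice_dense:
  assumes "d > 0"
  shows "\<exists>k\<in>lattice2. \<bar>cu (x - k)\<bar> < d"
proof (rule lattice_dense[OF linear_cu _ assms])
  fix n
  obtain p q :: int where "(sqrt 2 - 1) ^ n = of_int p + of_int q * sqrt 2"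
    using sqrt2_power by blast
  then show "\<exists>v\<in>lattice2. cu v = (sqrt 2 - 1) ^ n / 2"
    \<comment> \<open>The second entry solves \<open>cu v = (p + q * sqrt 2) / 2\<close>; the
      analogous equation for \<open>cs\<close> gives the other witness.\<close>
    by (intro bexI[of _ "vector [of_int p, 2 * of_int q - of_int p]"])
      (simp_all add: cu_def vector_2 algebra_simps lattice2_def forall_2)
qed

lemma cs_lattice_dense:
  assumes "d > 0"
  shows "\<exists>k\<in>lattice2. \<bar>cs (x - k)\<bar> < d"
proof (rule lattice_dense[OF linear_cs _ assms])
  fix n
  obtain p q :: int where "(sqrt 2 - 1) ^ n = of_int p + of_int q * sqrt 2"
    using sqrt2_power by blast
  then show "\<exists>v\<in>lattice2. cs v = (sqrt 2 - 1) ^ n / 2"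
    by (intro bexI[of _ "vector [of_int p - 2 * of_int q, of_int p]"])
      (simp_all add: cs_def vector_2 algebra_simps lattice2_def forall_2)
qed

lemma cover3_base_shift: "k \<in> lattice2 \<Longrightarrow> cover3 (x - k, t) = cover3 (x, t)"
  by (simp add: cover3_eq_iff lattice3_def lattice1_0 lattice2_minus)

lemma mu_power_small:
  assumes "d > 0"
  shows "\<exists>n. mu ^ n * c < d"
proof -
  have "(\<lambda>n. mu ^ n * c) \<longlonglongrightarrow> 0 * c"
    using mu_bounds by (intro tendsto_mult_right LIMSEQ_realpow_zero) auto
  then show ?thesis
    using order_tendstoD(2)[of _ "0 * c" sequentially d] assms by (fastforce simp: eventually_sequentially)
qed

section \<open>Chains along the stable and unstable lines through the origin\<close>

lemma F_funpow_stable: "\<exists>u. (F ^^ n) (b *\<^sub>R es, t) = ((mu ^ n * b) *\<^sub>R es, u)"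
proof (induction n)
  case (Suc n)
  then obtain u where "(F ^^ n) (b *\<^sub>R es, t) = ((mu ^ n * b) *\<^sub>R es, u)" by blast
  then have "(F ^^ Suc n) (b *\<^sub>R es, t) = F ((mu ^ n * b) *\<^sub>R es, u)" by simp
  then show ?case by (simp only:) (simp add: F_def linear_scale[OF linear_Lm] Lm_eigen mult_ac)
qed simp

lemma G_funpow_unstable: "\<exists>u. (G ^^ n) (b *\<^sub>R eu, t) = ((mu ^ n * b) *\<^sub>R eu, u)"
proof (induction n)
  case (Suc n)
  then obtain u where "(G ^^ n) (b *\<^sub>R eu, t) = ((mu ^ n * b) *\<^sub>R eu, u)" by blast
  then have "(G ^^ Suc n) (b *\<^sub>R eu, t) = G ((mu ^ n * b) *\<^sub>R eu, u)" by simp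
  then show ?case by (simp only:) (simp add: G_def linear_scale[OF linear_Li] Li_eigen mult_ac)
qed simp

lemma F_G_funpow: "(F ^^ n) ((G ^^ n) p) = p"
  by (induction n arbitrary: p) (simp_all add: funpow_swap1[of F])

lemma Lm_eu: "Lm eu = inverse mu *\<^sub>R eu"
proof -
  have "mu *\<^sub>R Lm eu = eu"
    unfolding linear_scale[OF linear_Lm, symmetric] Li_eigen[symmetric] by simp
  then show ?thesis using mu_bounds by (intro scaleR_solve) auto
qed

text \<open>A lattice translation brings the base point close to the stable line of 0. One jump
  lands on that line, the orbit contracts along it, and a last jump reaches the fibre.\<close>

lemma eps_steps_to_fiber:
  assumes "d > 0"
  shows "\<exists>s. (eps_step d)\<^sup>+\<^sup>+ (cover3 (x, t)) (cover3 (0, s))"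
proof -
  \<comment> \<open>The jump is measured after applying \<open>F\<close>, which stretches the
    unstable coordinate by \<open>inverse mu\<close>; the \<open>+ 1\<close> makes positivity of the
    denominator immediate.\<close>
  have "0 < d / (inverse mu * (norm eu + 1))"
    using assms mu_bounds norm_ge_zero[of eu] by (intro divide_pos_pos mult_pos_pos add_nonneg_pos) auto
  then obtain k where k: "k \<in> lattice2" "\<bar>cu (x - k)\<bar> < d / (inverse mu * (norm eu + 1))"
    using cu_lattice_dense by blast
  define a b where "a = cu (x - k)" and "b = cs (x - k)"
  have xk: "x - k = b *\<^sub>R es + a *\<^sub>R eu" by (simp add: a_def b_def basis_expansion_su)
  have small: "\<bar>a\<bar> * (inverse mu * norm eu) < d"
  proof -
    have "\<bar>a\<bar> * (inverse mu * norm eu) \<le> \<bar>a\<bar> * (inverse mu * (norm eu + 1))"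
      using mu_bounds by (intro mult_left_mono) auto
    also have "\<dots> < d"
      using k(2) mu_bounds norm_ge_zero[of eu] by (simp add: a_def pos_less_divide_eq add_nonneg_pos)
    finally show ?thesis .
  qed
  define z where "z = ((mu * b) *\<^sub>R es, phi (x - k) t)"
  have "F (x - k, t) = ((mu * b) *\<^sub>R es + (a * inverse mu) *\<^sub>R eu, phi (x - k) t)"
    unfolding F_def xk
    by (simp add: linear_add[OF linear_Lm] linear_scale[OF linear_Lm] Lm_eigen Lm_eu mult_ac)
  then have "dist (F (x - k, t)) z = \<bar>a\<bar> * (inverse mu * norm eu)"
    using mu_bounds by (simp add: z_def dist_Pair_Pair dist_norm abs_mult)
  then have 1: "eps_step d (cover3 (x, t)) (cover3 z)"
    using eps_step_cover3[of "(x - k, t)" z d] small cover3_base_shift[OF k(1)] by simp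
  obtain n where n: "mu ^ n * (\<bar>mu * (mu * b)\<bar> * norm es) < d"
    using mu_power_small[OF assms] by blast
  obtain u where u: "(F ^^ Suc n) z = ((mu ^ Suc n * (mu * b)) *\<^sub>R es, u)"
    unfolding z_def using F_funpow_stable by blast
  have "dist ((F ^^ Suc n) z) (0, u) = mu ^ n * (\<bar>mu * (mu * b)\<bar> * norm es)"
    unfolding u using mu_bounds by (simp add: dist_Pair_Pair abs_mult)
  then have "eps_step d (cover3 ((F ^^ n) z)) (cover3 (0, u))"
    using n by (intro eps_step_cover3) simp
  with 1 eps_steps_orbit[OF assms, of z n] have "(eps_step d)\<^sup>+\<^sup>+ (cover3 (x, t)) (cover3 (0, u))"
    by (meson rtranclp_into_tranclp1 rtranclp_into_tranclp2 rtranclp_trans r_into_rtranclp tranclp_rtranclp_tranclp rtranclp_tranclp_tranclp)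
  then show ?thesis by blast
qed

text \<open>Read backwards: the target is near the unstable line of 0, and backward orbits on that
  line converge to the fibre. A jump leaves the fibre, the orbit follows the line outwards, and a
  second jump hits the target.\<close>

lemma eps_steps_from_fiber:
  assumes "d > 0"
  shows "\<exists>s. (eps_step d)\<^sup>+\<^sup>+ (cover3 (0, s)) (cover3 (x, t))"
proof -
  have "0 < d / (norm es + 1)"
    using assms norm_ge_zero[of es] by (intro divide_pos_pos add_nonneg_pos) auto
  then obtain k where k: "k \<in> lattice2" "\<bar>cs (x - k)\<bar> < d / (norm es + 1)"
    using cs_lattice_dense by blast
  define a b where "a = cs (x - k)" and "b = cu (x - k)"
  have xk: "x - k = a *\<^sub>R es + b *\<^sub>R eu" by (simp add: a_def b_def basis_expansion_su)
  have small: "\<bar>a\<bar> * norm es < d"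
  proof -
    have "\<bar>a\<bar> * norm es \<le> \<bar>a\<bar> * (norm es + 1)"
      by (intro mult_left_mono) auto
    also have "\<dots> < d"
      using k(2) norm_ge_zero[of es] by (simp add: a_def pos_less_divide_eq add_nonneg_pos)
    finally show ?thesis .
  qed
  define w where "w = G (b *\<^sub>R eu, t)"
  have "dist (F w) (x - k, t) = \<bar>a\<bar> * norm es"
    by (simp add: w_def xk dist_Pair_Pair dist_norm)
  then have 3: "eps_step d (cover3 w) (cover3 (x, t))"
    using eps_step_cover3[of w "(x - k, t)" d] small cover3_base_shift[OF k(1)] by simp
  obtain n where n: "mu ^ n * (\<bar>mu * b\<bar> * norm eu) < d"
    using mu_power_small[OF assms] by blast
  obtain u where u: "(G ^^ n) w = ((mu ^ n * (mu * b)) *\<^sub>R eu, u)"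
    using G_funpow_unstable[of n "mu * b" "snd w"]
    by (auto simp: w_def G_def linear_scale[OF linear_Li] Li_eigen mult.commute)
  have "F (0, u) = (0, u)"
    by (simp add: F_def linear_0[OF linear_Lm] phi_lattice lattice2_0)
  then have "dist (F (0, u)) ((G ^^ n) w) = mu ^ n * (\<bar>mu * b\<bar> * norm eu)"
    unfolding u using mu_bounds by (simp add: dist_Pair_Pair abs_mult)
  then have 1: "eps_step d (cover3 (0, u)) (cover3 ((G ^^ n) w))"
    using n by (intro eps_step_cover3) simp
  have 2: "(eps_step d)\<^sup>*\<^sup>* (cover3 ((G ^^ n) w)) (cover3 w)"
    using eps_steps_orbit[OF assms, of "(G ^^ n) w" n] by (simp add: F_G_funpow)
  from rtranclp_into_tranclp1[OF converse_rtranclp_into_rtranclp[of "eps_step d", OF 1 2] 3]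
  show ?thesis by blast
qed

lemma chain_transitive_skew_map: "chain_transitive skew_map"
  unfolding chain_transitive_def chain_recurrent_def
proof (intro allI chain_attainable_if_steps)
  fix y and d :: real assume d: "d > 0"
  obtain x t where y: "y = cover3 (x, t)" by (metis cover3_cases surj_pair)
  obtain s s' where s: "(eps_step d)\<^sup>+\<^sup>+ y (cover3 (0, s))" and s': "(eps_step d)\<^sup>+\<^sup>+ (cover3 (0, s')) y"
    using eps_steps_to_fiber[OF d] eps_steps_from_fiber[OF d] unfolding y by blast
  from tranclp_rtranclp_tranclp[OF s eps_steps_fiber[OF d]] s'
  show "(eps_step d)\<^sup>+\<^sup>+ y y" by (rule tranclp_trans)
qed

section \<open>Failure of transitivity\<close>

lemma not_transitive_skew_map: "\<not> topologically_transitive skew_map"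
proof
  assume trans: "topologically_transitive skew_map"
  define A where "A = cover3 ` (UNIV \<times> {0<..<1})"
  define B where "B = cover3 ` (UNIV \<times> {1<..<2})"
  have "open A" "open B"
    unfolding A_def B_def by (intro open_cover3 open_Times open_UNIV open_greaterThanLessThan)+
  moreover have "A \<noteq> {}" "B \<noteq> {}"
    using greaterThanLessThan_empty_iff[of 0 "1::real"] greaterThanLessThan_empty_iff[of 1 "2::real"]
    by (auto simp: A_def B_def)
  ultimately obtain n where n: "(skew_map ^^ n) ` A \<inter> B \<noteq> {}"
    using trans unfolding topologically_transitive_def by blast
  have "skew_map y \<in> A" if yA: "y \<in> A" for y
  proof -
    obtain x t where y: "y = cover3 (x, t)" "0 < t" "t < 1"
      using yA by (auto simp: A_def)
    \<comment> \<open>At \<open>t = 0\<close> only the nonnegative cosine term remains, and at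
      \<open>t = 1\<close> the same term with the opposite sign; monotonicity then traps the open
      interval.\<close>
    have "0 \<le> phi x 0" "phi x 1 \<le> 1"
      by (simp_all add: phi_def)
    then have "0 < phi x t" "phi x t < 1"
      using phi_strict_mono[OF y(2), of x] phi_strict_mono[OF y(3), of x] by linarith+
    then show ?thesis by (auto simp: y skew_map_cover3 F_def A_def)
  qed
  then have "(skew_map ^^ n) y \<in> A" if "y \<in> A" for y
    using that by (induction n) simp_all
  with n obtain y where "y \<in> A" "y \<in> B" by blast
  then obtain x t x' t' where "cover3 (x, t) = cover3 (x', t')" "0 < t" "t < 1" "1 < t'" "t' < 2"
    by (auto simp: A_def B_def)
  then have "t - t' = 0"
    by (intro lattice1_discrete) (auto simp: cover3_eq_iff lattice3_def)
  with \<open>t < 1\<close> \<open>1 < t'\<close> show False by simp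
qed

theorem theorem1:
  shows "\<exists>(A :: int^2^2) (f :: torus3 \<Rightarrow> torus3).
    hyperbolic_matrix A \<and> smooth_diffeo f \<and> ph_skew_product A f \<and>
    accessible f \<and> chain_transitive f \<and> \<not> topologically_transitive f"
  using hyperbolic_cat_matrix smooth_diffeo_skew_map ph_skew_product_skew_map
    accessible_skew_map chain_transitive_skew_map not_transitive_skew_map by blast

end
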